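(* Fix $m\ge 1$, a probability vector $\mathbf p=(p_1,\dots,p_m)$ with all $p_i>0$, and positive integers $m_i$ ($1\le i\le m$) and $m_{ij}$ ($1\le i\le m$, $1\le j\le m_i$). There exists $\varepsilon>0$ such that for every admissible family of numbers $(a_{ijk}, b_{ij}, c_{ijk}, d_{ij})$ (as defined in the context) satisfying the genericity hypothesis (G) for each $t\in[0,1]$ there exist $1\le i\le m$ and $1\le j<j'\le m_i$ with $\sum_{k=1}^{m_{ij}} a_{ijk}^t\neq\sum_{k=1}^{m_{ij'}} a_{ij'k}^t$, and at least one of the two hypotheses (R1) for each $i\in\{1,\dots,m\}$ there exist numbers $0<a_i\le b_i<1$ such that $(1+\varepsilon)^{-1}<\frac{b_{ij}}{b_i}<1+\varepsilon$ and $(1+\varepsilon)^{-1}<\frac{a_{ijk}}{a_i}<1+\varepsilon$ for all $(j,k)\in\mathcal J_i$; (R2) $\frac{b_{ij}}{a_{ijk}}<1+\varepsilon$ for all $i\in\{1,\dots,m\}$ and all $(j,k)\in\mathcal J_i$; there exists a collection $\mathbf P^*=(p^*_{ij})_{1\le i\le m,\,1\le j\le m_i}$ of non-negative numbers with $\sum_{j=1}^{m_i}p^*_{ij}=p_i$ for all $i$, such that $$\dim_{\mathrm H}\Lambda_{\mathbf i}=\dim_{\mathrm H}\mu_{\mathbf P^*,\mathbf i}\quad\text{for }\mathbf p\text{-a.e. }\mathbf i\in\mathcal I.$$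
   Context: $\dim_{\mathrm H}$ denotes Hausdorff dimension; for a Borel probability measure $\mu$ on $\mathbb R^2$, $\dim_{\mathrm H}\mu=\inf\{\dim_{\mathrm H}F:\mu(F)=1\}$. $\mathcal I=\{1,\dots,m\}^{\mathbb N}$ is equipped with the Bernoulli (product) measure given by the probability vector $\mathbf p$; "$\mathbf p$-a.e. $\mathbf i$" refers to this measure. Put $\mathcal J_i=\{(j,k): 1\le j\le m_i,\ 1\le k\le m_{ij}\}$. An admissible family consists of real numbers $a_{ijk},b_{ij},c_{ijk},d_{ij}$ ($1\le i\le m$, $(j,k)\in\mathcal J_i$) such that: - $0<a_{ijk}\le b_{ij}<1$, $\sum_{j=1}^{m_i}b_{ij}\le1$, and $\sum_{k=1}^{m_{ij}}a_{ijk}\le 1$; - $0\le d_{i1}<d_{i2}<\dots<d_{im_i}<1$, $d_{i(j+1)}-d_{ij}\ge b_{ij}$, and $1-d_{im_i}\ge b_{im_i}$; - $0\le c_{ij1}<c_{ij2}<\dots<c_{ijm_{ij}}<1$, $c_{ij(k+1)}-c_{ijk}\ge a_{ijk}$, and $1-c_{ijm_{ij}}\ge a_{ijm_{ij}}$. Let $A_{ijk}:\mathbb R^2\to\mathbb R^2$ be the affine map $A_{ijk}(x)=\begin{pmatrix}a_{ijk}&0\\0&b_{ij}\end{pmatrix}x+\begin{pmatrix}c_{ijk}\\d_{ij}\end{pmatrix}$. For $\mathbf i=(i_1,i_2,\dots)\in\mathcal I$ let $$\Lambda_{\mathbf i}=\bigcap_{n=1}^\infty\ \bigcup_{(j_1,k_1)\in\mathcal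 J_{i_1},\dots,(j_n,k_n)\in\mathcal J_{i_n}}A_{i_1j_1k_1}\circ\cdots\circ A_{i_nj_nk_n}([0,1]^2).$$ For a collection $\mathbf P=(p_{ij})$ of non-negative numbers with $\sum_{j=1}^{m_i}p_{ij}=p_i$ for all $i$, $t(\mathbf P)$ is the unique real number in $[0,1]$ satisfying $\sum_{i,j}p_{ij}\log\Bigl(\sum_{k=1}^{m_{ij}}a_{ijk}^{t(\mathbf P)}\Bigr)=0$. For $\mathbf i\in\mathcal I$ let $\Omega_{\mathbf i}=\prod_{n=1}^\infty\mathcal J_{i_n}$, with elements $\omega=(\omega_1,\omega_2,\dots)$, $\omega_n=(j_n,k_n)$. The map $\chi_{\mathbf i}:\Omega_{\mathbf i}\to\Lambda_{\mathbf i}$ sends $\omega$ to the unique point of $\bigcap_{n\ge1}A_{i_1j_1k_1}\circ\cdots\circ A_{i_nj_nk_n}([0,1]^2)$. The measure $\tilde\mu_{\mathbf P,\mathbf i}$ is the product probability measure on $\Omega_{\mathbf i}$ giving the cylinder $\{\omega':\omega'_l=\omega_l,\ l=1,\dots,n\}$ the mass $$\prod_{l=1}^n\frac{p_{i_lj_l}}{p_{i_l}}\,\frac{a_{i_lj_lk_l}^{t(\mathbf P)}}{\sum_ka_{i_lj_lk}^{t(\mathbf P)}},$$ and $\mu_{\mathbf P,\mathbf i}=\tilde\mu_{\mathbf P,\mathbf i}\circ\chi_{\mathbf i}^{-1}$ is its pushforward to $\Lambda_{\mathbf i}$. *)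

theory Defs
  imports "HOL-Probability.Probability"
begin

section \<open>Hausdorff dimension\<close>

(* Since diameter is a junk value on unbounded sets, the covering sets are required to be bounded. *)

definition hausdorff_premeasure :: "real \<Rightarrow> real \<Rightarrow> 'a::metric_space set \<Rightarrow> ennreal" where
  "hausdorff_premeasure \<delta> s E =
     Inf {(\<Sum>n. ennreal (diameter (U n) powr s)) | U :: nat \<Rightarrow> 'a set.
            E \<subseteq> (\<Union>n. U n) \<and> (\<forall>n. bounded (U n) \<and> diameter (U n) \<le> \<delta>)}"

definition hausdorff_measure :: "real \<Rightarrow> 'a::metric_space set \<Rightarrow> ennreal" where
  "hausdorff_measure s E = (SUP \<delta>\<in>{0<..}. hausdorff_premeasure \<delta> s E)"

(* Only exponents s > 0 are used: then 0 powr s = 0, no convention for the 0-th power of 0 is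
   needed, and the infimum is the same as over s \<ge> 0. *)

definition hausdorff_dim :: "'a::metric_space set \<Rightarrow> ennreal" where
  "hausdorff_dim E = Inf {ennreal s | s. 0 < s \<and> hausdorff_measure s E = 0}"

definition hausdorff_dim_measure :: "'a::metric_space measure \<Rightarrow> ennreal" where
  "hausdorff_dim_measure \<mu> = Inf {hausdorff_dim F | F. F \<in> sets \<mu> \<and> emeasure \<mu> F = 1}"

section \<open>Random self-affine carpets\<close>

(* M i and N i j stand for m_i and m_ij. Letters i, j, k are numbered from 1 as usual, but the
   positions in an infinite sequence from 0: the letter written i_(n+1) is "seq n". All parameter
   functions are relevant only on their index ranges. *)

definition row_col :: "(nat \<Rightarrow> nat) \<Rightarrow> (nat \<Rightarrow> nat \<Rightarrow> nat) \<Rightarrow> nat \<Rightarrow> (nat \<times> nat) set" where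
  "row_col M N i = (SIGMA j:{1..M i}. {1..N i j})"

definition admissible ::
  "nat \<Rightarrow> (nat \<Rightarrow> nat) \<Rightarrow> (nat \<Rightarrow> nat \<Rightarrow> nat) \<Rightarrow>
   (nat \<Rightarrow> nat \<Rightarrow> nat \<Rightarrow> real) \<Rightarrow> (nat \<Rightarrow> nat \<Rightarrow> real) \<Rightarrow>
   (nat \<Rightarrow> nat \<Rightarrow> nat \<Rightarrow> real) \<Rightarrow> (nat \<Rightarrow> nat \<Rightarrow> real) \<Rightarrow> bool" where
  "admissible m M N a b c d \<longleftrightarrow>
     (\<forall>i\<in>{1..m}.
        (\<forall>(j, k)\<in>row_col M N i. 0 < a i j k \<and> a i j k \<le> b i j \<and> b i j < 1) \<and>
        (\<Sum>j=1..M i. b i j) \<le> 1 \<and>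
        (\<forall>j\<in>{1..M i}. (\<Sum>k=1..N i j. a i j k) \<le> 1) \<and>
        0 \<le> d i 1 \<and> d i (M i) < 1 \<and>
        (\<forall>j\<in>{1..<M i}. d i j < d i (j + 1) \<and> d i (j + 1) - d i j \<ge> b i j) \<and>
        1 - d i (M i) \<ge> b i (M i) \<and>
        (\<forall>j\<in>{1..M i}.
           0 \<le> c i j 1 \<and> c i j (N i j) < 1 \<and>
           (\<forall>k\<in>{1..<N i j}. c i j k < c i j (k + 1) \<and> c i j (k + 1) - c i j k \<ge> a i j k) \<and>
           1 - c i j (N i j) \<ge> a i j (N i j)))"

definition affine_piece ::
  "(nat \<Rightarrow> nat \<Rightarrow> nat \<Rightarrow> real) \<Rightarrow> (nat \<Rightarrow> nat \<Rightarrow> real) \<Rightarrow>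
   (nat \<Rightarrow> nat \<Rightarrow> nat \<Rightarrow> real) \<Rightarrow> (nat \<Rightarrow> nat \<Rightarrow> real) \<Rightarrow>
   nat \<Rightarrow> nat \<times> nat \<Rightarrow> real \<times> real \<Rightarrow> real \<times> real" where
  "affine_piece a b c d i = (\<lambda>(j, k) (x, y). (a i j k * x + c i j k, b i j * y + d i j))"

primrec affine_word ::
  "(nat \<Rightarrow> nat \<Rightarrow> nat \<Rightarrow> real) \<Rightarrow> (nat \<Rightarrow> nat \<Rightarrow> real) \<Rightarrow>
   (nat \<Rightarrow> nat \<Rightarrow> nat \<Rightarrow> real) \<Rightarrow> (nat \<Rightarrow> nat \<Rightarrow> real) \<Rightarrow>
   (nat \<Rightarrow> nat) \<Rightarrow> (nat \<Rightarrow> nat \<times> nat) \<Rightarrow> nat \<Rightarrow> real \<times> real \<Rightarrow> real \<times> real" where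
  "affine_word a b c d seq \<omega> 0 = id"
| "affine_word a b c d seq \<omega> (Suc n) =
     affine_word a b c d seq \<omega> n \<circ> affine_piece a b c d (seq n) (\<omega> n)"

definition unit_square :: "(real \<times> real) set" where
  "unit_square = {0..1} \<times> {0..1}"

definition limit_set ::
  "(nat \<Rightarrow> nat) \<Rightarrow> (nat \<Rightarrow> nat \<Rightarrow> nat) \<Rightarrow>
   (nat \<Rightarrow> nat \<Rightarrow> nat \<Rightarrow> real) \<Rightarrow> (nat \<Rightarrow> nat \<Rightarrow> real) \<Rightarrow>
   (nat \<Rightarrow> nat \<Rightarrow> nat \<Rightarrow> real) \<Rightarrow> (nat \<Rightarrow> nat \<Rightarrow> real) \<Rightarrow>
   (nat \<Rightarrow> nat) \<Rightarrow> (real \<times> real) set" where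
  "limit_set M N a b c d seq =
     (\<Inter>n\<in>{1..}. \<Union>\<omega>\<in>(\<Pi>\<^sub>E l\<in>{..<n}. row_col M N (seq l)).
        affine_word a b c d seq \<omega> n ` unit_square)"

definition bernoulli_measure :: "nat \<Rightarrow> (nat \<Rightarrow> real) \<Rightarrow> (nat \<Rightarrow> nat) measure" where
  "bernoulli_measure m p = (\<Pi>\<^sub>M n\<in>UNIV. point_measure {1..m} (\<lambda>i. ennreal (p i)))"

definition t_exponent ::
  "nat \<Rightarrow> (nat \<Rightarrow> nat) \<Rightarrow> (nat \<Rightarrow> nat \<Rightarrow> nat) \<Rightarrow>
   (nat \<Rightarrow> nat \<Rightarrow> nat \<Rightarrow> real) \<Rightarrow> (nat \<Rightarrow> nat \<Rightarrow> real) \<Rightarrow> real" where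
  "t_exponent m M N a P =
     (THE t. t \<in> {0..1} \<and>
        (\<Sum>i=1..m. \<Sum>j=1..M i. P i j * ln (\<Sum>k=1..N i j. a i j k powr t)) = 0)"

definition coding_map ::
  "(nat \<Rightarrow> nat \<Rightarrow> nat \<Rightarrow> real) \<Rightarrow> (nat \<Rightarrow> nat \<Rightarrow> real) \<Rightarrow>
   (nat \<Rightarrow> nat \<Rightarrow> nat \<Rightarrow> real) \<Rightarrow> (nat \<Rightarrow> nat \<Rightarrow> real) \<Rightarrow>
   (nat \<Rightarrow> nat) \<Rightarrow> (nat \<Rightarrow> nat \<times> nat) \<Rightarrow> real \<times> real" where
  "coding_map a b c d seq \<omega> =
     (THE x. x \<in> (\<Inter>n\<in>{1..}. affine_word a b c d seq \<omega> n ` unit_square))"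

definition letter_weight ::
  "nat \<Rightarrow> (nat \<Rightarrow> real) \<Rightarrow> (nat \<Rightarrow> nat) \<Rightarrow> (nat \<Rightarrow> nat \<Rightarrow> nat) \<Rightarrow>
   (nat \<Rightarrow> nat \<Rightarrow> nat \<Rightarrow> real) \<Rightarrow> (nat \<Rightarrow> nat \<Rightarrow> real) \<Rightarrow>
   nat \<Rightarrow> nat \<times> nat \<Rightarrow> real" where
  "letter_weight m p M N a P i = (\<lambda>(j, k).
     let t = t_exponent m M N a P
     in P i j / p i * (a i j k powr t / (\<Sum>k'=1..N i j. a i j k' powr t)))"

definition symbolic_measure ::
  "nat \<Rightarrow> (nat \<Rightarrow> real) \<Rightarrow> (nat \<Rightarrow> nat) \<Rightarrow> (nat \<Rightarrow> nat \<Rightarrow> nat) \<Rightarrow>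
   (nat \<Rightarrow> nat \<Rightarrow> nat \<Rightarrow> real) \<Rightarrow> (nat \<Rightarrow> nat \<Rightarrow> real) \<Rightarrow>
   (nat \<Rightarrow> nat) \<Rightarrow> (nat \<Rightarrow> nat \<times> nat) measure" where
  "symbolic_measure m p M N a P seq =
     (\<Pi>\<^sub>M n\<in>UNIV. point_measure (row_col M N (seq n))
        (\<lambda>w. ennreal (letter_weight m p M N a P (seq n) w)))"

(* The push-forward is taken as a Borel measure on the plane; it is concentrated on the limit set. *)

definition carpet_measure ::
  "nat \<Rightarrow> (nat \<Rightarrow> real) \<Rightarrow> (nat \<Rightarrow> nat) \<Rightarrow> (nat \<Rightarrow> nat \<Rightarrow> nat) \<Rightarrow>
   (nat \<Rightarrow> nat \<Rightarrow> nat \<Rightarrow> real) \<Rightarrow> (nat \<Rightarrow> nat \<Rightarrow> real) \<Rightarrow>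
   (nat \<Rightarrow> nat \<Rightarrow> nat \<Rightarrow> real) \<Rightarrow> (nat \<Rightarrow> nat \<Rightarrow> real) \<Rightarrow>
   (nat \<Rightarrow> nat \<Rightarrow> real) \<Rightarrow> (nat \<Rightarrow> nat) \<Rightarrow> (real \<times> real) measure" where
  "carpet_measure m p M N a b c d P seq =
     distr (symbolic_measure m p M N a P seq) borel (coding_map a b c d seq)"

end

theory Submission
  imports Defs "HOL-Real_Asymp.Real_Asymp"
begin

text \<open>
  Let \<open>\<lambda>(P)\<close> be the quotient of \<open>\<Sum> p\<^sub>i\<^sub>j ln (p\<^sub>i\<^sub>j / p\<^sub>i)\<close> by \<open>\<Sum> p\<^sub>i\<^sub>j ln b\<^sub>i\<^sub>j\<close>. The continuous function
  \<open>\<lambda>(P) + t(P)\<close> attains its maximum \<open>D\<close> on the compact set of admissible vectors, at \<open>P\<^sup>*\<close> say, and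
  for every sequence whose letter frequencies converge to \<open>p\<close> both dimensions equal \<open>D\<close>.

  Lower bound: by the law of large numbers almost every code has approximate squares of side
  \<open>\<delta>\<close> of mass at most \<open>\<delta>\<close> to the power \<open>D - \<epsilon>\<close>, and by an area count a set of diameter \<open>\<delta>\<close>
  meets boundedly many of them.

  Upper bound: consider the approximate square fixing \<open>L\<close> columns and \<open>n(L) \<ge> L\<close> rows, and give it
  the measure of the empirical row frequencies \<open>P\<^sub>n\<close> of its own first \<open>n = n(L)\<close> letters. Its mass is
  at least its width to the power \<open>D + \<epsilon>\<close>, provided \<open>t(P\<^sub>n) \<ge> t(P\<^sub>L) - \<delta>\<close>. As \<open>t\<close> takes values in \<open>[0, 1]\<close>,
  this proviso cannot fail more than \<open>1/\<delta>\<close> times in a row along \<open>L, n(L), n(n(L)), \<dots>\<close>, so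
  these squares cover. Only polynomially many empirical vectors occur for a given \<open>L\<close>, while
  the widths decay exponentially.
\<close>

section \<open>A law of large numbers for products of finite probability spaces\<close>

text \<open>The logarithm of the mass of an approximate square with L columns and n rows has three
  parts: a row part over n letters, the term \<open>t * ln width\<close>, and minus the sum of
  \<open>ln (row_sum t)\<close> over the first L letters only. Taking the measure of the square's
  own row frequencies P_n makes the row part at least \<open>base_dim P_n\<close> times the
  logarithm of the height, up to a small relative error, whatever the square is. The obstacle is the
  last sum: it sees the frequencies P_L of a shorter word, while the exponent t belongs to P_n. At t
  = t(P_L) its average would vanish, up to a small error, by the equation that defines t. Row sums
  decrease in t, so t(P_n) >= t(P_L) - \<delta> keeps the sum from being large; this is the origin
  of the proviso. The long word of one step is the short word of the next, so the drops of t at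
  consecutive failures add up. Since n(L) <= C * L with a constant C, the search stops within a
  bounded factor of its start, and one cover uses only finitely many lengths.\<close>

lemma slln_product_point_measure:
  fixes A :: "nat \<Rightarrow> 'a set" and w X :: "nat \<Rightarrow> 'a \<Rightarrow> real"
  assumes fin: "\<And>n. finite (A n)"
    and nonneg: "\<And>n x. x \<in> A n \<Longrightarrow> 0 \<le> w n x"
    and one: "\<And>n. (\<Sum>x\<in>A n. w n x) = 1"
    and bd: "\<And>n x. x \<in> A n \<Longrightarrow> \<bar>X n x\<bar> \<le> C"
  shows "AE \<omega> in (\<Pi>\<^sub>M n\<in>UNIV. point_measure (A n) (\<lambda>x. ennreal (w n x))).
           (\<lambda>n. (\<Sum>l<n. X l (\<omega> l) - (\<Sum>x\<in>A l. w l x * X l x)) / n) \<longlonglongrightarrow> 0"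
proof -
  define M where "M n = point_measure (A n) (\<lambda>x. ennreal (w n x))" for n
  have prob: "prob_space (M n)" for n
    unfolding M_def using fin[of n] nonneg[of _ n] one[of n]
    by (intro prob_space_point_measure) (auto simp: sum_ennreal)
  interpret product_prob_space M UNIV
    using prob by (simp add: product_prob_space_def product_prob_space_axioms_def
        product_sigma_finite_def prob_space_imp_sigma_finite)
  define Y where "Y l \<omega> = X l (\<omega> l)" for l \<omega>
  define e where "e l = (\<Sum>x\<in>A l. w l x * X l x)" for l
  \<comment> \<open>Hoeffding's inequality divides by the squared range of the variables; the added
    1 keeps that range positive even if all \<open>X\<close> vanish.\<close>
  define D where "D = \<bar>C\<bar> + 1"
  have D: "D > 0" by (auto simp: D_def)
  have measX [measurable]: "X l \<in> borel_measurable (M l)" for l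
    by (simp add: M_def)
  have measY [measurable]: "Y l \<in> borel_measurable (PiM UNIV M)" for l
    unfolding Y_def by (rule measurable_compose[where N = "M l" and g = "X l"]) auto
  have indep: "P.indep_vars (\<lambda>_. borel) Y UNIV"
  proof -
    have "P.indep_vars M (\<lambda>i \<omega>. \<omega> i) UNIV"
    proof (subst P.indep_vars_iff_distr_eq_PiM')
      have eq: "distr (Pi\<^sub>M UNIV M) (M i) (\<lambda>x. x i) = M i" for i
        by (rule PiM_component) auto
      show "distr (Pi\<^sub>M UNIV M) (Pi\<^sub>M UNIV M) (\<lambda>x. \<lambda>i\<in>UNIV. x i) =
            Pi\<^sub>M UNIV (\<lambda>i. distr (Pi\<^sub>M UNIV M) (M i) (\<lambda>x. x i))"
        by (simp add: eq restrict_UNIV distr_id2)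
    qed auto
    from P.indep_vars_compose2[OF this, of X "\<lambda>_. borel"] show ?thesis
      by (simp add: Y_def[abs_def])
  qed
  have bdY: "AE x in PiM UNIV M. Y i x \<in> {-D..D}" for i
  proof (rule AE_I2)
    fix x assume "x \<in> space (PiM UNIV M)"
    then have "x i \<in> A i" by (auto simp: space_PiM PiE_def Pi_def M_def space_point_measure)
    from bd[OF this] show "Y i x \<in> {-D..D}" by (auto simp: Y_def D_def)
  qed
  have exp: "P.expectation (Y l) = e l" for l
  proof -
    have "P.expectation (Y l) = integral\<^sup>L (distr (PiM UNIV M) (M l) (\<lambda>\<omega>. \<omega> l)) (X l)"
      unfolding Y_def by (subst integral_distr) auto
    also have "distr (PiM UNIV M) (M l) (\<lambda>\<omega>. \<omega> l) = M l"
      by (rule PiM_component) auto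
    also have "integral\<^sup>L (M l) (X l) = e l"
      unfolding M_def e_def using fin nonneg
      by (subst lebesgue_integral_point_measure_finite) auto
    finally show ?thesis .
  qed
  \<comment> \<open>The variables are independent and uniformly bounded but not identically
    distributed. Hoeffding's inequality makes the deviation probabilities decay geometrically, and
    Borel-Cantelli removes the deviations from some index on.\<close>
  have conv: "AE \<omega> in PiM UNIV M. eventually (\<lambda>n. \<bar>(\<Sum>l<n. Y l \<omega>) - (\<Sum>l<n. e l)\<bar> < \<epsilon> * n) sequentially"
    if eps: "\<epsilon> > 0" for \<epsilon> :: real
  proof -
    \<comment> \<open>Length \<open>Suc n\<close> avoids the empty sum, for which the denominator in
      Hoeffding's inequality is 0.\<close>
    define B where "B n = {\<omega>\<in>space (PiM UNIV M). \<bar>(\<Sum>l<Suc n. Y l \<omega>) - (\<Sum>l<Suc n. e l)\<bar> \<ge> \<epsilon> * Suc n}" for n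
    have [measurable]: "B n \<in> sets (PiM UNIV M)" for n
      unfolding B_def by measurable
    have bound: "P.prob (B n) \<le> 2 * exp (- (\<epsilon>\<^sup>2 / (2 * D\<^sup>2))) ^ Suc n" for n
    proof -
      interpret H: Hoeffding_ineq "PiM UNIV M" "{..<Suc n}" Y "\<lambda>_. -D" "\<lambda>_. D" "\<Sum>l<Suc n. P.expectation (Y l)"
        by unfold_locales (use bdY P.indep_vars_subset[OF indep] in auto)
      have "P.prob (B n) \<le> 2 * exp (-2 * (\<epsilon> * Suc n)\<^sup>2 / (\<Sum>i<Suc n. (D - -D)\<^sup>2))"
        unfolding B_def using H.Hoeffding_ineq_abs_ge[of "\<epsilon> * Suc n"] eps D by (simp add: exp)
      also have "-2 * (\<epsilon> * Suc n)\<^sup>2 / (\<Sum>i<Suc n. (D - -D)\<^sup>2) = Suc n * (- (\<epsilon>\<^sup>2 / (2 * D\<^sup>2)))"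
      proof -
        have "-2 * (\<epsilon> * r)\<^sup>2 / (r * (4 * D\<^sup>2)) = r * (- (\<epsilon>\<^sup>2 / (2 * D\<^sup>2)))" if "r > 0" for r :: real
          using D that by (simp add: power2_eq_square field_simps)
        from this[of "Suc n"] show ?thesis
          by (simp add: power2_eq_square algebra_simps)
      qed
      also have "exp \<dots> = exp (- (\<epsilon>\<^sup>2 / (2 * D\<^sup>2))) ^ Suc n"
        by (rule exp_of_nat_mult)
      finally show ?thesis .
    qed
    have "summable (\<lambda>n. 2 * exp (- (\<epsilon>\<^sup>2 / (2 * D\<^sup>2))) ^ Suc n)"
      using D eps by (intro summable_mult iffD2[OF summable_Suc_iff] summable_geometric) auto
    then have "summable (\<lambda>n. P.prob (B n))"
      by (rule summable_comparison_test'[where N = 0]) (use bound in auto)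
    then have "AE x in PiM UNIV M. eventually (\<lambda>n. x \<in> space (PiM UNIV M) - B n) sequentially"
      by (intro borel_cantelli_AE1) (auto simp: P.emeasure_eq_measure)
    then show ?thesis
    proof eventually_elim
      case (elim \<omega>)
      then have "eventually (\<lambda>n. \<bar>(\<Sum>l<Suc n. Y l \<omega>) - (\<Sum>l<Suc n. e l)\<bar> < \<epsilon> * Suc n) sequentially"
        by eventually_elim (auto simp: B_def)
      then show ?case by (rule eventually_sequentially_Suc[THEN iffD1])
    qed
  qed
  \<comment> \<open>A countable family of tolerances, so that the exceptional null sets can be
    united.\<close>
  have "AE \<omega> in PiM UNIV M. \<forall>k. eventually (\<lambda>n. \<bar>(\<Sum>l<n. Y l \<omega>) - (\<Sum>l<n. e l)\<bar> < inverse (Suc k) * n) sequentially"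
    by (subst AE_all_countable) (auto intro!: conv)
  then have "AE \<omega> in PiM UNIV M. (\<lambda>n. (\<Sum>l<n. Y l \<omega> - e l) / n) \<longlonglongrightarrow> 0"
  proof eventually_elim
    case (elim \<omega>)
    show ?case
    proof (rule tendstoI)
      fix r :: real assume "r > 0"
      then obtain k where k: "inverse (real (Suc k)) < r" using reals_Archimedean by blast
      from elim have "eventually (\<lambda>n. \<bar>(\<Sum>l<n. Y l \<omega>) - (\<Sum>l<n. e l)\<bar> < inverse (Suc k) * n) sequentially" by blast
      then show "eventually (\<lambda>n. dist ((\<Sum>l<n. Y l \<omega> - e l) / n) 0 < r) sequentially"
        using eventually_gt_at_top[of 0]
      proof eventually_elim
        case (elim n)
        then have "\<bar>(\<Sum>l<n. Y l \<omega> - e l) / n\<bar> < inverse (Suc k)"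
          by (simp add: sum_subtractf field_simps)
        with k show ?case by simp
      qed
    qed
  qed
  then show ?thesis unfolding M_def Y_def e_def .
qed

section \<open>Hausdorff measure and nested intervals\<close>

lemma hausdorff_premeasure_le_finite_sum:
  assumes fin: "finite I" and cov: "E \<subseteq> (\<Union>i\<in>I. V i)"
    and V: "\<And>i. i \<in> I \<Longrightarrow> bounded (V i) \<and> diameter (V i) \<le> \<delta>" and "0 \<le> \<delta>"
  shows "hausdorff_premeasure \<delta> s E \<le> (\<Sum>i\<in>I. ennreal (diameter (V i) powr s))"
proof -
  obtain h where h: "bij_betw h {..<card I} I"
    using ex_bij_betw_nat_finite[OF fin] by (auto simp: atLeast0LessThan)
  \<comment> \<open>The definition wants a sequence of sets. The empty sets used as padding cost
    nothing, because \<open>diameter {} = 0\<close> and \<open>0 powr s = 0\<close>.\<close>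
  define U where "U n = (if n < card I then V (h n) else {})" for n
  have hI: "h n \<in> I" if "n < card I" for n
    using h that by (auto simp: bij_betw_def)
  have "E \<subseteq> (\<Union>n. U n)"
  proof
    fix x assume "x \<in> E"
    with cov obtain i where i: "i \<in> I" "x \<in> V i" by blast
    then obtain n where "n < card I" "h n = i"
      using h unfolding bij_betw_def by (metis imageE lessThan_iff)
    with i show "x \<in> (\<Union>n. U n)" by (auto simp: U_def intro!: exI[of _ n])
  qed
  moreover have "\<forall>n. bounded (U n) \<and> diameter (U n) \<le> \<delta>"
    using V hI \<open>0 \<le> \<delta>\<close> by (auto simp: U_def)
  ultimately have "hausdorff_premeasure \<delta> s E \<le> (\<Sum>n. ennreal (diameter (U n) powr s))"
    unfolding hausdorff_premeasure_def by (intro Inf_lower) blast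
  also have "\<dots> = (\<Sum>n<card I. ennreal (diameter (U n) powr s))"
    by (intro suminf_finite) (auto simp: U_def)
  also have "\<dots> = (\<Sum>n<card I. ennreal (diameter (V (h n)) powr s))"
    by (intro sum.cong) (auto simp: U_def)
  also have "\<dots> = (\<Sum>i\<in>I. ennreal (diameter (V i) powr s))"
    by (rule sum.reindex_bij_betw[OF h])
  finally show ?thesis .
qed

lemma hausdorff_measure_eq_0I:
  assumes "\<And>\<delta> e. 0 < \<delta> \<Longrightarrow> 0 < e \<Longrightarrow> hausdorff_premeasure \<delta> s E \<le> ennreal e"
  shows "hausdorff_measure s E = 0"
proof -
  have "hausdorff_premeasure \<delta> s E = 0" if "0 < \<delta>" for \<delta>
    using assms[OF that] by (metis ennreal_le_epsilon le_zero_eq add_0 )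
  then show ?thesis by (simp add: hausdorff_measure_def)
qed

lemma hausdorff_dim_leI:
  assumes "0 \<le> D" "\<And>s. D < s \<Longrightarrow> hausdorff_measure s E = 0"
  shows "hausdorff_dim E \<le> ennreal D"
proof (rule ennreal_le_epsilon)
  fix e :: real assume "0 < e"
  then have "hausdorff_dim E \<le> ennreal (D + e)"
    unfolding hausdorff_dim_def using assms
    by (intro Inf_lower CollectI exI[of _ "D + e"]) auto
  then show "hausdorff_dim E \<le> ennreal D + ennreal e"
    using assms(1) \<open>0 < e\<close> by simp
qed

lemma hausdorff_dim_geI:
  assumes "\<And>s. 0 < s \<Longrightarrow> s < D \<Longrightarrow> hausdorff_measure s E \<noteq> 0"
  shows "ennreal D \<le> hausdorff_dim E"
  unfolding hausdorff_dim_def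
proof (rule Inf_greatest)
  fix x assume "x \<in> {ennreal s |s. 0 < s \<and> hausdorff_measure s E = 0}"
  then obtain s where "x = ennreal s" "0 < s" "hausdorff_measure s E = 0" by blast
  with assms[of s] show "ennreal D \<le> x" by (metis ennreal_leI not_less)
qed

text \<open>The measure lives on the code space and \<phi> is the coding, so \<open>F\<close> is
  reached only through the image of \<open>G\<close>. Covering sets need not be measurable, hence
  the trace of \<open>U\<close> on \<open>G\<close> is bounded through a measurable superset
  \<open>V\<close>. Countable subadditivity then bounds every cover from below by a fixed multiple
  of the mass of \<open>G\<close>.\<close>

lemma mass_distribution_principle:
  assumes "G \<in> sets \<mu>" and pos: "0 < emeasure \<mu> G" and fin: "emeasure \<mu> G < \<infinity>"
    and sub: "\<phi> ` G \<subseteq> F" and \<rho>: "0 < \<rho>" and s: "0 < s" and K: "0 < K"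
    and small: "\<And>\<delta> U. 0 < \<delta> \<Longrightarrow> \<delta> \<le> \<rho> \<Longrightarrow> bounded U \<Longrightarrow> diameter U \<le> \<delta> \<Longrightarrow>
        \<exists>V\<in>sets \<mu>. {\<omega>\<in>G. \<phi> \<omega> \<in> U} \<subseteq> V \<and> emeasure \<mu> V \<le> ennreal (K * \<delta> powr s)"
  shows "hausdorff_measure s F \<noteq> 0"
proof -
  have small': "\<exists>V\<in>sets \<mu>. {\<omega>\<in>G. \<phi> \<omega> \<in> U} \<subseteq> V \<and> emeasure \<mu> V \<le> ennreal (K * diameter U powr s)"
    if U: "bounded U" "diameter U \<le> \<rho>" for U
  proof (cases "diameter U = 0")
    case False
    then have "0 < diameter U" using diameter_ge_0[OF U(1)] by linarith
    from small[OF this U(2) U(1)] show ?thesis by simp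
  next
    case True
    \<comment> \<open>A set of diameter 0 needs a superset of mass 0, but the hypothesis speaks of
      positive \<delta> only. The intersection of the supersets for scales tending to 0
      serves.\<close>
    define \<delta> where "\<delta> n = \<rho> / real (Suc n)" for n
    have d: "0 < \<delta> n" "\<delta> n \<le> \<rho>" for n
      using \<rho> by (auto simp: \<delta>_def field_simps)
    have "\<forall>n. \<exists>V\<in>sets \<mu>. {\<omega>\<in>G. \<phi> \<omega> \<in> U} \<subseteq> V \<and> emeasure \<mu> V \<le> ennreal (K * \<delta> n powr s)"
      using small[OF d U(1)] True d by (simp add: less_imp_le)
    then obtain V where V: "\<And>n. V n \<in> sets \<mu>" "\<And>n. {\<omega>\<in>G. \<phi> \<omega> \<in> U} \<subseteq> V n"
      "\<And>n. emeasure \<mu> (V n) \<le> ennreal (K * \<delta> n powr s)" by metis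
    have "\<delta> \<longlonglongrightarrow> 0" unfolding \<delta>_def
      using lim_const_over_n[of \<rho>, THEN LIMSEQ_Suc] by simp
    then have "(\<lambda>n. \<delta> n powr s) \<longlonglongrightarrow> 0 powr s"
      using s d by (intro tendsto_powr2 tendsto_const eventuallyI) (auto intro: less_imp_le)
    then have "(\<lambda>n. ennreal (K * \<delta> n powr s)) \<longlonglongrightarrow> ennreal (K * 0)"
      using s by (intro tendsto_ennrealI tendsto_mult tendsto_const) auto
    then have "emeasure \<mu> (\<Inter>n. V n) \<le> ennreal (K * 0)"
    proof (rule LIMSEQ_le_const, intro exI[of _ 0] allI impI)
      fix n
      have "emeasure \<mu> (\<Inter>n. V n) \<le> emeasure \<mu> (V n)"
        using V(1) by (intro emeasure_mono) auto
      also note V(3)[of n]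
      finally show "emeasure \<mu> (\<Inter>n. V n) \<le> ennreal (K * \<delta> n powr s)" .
    qed
    then show ?thesis using V True
      by (intro bexI[of _ "\<Inter>n. V n"]) auto
  qed
  have "hausdorff_premeasure \<rho> s F \<ge> emeasure \<mu> G / ennreal K"
    unfolding hausdorff_premeasure_def
  proof (rule Inf_greatest, clarify)
    fix U :: "nat \<Rightarrow> 'b set"
    assume cov: "F \<subseteq> (\<Union>n. U n)" and U: "\<forall>n. bounded (U n) \<and> diameter (U n) \<le> \<rho>"
    have "\<forall>n. \<exists>V\<in>sets \<mu>. {\<omega>\<in>G. \<phi> \<omega> \<in> U n} \<subseteq> V \<and> emeasure \<mu> V \<le> ennreal (K * diameter (U n) powr s)"
      using small' U by blast
    then obtain V where V: "\<And>n. V n \<in> sets \<mu>" "\<And>n. {\<omega>\<in>G. \<phi> \<omega> \<in> U n} \<subseteq> V n"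
      "\<And>n. emeasure \<mu> (V n) \<le> ennreal (K * diameter (U n) powr s)" by metis
    have "G \<subseteq> (\<Union>n. V n)"
      using sub cov V(2) by blast
    then have "emeasure \<mu> G \<le> emeasure \<mu> (\<Union>n. V n)"
      using V(1) by (intro emeasure_mono) auto
    also have "\<dots> \<le> (\<Sum>n. emeasure \<mu> (V n))"
      using V(1) by (intro emeasure_subadditive_countably) auto
    also have "\<dots> \<le> (\<Sum>n. ennreal (K * diameter (U n) powr s))"
      using V(3) by (intro suminf_le) auto
    also have "\<dots> = ennreal K * (\<Sum>n. ennreal (diameter (U n) powr s))"
      using K by (simp add: ennreal_mult ennreal_suminf_cmult)
    finally show "emeasure \<mu> G / ennreal K \<le> (\<Sum>n. ennreal (diameter (U n) powr s))"
      using K by (metis divide_right_mono_ennreal ennreal_mult_divide_eq ennreal_neq_top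
          ennreal_eq_0_iff linorder_not_le mult.commute)
  qed
  moreover have "0 < emeasure \<mu> G / ennreal K"
    using pos by (simp add: ennreal_zero_less_divide)
  ultimately have "0 < hausdorff_premeasure \<rho> s F" by (rule less_le_trans[rotated])
  also have "\<dots> \<le> hausdorff_measure s F"
    unfolding hausdorff_measure_def using \<rho> by (intro SUP_upper) auto
  finally show ?thesis by simp
qed

section \<open>Nested intervals generated by affine contractions of the line\<close>

definition interval_len :: "(nat \<Rightarrow> real) \<Rightarrow> nat \<Rightarrow> real" where
  "interval_len u n = (\<Prod>l<n. u l)"

text \<open>The composition of the maps x -> \<open>u l\<close> x + \<open>v l\<close> with l < n
  sends [0, 1] to the interval with this left end and with length
  \<open>interval_len u n\<close>.\<close>

definition interval_pos :: "(nat \<Rightarrow> real) \<Rightarrow> (nat \<Rightarrow> real) \<Rightarrow> nat \<Rightarrow> real" where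
  "interval_pos u v n = (\<Sum>l<n. interval_len u l * v l)"

lemma interval_len_Suc: "interval_len u (Suc n) = interval_len u n * u n"
  and interval_len_0: "interval_len u 0 = 1"
  by (simp_all add: interval_len_def)

lemma interval_pos_Suc: "interval_pos u v (Suc n) = interval_pos u v n + interval_len u n * v n"
  and interval_pos_0: "interval_pos u v 0 = 0"
  by (simp_all add: interval_pos_def)

lemma interval_len_cong: "(\<And>l. l < n \<Longrightarrow> u l = u' l) \<Longrightarrow> interval_len u n = interval_len u' n"
  unfolding interval_len_def by (intro prod.cong) auto

lemma interval_pos_cong:
  "(\<And>l. l < n \<Longrightarrow> u l = u' l) \<Longrightarrow> (\<And>l. l < n \<Longrightarrow> v l = v' l) \<Longrightarrow> interval_pos u v n = interval_pos u' v' n"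
  unfolding interval_pos_def by (intro sum.cong arg_cong2[where f = "(*)"] interval_len_cong) auto

lemma interval_nested:
  assumes "\<And>l. 0 \<le> u l" "\<And>l. 0 \<le> v l" "\<And>l. v l + u l \<le> 1" and "n \<le> n'"
  shows "interval_pos u v n \<le> interval_pos u v n'"
    and "interval_pos u v n' + interval_len u n' \<le> interval_pos u v n + interval_len u n"
proof -
  have len: "0 \<le> interval_len u n" for n
    unfolding interval_len_def using assms(1) by (intro prod_nonneg) auto
  show "interval_pos u v n \<le> interval_pos u v n'"
    using \<open>n \<le> n'\<close> by (rule lift_Suc_mono_le[rotated]) (use len assms(2) in \<open>simp add: interval_pos_Suc\<close>)
  show "interval_pos u v n' + interval_len u n' \<le> interval_pos u v n + interval_len u n"
  proof (rule lift_Suc_antimono_le[where f = "\<lambda>n. interval_pos u v n + interval_len u n", OF _ \<open>n \<le> n'\<close>])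
    fix n
    have "interval_len u n * (v n + u n) \<le> interval_len u n * 1"
      using len assms(3) by (intro mult_left_mono) auto
    then show "interval_pos u v (Suc n) + interval_len u (Suc n) \<le> interval_pos u v n + interval_len u n"
      by (simp add: interval_pos_Suc interval_len_Suc algebra_simps)
  qed
qed

text \<open>Up to level k both intervals have the same ancestor, inside which \<open>sep\<close>
  orders their two children; all later levels stay inside these children. The levels n and n' may
  differ because codes are stopped at different levels.\<close>

lemma interval_separated:
  assumes u: "\<And>l. 0 \<le> u l" "\<And>l. 0 \<le> v l" "\<And>l. v l + u l \<le> 1"
    and u': "\<And>l. 0 \<le> u' l" "\<And>l. 0 \<le> v' l" "\<And>l. v' l + u' l \<le> 1"
    and eq: "\<And>l. l < k \<Longrightarrow> u l = u' l" "\<And>l. l < k \<Longrightarrow> v l = v' l"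
    and "k < n" "k < n'" and sep: "v k + u k \<le> v' k"
  shows "interval_pos u v n + interval_len u n \<le> interval_pos u' v' n'"
proof -
  have len: "0 \<le> interval_len u k"
    unfolding interval_len_def using u by (intro prod_nonneg) auto
  have "interval_pos u v n + interval_len u n \<le> interval_pos u v (Suc k) + interval_len u (Suc k)"
    using \<open>k < n\<close> by (intro interval_nested u) auto
  also have "\<dots> = interval_pos u v k + interval_len u k * (v k + u k)"
    by (simp add: interval_pos_Suc interval_len_Suc algebra_simps)
  also have "\<dots> \<le> interval_pos u v k + interval_len u k * v' k"
    using len sep by (intro add_left_mono mult_left_mono) auto
  also have "\<dots> = interval_pos u' v' (Suc k)"
    using interval_len_cong[of k u u'] interval_pos_cong[of k u u' v v'] eq
    by (simp add: interval_pos_Suc)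
  also have "\<dots> \<le> interval_pos u' v' n'"
    using \<open>k < n'\<close> by (intro interval_nested u') auto
  finally show ?thesis .
qed

text \<open>An area count: the interiors are disjoint, each has area at least
  \<open>(c * \<delta>)\<^sup>2\<close>, and all lie in one square of area
  \<open>16 * \<delta>\<^sup>2\<close>.\<close>

lemma card_separated_rectangles_le:
  fixes x y w h :: "'i \<Rightarrow> real" and U :: "(real \<times> real) set"
  assumes fin: "finite I" and \<delta>: "0 < \<delta>" and c: "0 < c" and U: "bounded U" "diameter U \<le> \<delta>"
    and w: "\<And>i. i \<in> I \<Longrightarrow> c * \<delta> \<le> w i \<and> w i \<le> \<delta>"
    and h: "\<And>i. i \<in> I \<Longrightarrow> c * \<delta> \<le> h i \<and> h i \<le> \<delta>"
    and meet: "\<And>i. i \<in> I \<Longrightarrow> \<exists>q\<in>U. q \<in> {x i..x i + w i} \<times> {y i..y i + h i}"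
    and sep: "\<And>i j. i \<in> I \<Longrightarrow> j \<in> I \<Longrightarrow> i \<noteq> j \<Longrightarrow>
        x i + w i \<le> x j \<or> x j + w j \<le> x i \<or> y i + h i \<le> y j \<or> y j + h j \<le> y i"
  shows "real (card I) \<le> 16 / c\<^sup>2"
proof (cases "I = {}")
  case False
  then obtain u where u: "u \<in> U" using meet by blast
  \<comment> \<open>Open rectangles, since separated closed ones may still share an edge.\<close>
  define R where "R i = {x i<..<x i + w i} \<times> {y i<..<y i + h i}" for i
  \<comment> \<open>Half the side is 2\<delta>: one \<delta> from u to a point of U in the
    rectangle, and one for the side of the rectangle.\<close>
  define Q where "Q = {fst u - 2 * \<delta><..<fst u + 2 * \<delta>} \<times> {snd u - 2 * \<delta><..<snd u + 2 * \<delta>}"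
  have wh: "0 < w i" "0 < h i" if "i \<in> I" for i
    using w[OF that] h[OF that] mult_pos_pos[OF c \<delta>] by auto
  have em: "emeasure lborel ({a<..<a'} \<times> {b<..<b'}) = ennreal ((a' - a) * (b' - b))"
    if "a \<le> a'" "b \<le> b'" for a a' b b' :: real
    using that by (subst lborel_prod[symmetric], subst lborel.emeasure_pair_measure_Times)
      (auto simp: ennreal_mult)
  have meas: "{a<..<a'} \<times> {b<..<b'} \<in> sets lborel" for a a' b b' :: real
    unfolding sets_lborel by (intro borel_open open_Times) auto
  have disj: "disjoint_family_on R I"
    unfolding disjoint_family_on_def R_def using sep by fastforce
  have sub: "R i \<subseteq> Q" if i: "i \<in> I" for i
  proof -
    obtain q where q: "q \<in> U" "q \<in> {x i..x i + w i} \<times> {y i..y i + h i}" using meet[OF i] by blast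
    have "dist q u \<le> \<delta>" using diameter_bounded_bound[OF U(1) q(1) u] U(2) by simp
    then have "\<bar>fst q - fst u\<bar> \<le> \<delta>" "\<bar>snd q - snd u\<bar> \<le> \<delta>"
      using dist_fst_le[of q u] dist_snd_le[of q u] by (auto simp: dist_real_def)
    with q(2) w[OF i] h[OF i] show ?thesis
      unfolding R_def Q_def by (cases q) auto
  qed
  have "(\<Sum>i\<in>I. emeasure lborel (R i)) = emeasure lborel (\<Union>i\<in>I. R i)"
    using fin disj meas by (intro sum_emeasure) (auto simp: R_def[abs_def])
  also have "\<dots> \<le> emeasure lborel Q"
    using sub meas by (intro emeasure_mono) (auto simp: Q_def)
  also have "\<dots> = ennreal (16 * \<delta>\<^sup>2)"
    unfolding Q_def using \<delta> by (subst em) (auto simp: power2_eq_square)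
  finally have le: "(\<Sum>i\<in>I. emeasure lborel (R i)) \<le> ennreal (16 * \<delta>\<^sup>2)" .
  have "ennreal (real (card I) * (c * \<delta>)\<^sup>2) = (\<Sum>i\<in>I. ennreal ((c * \<delta>)\<^sup>2))"
    by (subst sum_ennreal) auto
  also have "\<dots> \<le> (\<Sum>i\<in>I. emeasure lborel (R i))"
  proof (intro sum_mono)
    fix i assume i: "i \<in> I"
    have "(c * \<delta>)\<^sup>2 \<le> w i * h i"
      unfolding power2_eq_square using w[OF i] h[OF i] wh[OF i] c \<delta> by (intro mult_mono) auto
    then show "ennreal ((c * \<delta>)\<^sup>2) \<le> emeasure lborel (R i)"
      unfolding R_def using wh[OF i] by (subst em) (auto intro: ennreal_leI)
  qed
  also note le
  finally have "real (card I) * (c * \<delta>)\<^sup>2 \<le> 16 * \<delta>\<^sup>2"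
    using \<delta> by (subst (asm) ennreal_le_iff) auto
  then have "(real (card I) * c\<^sup>2) * \<delta>\<^sup>2 \<le> 16 * \<delta>\<^sup>2" by (simp add: power_mult_distrib mult_ac)
  then have "real (card I) * c\<^sup>2 \<le> 16" using \<delta> by (subst (asm) mult_le_cancel_right) auto
  then show ?thesis using c by (simp add: field_simps)
qed simp

section \<open>Variational principle on the simplex\<close>

text \<open>Makes the entropy continuous up to the boundary of the simplex, where rows have
  probability zero: the limit at 0 is 0, which is also the value there because of the factor
  y.\<close>

lemma continuous_on_mult_ln:
  assumes "0 < q"
  shows "continuous_on {0..} (\<lambda>y::real. y * ln (y / q))"
proof (rule continuous_on_cong[THEN iffD1, OF refl, rotated])
  have "((\<lambda>y::real. y * ln (y / q)) \<longlongrightarrow> 0) (at_right 0)"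
    using assms by real_asymp
  then have lim: "((\<lambda>y::real. y * ln (y / q)) \<longlongrightarrow> 0) (at 0 within {0..})"
    by (simp add: at_within_Ici_at_right)
  show "continuous_on {0..} (\<lambda>y::real. y * ln (y / q))"
    unfolding continuous_on_def
  proof
    fix x :: real assume x: "x \<in> {0..}"
    show "((\<lambda>y. y * ln (y / q)) \<longlongrightarrow> x * ln (x / q)) (at x within {0..})"
    proof (cases "x = 0")
      case True
      with lim show ?thesis by simp
    next
      case False
      then show ?thesis using x assms by (intro tendsto_intros) auto
    qed
  qed
qed simp

section \<open>Bounds and orderings that follow from admissibility\<close>

locale random_carpet =
  fixes m :: nat and p :: "nat \<Rightarrow> real"
    and M :: "nat \<Rightarrow> nat" and N :: "nat \<Rightarrow> nat \<Rightarrow> nat"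
    and a :: "nat \<Rightarrow> nat \<Rightarrow> nat \<Rightarrow> real" and b :: "nat \<Rightarrow> nat \<Rightarrow> real"
    and c :: "nat \<Rightarrow> nat \<Rightarrow> nat \<Rightarrow> real" and d :: "nat \<Rightarrow> nat \<Rightarrow> real"
  assumes m: "1 \<le> m"
    and p_pos: "\<And>i. i \<in> {1..m} \<Longrightarrow> 0 < p i" and p_sum: "(\<Sum>i=1..m. p i) = 1"
    and M: "\<And>i. i \<in> {1..m} \<Longrightarrow> 1 \<le> M i"
    and N: "\<And>i j. i \<in> {1..m} \<Longrightarrow> j \<in> {1..M i} \<Longrightarrow> 1 \<le> N i j"
    and adm: "admissible m M N a b c d"
begin

definition rows :: "(nat \<times> nat) set" where "rows = (SIGMA i:{1..m}. {1..M i})"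

definition cells :: "(nat \<times> nat \<times> nat) set" where "cells = (SIGMA i:{1..m}. row_col M N i)"

text \<open>As \<open>a i j k \<le> b i j\<close>, all horizontal and vertical ratios lie between
  \<open>amin\<close> and \<open>bmax\<close>; every uniform constant below is built from these
  two.\<close>

definition amin :: real where "amin = Min ((\<lambda>(i, j, k). a i j k) ` cells)"

definition bmax :: real where "bmax = Max ((\<lambda>(i, j). b i j) ` rows)"

definition row_sum :: "real \<Rightarrow> nat \<Rightarrow> nat \<Rightarrow> real" where
  "row_sum t i j = (\<Sum>k=1..N i j. a i j k powr t)"

lemma finite_rows: "finite rows" by (simp add: rows_def)

lemma finite_row_col: "finite (row_col M N i)" by (simp add: row_col_def)

lemma finite_cells: "finite cells" by (simp add: cells_def finite_row_col)

lemma rowsD: "(i, j) \<in> rows \<Longrightarrow> i \<in> {1..m} \<and> j \<in> {1..M i}" by (simp add: rows_def)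

lemma sum_rows: "(\<Sum>(i, j)\<in>rows. f i j) = (\<Sum>i=1..m. \<Sum>j=1..M i. f i j)"
  unfolding rows_def by (subst sum.Sigma) auto

lemma row_cell: "i \<in> {1..m} \<Longrightarrow> j \<in> {1..M i} \<Longrightarrow> (j, 1) \<in> row_col M N i"
  using N[of i j] by (auto simp: row_col_def)

lemma rows_nonempty: "rows \<noteq> {}"
proof -
  have "(1, 1) \<in> rows" using m M[of 1] by (simp add: rows_def)
  then show ?thesis by blast
qed

lemma cells_nonempty: "cells \<noteq> {}"
proof -
  have "(1, 1, 1) \<in> cells" using m M[of 1] row_cell[of 1 1] by (simp add: cells_def)
  then show ?thesis by blast
qed

lemma cell_admissible:
  assumes "i \<in> {1..m}" "(j, k) \<in> row_col M N i"
  shows "0 < a i j k \<and> a i j k \<le> b i j \<and> b i j < 1"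
proof -
  have "\<forall>(j, k)\<in>row_col M N i. 0 < a i j k \<and> a i j k \<le> b i j \<and> b i j < 1"
    using adm assms(1) unfolding admissible_def by simp
  from bspec[OF this assms(2)] show ?thesis by simp
qed

lemma a_pos: "i \<in> {1..m} \<Longrightarrow> (j, k) \<in> row_col M N i \<Longrightarrow> 0 < a i j k"
  and a_le_b: "i \<in> {1..m} \<Longrightarrow> (j, k) \<in> row_col M N i \<Longrightarrow> a i j k \<le> b i j"
  using cell_admissible by auto

lemma b_less_1: "(i, j) \<in> rows \<Longrightarrow> b i j < 1"
  using cell_admissible row_cell[of i j] by (blast dest: rowsD)

lemma amin_le: "i \<in> {1..m} \<Longrightarrow> (j, k) \<in> row_col M N i \<Longrightarrow> amin \<le> a i j k"
  unfolding amin_def using finite_cells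
  by (intro Min_le finite_imageI image_eqI[where x = "(i, j, k)"]) (auto simp: cells_def)

lemma amin_pos: "0 < amin"
  unfolding amin_def using finite_cells cells_nonempty a_pos
  by (subst Min_gr_iff) (auto simp: cells_def)

lemma b_le_bmax: "(i, j) \<in> rows \<Longrightarrow> b i j \<le> bmax"
  unfolding bmax_def using finite_rows
  by (intro Max_ge finite_imageI image_eqI[where x = "(i, j)"]) auto

lemma bmax_less_1: "bmax < 1"
  unfolding bmax_def using finite_rows rows_nonempty b_less_1
  by (subst Max_less_iff) auto

lemma amin_le_b: "(i, j) \<in> rows \<Longrightarrow> amin \<le> b i j"
  using amin_le[of i j 1] a_le_b[of i j 1] row_cell[of i j] rowsD[of i j] by simp

lemma b_pos: "(i, j) \<in> rows \<Longrightarrow> 0 < b i j"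
  using amin_pos amin_le_b[of i j] by linarith

lemma amin_le_bmax: "amin \<le> bmax"
proof -
  obtain i j where "(i, j) \<in> rows" using rows_nonempty by auto
  from amin_le_b[OF this] b_le_bmax[OF this] show ?thesis by simp
qed

lemma bmax_pos: "0 < bmax" and amin_less_1: "amin < 1"
  using amin_le_bmax amin_pos bmax_less_1 by linarith+

lemma a_le_bmax: "i \<in> {1..m} \<Longrightarrow> (j, k) \<in> row_col M N i \<Longrightarrow> a i j k \<le> bmax"
  using a_le_b[of i j k] b_le_bmax[of i j] by (simp add: rows_def row_col_def)

lemma cell_bounds:
  assumes "(i, j) \<in> rows" "k \<in> {1..N i j}"
  shows "amin \<le> a i j k" "a i j k \<le> bmax" "0 < a i j k" "a i j k < 1"
proof -
  have *: "i \<in> {1..m}" "(j, k) \<in> row_col M N i" using assms by (auto simp: rows_def row_col_def)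
  show "amin \<le> a i j k" "a i j k \<le> bmax" "0 < a i j k" "a i j k < 1"
    using amin_le[OF *] a_le_bmax[OF *] a_pos[OF *] bmax_less_1 by auto
qed

text \<open>Admissibility compares neighbouring offsets only; adding up the gaps compares any two of
  them.\<close>

lemma offsets_ordered:
  assumes "\<And>j. j \<in> {1..<n} \<Longrightarrow> v (j + 1) - v j \<ge> (u j :: real)" "\<And>j. j \<in> {1..n} \<Longrightarrow> 0 \<le> u j"
    and "1 \<le> j" "j < j'" "j' \<le> (n :: nat)"
  shows "v j + u j \<le> v j'"
proof -
  have "j + 1 \<le> j'" using assms by simp
  then show ?thesis using \<open>j' \<le> n\<close>
  proof (induction j' rule: dec_induct)
    case base
    then show ?case using assms(1)[of j] assms(3) by auto
  next
    case (step k)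
    then have "v j + u j \<le> v k" "u k \<le> v (k + 1) - v k" "0 \<le> u k"
      using assms(1)[of k] assms(2)[of k] assms(3) by auto
    then show ?case by simp
  qed
qed

lemma d_ordered:
  assumes "i \<in> {1..m}" "1 \<le> j" "j < j'" "j' \<le> M i"
  shows "d i j + b i j \<le> d i j'"
proof (rule offsets_ordered[where n = "M i" and v = "d i" and u = "b i"])
  show "b i j \<le> d i (j + 1) - d i j" if "j \<in> {1..<M i}" for j
    using adm that assms(1) unfolding admissible_def by simp
  show "0 \<le> b i j" if "j \<in> {1..M i}" for j
    using b_pos[of i j] that assms(1) by (auto simp: rows_def)
qed (use assms in auto)

lemma c_ordered:
  assumes "i \<in> {1..m}" "j \<in> {1..M i}" "1 \<le> k" "k < k'" "k' \<le> N i j"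
  shows "c i j k + a i j k \<le> c i j k'"
proof (rule offsets_ordered[where n = "N i j" and v = "c i j" and u = "a i j"])
  show "a i j k \<le> c i j (k + 1) - c i j k" if "k \<in> {1..<N i j}" for k
    using adm that assms(1,2) unfolding admissible_def by simp
  show "0 \<le> a i j k" if "k \<in> {1..N i j}" for k
    using cell_bounds[of i j k] that assms by (auto simp: rows_def)
qed (use assms in auto)

lemma d_bounds:
  assumes "i \<in> {1..m}" "j \<in> {1..M i}"
  shows "0 \<le> d i j" "d i j + b i j \<le> 1"
proof -
  have 1: "0 \<le> d i 1" "d i (M i) + b i (M i) \<le> 1"
    using adm assms(1) unfolding admissible_def by (auto simp: algebra_simps)
  have b: "0 \<le> b i j" if "j \<in> {1..M i}" for j
    using b_pos[of i j] that assms(1) by (auto simp: rows_def)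
  show "0 \<le> d i j"
    using d_ordered[of i 1 j] assms 1 b[of 1] by (cases "j = 1") auto
  show "d i j + b i j \<le> 1"
    using d_ordered[of i j "M i"] assms 1 b[of "M i"] by (cases "j = M i") auto
qed

lemma c_bounds:
  assumes "i \<in> {1..m}" "j \<in> {1..M i}" "k \<in> {1..N i j}"
  shows "0 \<le> c i j k" "c i j k + a i j k \<le> 1"
proof -
  have 1: "0 \<le> c i j 1" "c i j (N i j) + a i j (N i j) \<le> 1"
    using adm assms(1,2) unfolding admissible_def by (auto simp: algebra_simps)
  have a: "0 \<le> a i j k" if "k \<in> {1..N i j}" for k
    using cell_bounds[of i j k] that assms(1,2) by (auto simp: rows_def)
  show "0 \<le> c i j k"
    using c_ordered[of i j 1 k] assms 1 a[of 1] by (cases "k = 1") auto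
  show "c i j k + a i j k \<le> 1"
    using c_ordered[of i j k "N i j"] assms 1 a[of "N i j"] by (cases "k = N i j") auto
qed

lemma row_sum_pos:
  assumes "(i, j) \<in> rows" shows "0 < row_sum t i j"
  unfolding row_sum_def
proof (intro sum_pos)
  show "{1..N i j} \<noteq> {}" using N[of i j] rowsD[OF assms] by auto
  show "0 < a i j k powr t" if "k \<in> {1..N i j}" for k
    using cell_bounds(3)[OF assms that] by simp
qed simp

lemma row_sum_strict_antimono:
  assumes "(i, j) \<in> rows" "t < t'"
  shows "row_sum t' i j < row_sum t i j"
  unfolding row_sum_def using assms cell_bounds[OF assms(1)] N[of i j]
  by (intro sum_strict_mono) (auto simp: rows_def intro!: powr_less_mono')

lemma row_sum_antimono:
  assumes "(i, j) \<in> rows" "t \<le> t'"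
  shows "row_sum t' i j \<le> row_sum t i j"
  using row_sum_strict_antimono[OF assms(1), of t t'] assms(2) by (cases "t = t'") auto

text \<open>Lowering the exponent by at most \<delta> multiplies each summand by at most
  \<open>amin powr (-\<delta>)\<close>. This is how the bound on the drop of t enters the upper
  estimate.\<close>

lemma ln_row_sum_le:
  assumes "(i, j) \<in> rows" "0 \<le> \<delta>" "t - \<delta> \<le> t'"
  shows "ln (row_sum t' i j) \<le> ln (row_sum t i j) + \<delta> * (- ln amin)"
proof -
  have "row_sum t' i j \<le> (\<Sum>k=1..N i j. a i j k powr t * amin powr (-\<delta>))"
    unfolding row_sum_def
  proof (intro sum_mono)
    fix k assume k: "k \<in> {1..N i j}"
    have "a i j k powr t' \<le> a i j k powr (t - \<delta>)"
      using cell_bounds[OF assms(1) k] assms by (intro powr_mono') auto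
    also have "\<dots> = a i j k powr t * a i j k powr (-\<delta>)" by (simp flip: powr_add)
    also have "\<dots> \<le> a i j k powr t * amin powr (-\<delta>)"
      using cell_bounds[OF assms(1) k] amin_pos assms
      by (intro mult_left_mono powr_mono2') auto
    finally show "a i j k powr t' \<le> a i j k powr t * amin powr (-\<delta>)" .
  qed
  also have "\<dots> = row_sum t i j * amin powr (-\<delta>)"
    by (simp add: row_sum_def sum_distrib_right)
  finally have "ln (row_sum t' i j) \<le> ln (row_sum t i j * amin powr (-\<delta>))"
    using row_sum_pos[OF assms(1)] by (intro ln_mono) auto
  also have "\<dots> = ln (row_sum t i j) + \<delta> * (- ln amin)"
    using row_sum_pos[OF assms(1), of t] amin_pos by (simp add: ln_mult ln_powr)
  finally show ?thesis .
qed

lemma abs_ln_row_sum_bounded: "\<exists>C>0. \<forall>(i, j)\<in>rows. \<forall>t\<in>{0..1}. \<bar>ln (row_sum t i j)\<bar> \<le> C"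
proof -
  \<comment> \<open>Row sums are monotone in t, so the values at the endpoints 0 and 1 bound all of
    them; the 1 makes the constant positive.\<close>
  define C where "C = 1 + (\<Sum>(i, j)\<in>rows. \<bar>ln (row_sum 0 i j)\<bar> + \<bar>ln (row_sum 1 i j)\<bar>)"
  have "\<bar>ln (row_sum t i j)\<bar> \<le> C" if ij: "(i, j) \<in> rows" and t: "t \<in> {0..1}" for i j t
  proof -
    have "ln (row_sum 1 i j) \<le> ln (row_sum t i j)" "ln (row_sum t i j) \<le> ln (row_sum 0 i j)"
      using row_sum_antimono[OF ij, of t 1] row_sum_antimono[OF ij, of 0 t] row_sum_pos[OF ij] t
      by (auto intro!: ln_mono)
    then have "\<bar>ln (row_sum t i j)\<bar> \<le> \<bar>ln (row_sum 0 i j)\<bar> + \<bar>ln (row_sum 1 i j)\<bar>" by linarith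
    also have "\<dots> \<le> (\<Sum>(i, j)\<in>rows. \<bar>ln (row_sum 0 i j)\<bar> + \<bar>ln (row_sum 1 i j)\<bar>)"
      using member_le_sum[OF ij, of "\<lambda>(i, j). \<bar>ln (row_sum 0 i j)\<bar> + \<bar>ln (row_sum 1 i j)\<bar>"] finite_rows by auto
    finally show ?thesis by (simp add: C_def)
  qed
  moreover have "C > 0" unfolding C_def by (intro add_pos_nonneg sum_nonneg) auto
  ultimately show ?thesis by blast
qed

section \<open>Row probability vectors, their exponent t(P) and their entropy quotient\<close>

definition row_weights :: "(nat \<Rightarrow> nat \<Rightarrow> real) set" where
  "row_weights = {P. \<forall>i\<in>{1..m}. (\<forall>j\<in>{1..M i}. 0 \<le> P i j) \<and> (\<Sum>j=1..M i. P i j) = p i}"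

lemma row_weights_nonneg: "P \<in> row_weights \<Longrightarrow> (i, j) \<in> rows \<Longrightarrow> 0 \<le> P i j"
  by (auto simp: row_weights_def rows_def)

lemma row_weights_row_sum: "P \<in> row_weights \<Longrightarrow> i \<in> {1..m} \<Longrightarrow> (\<Sum>j=1..M i. P i j) = p i"
  by (auto simp: row_weights_def)

lemma row_weights_le:
  assumes "P \<in> row_weights" "(i, j) \<in> rows" shows "P i j \<le> p i"
proof -
  have "P i j \<le> (\<Sum>j=1..M i. P i j)"
    using assms by (intro member_le_sum) (auto simp: row_weights_def rows_def)
  then show ?thesis using assms by (auto simp: row_weights_def rows_def)
qed

lemma row_weights_sum: "P \<in> row_weights \<Longrightarrow> (\<Sum>(i, j)\<in>rows. P i j) = 1"
  unfolding sum_rows using p_sum by (simp add: row_weights_def)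

text \<open>The weights add up to 1, so at least one of them is positive and carries the strict
  inequality.\<close>

lemma sum_row_weights_strict_mono:
  assumes P: "P \<in> row_weights" and less: "\<And>i j. (i, j) \<in> rows \<Longrightarrow> f i j < (g i j :: real)"
  shows "(\<Sum>(i, j)\<in>rows. P i j * f i j) < (\<Sum>(i, j)\<in>rows. P i j * g i j)"
proof -
  obtain x where x: "x \<in> rows" "(case x of (i, j) \<Rightarrow> P i j) \<noteq> 0"
    using row_weights_sum[OF P] by (metis (mono_tags, lifting) sum.neutral zero_neq_one)
  show ?thesis
  proof (rule sum_strict_mono_ex1[OF finite_rows])
    show "\<forall>x\<in>rows. (case x of (i, j) \<Rightarrow> P i j * f i j) \<le> (case x of (i, j) \<Rightarrow> P i j * g i j)"
      using row_weights_nonneg[OF P] less by (auto intro!: mult_left_mono intro: less_imp_le simp del: mult_le_cancel_left)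
    show "\<exists>x\<in>rows. (case x of (i, j) \<Rightarrow> P i j * f i j) < (case x of (i, j) \<Rightarrow> P i j * g i j)"
    proof (rule bexI[OF _ x(1)], cases x)
      case (Pair i j)
      then have "0 < P i j" using x row_weights_nonneg[OF P, of i j] by auto
      then show "(case x of (i, j) \<Rightarrow> P i j * f i j) < (case x of (i, j) \<Rightarrow> P i j * g i j)"
        using less[of i j] x(1) Pair by auto
    qed
  qed
qed

abbreviation t_of :: "(nat \<Rightarrow> nat \<Rightarrow> real) \<Rightarrow> real" where "t_of \<equiv> t_exponent m M N a"

lemma continuous_on_ln_row_sum:
  assumes "(i, j) \<in> rows" "continuous_on A f"
  shows "continuous_on A (\<lambda>x. ln (row_sum (f x) i j))"
proof (rule continuous_on_ln)
  show "continuous_on A (\<lambda>x. row_sum (f x) i j)"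
    unfolding row_sum_def using assms(2) cell_bounds(3)[OF assms(1)]
    by (intro continuous_intros) fastforce+
qed (use row_sum_pos[OF assms(1)] in \<open>auto simp: less_imp_neq[symmetric]\<close>)

text \<open>\<open>t_exponent\<close> is a definite description. The weighted logarithm of the row
  sums is strictly decreasing in t; it is nonnegative at 0, where a row sum counts at least one
  cell, and nonpositive at 1, where the widths in a row add up to at most 1. The intermediate value
  theorem gives the root.\<close>

lemma t_of:
  assumes P: "P \<in> row_weights"
  shows "t_of P \<in> {0..1}" "(\<Sum>(i, j)\<in>rows. P i j * ln (row_sum (t_of P) i j)) = 0"
    and "t \<in> {0..1} \<Longrightarrow> (\<Sum>(i, j)\<in>rows. P i j * ln (row_sum t i j)) = 0 \<Longrightarrow> t_of P = t"
proof -
  define g where "g t = (\<Sum>(i, j)\<in>rows. P i j * ln (row_sum t i j))" for t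
  have mono: "g t' < g t" if "t < t'" for t t'
    unfolding g_def using row_sum_strict_antimono[OF _ that] row_sum_pos
    by (intro sum_row_weights_strict_mono[OF P]) auto
  have cont: "continuous_on {0..1} g"
    unfolding g_def by (auto intro!: continuous_intros continuous_on_ln_row_sum simp: case_prod_unfold)
  have "0 \<le> g 0"
    unfolding g_def
  proof (intro sum_nonneg, clarify, intro mult_nonneg_nonneg row_weights_nonneg[OF P] ln_ge_zero)
    fix i j assume ij: "(i, j) \<in> rows"
    have "row_sum 0 i j = real (N i j)"
      unfolding row_sum_def using cell_bounds(3)[OF ij] by (subst sum.cong[OF refl, where h = "\<lambda>_. 1"]) force+
    then show "1 \<le> row_sum 0 i j" using N[of i j] rowsD[OF ij] by simp
  qed
  moreover have "g 1 \<le> 0"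
    unfolding g_def
  proof (intro sum_nonpos, clarify, intro mult_nonneg_nonpos row_weights_nonneg[OF P])
    fix i j assume ij: "(i, j) \<in> rows"
    have "row_sum 1 i j = (\<Sum>k=1..N i j. a i j k)"
      unfolding row_sum_def using cell_bounds(3)[OF ij] by (intro sum.cong) (simp_all add: abs_of_pos)
    also have "\<dots> \<le> 1" using adm rowsD[OF ij] unfolding admissible_def by simp
    finally show "ln (row_sum 1 i j) \<le> 0" using row_sum_pos[OF ij] by (simp add: ln_le_zero_iff)
  qed
  ultimately obtain t0 where t0: "0 \<le> t0" "t0 \<le> 1" "g t0 = 0"
    using IVT2'[of g 1 0 0] cont by auto
  have uniq: "t = t0" if "g t = 0" for t
    using mono[of t t0] mono[of t0 t] that t0(3) by (cases t t0 rule: linorder_cases) auto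
  have eq: "t_of P = t0"
    unfolding t_exponent_def
  proof (rule the_equality)
    show "t0 \<in> {0..1} \<and> (\<Sum>i=1..m. \<Sum>j=1..M i. P i j * ln (\<Sum>k=1..N i j. a i j k powr t0)) = 0"
      using t0 by (simp add: g_def sum_rows row_sum_def)
    show "t = t0" if "t \<in> {0..1} \<and> (\<Sum>i=1..m. \<Sum>j=1..M i. P i j * ln (\<Sum>k=1..N i j. a i j k powr t)) = 0" for t
      using that by (intro uniq) (simp add: g_def sum_rows row_sum_def)
  qed
  show "t_of P \<in> {0..1}" "(\<Sum>(i, j)\<in>rows. P i j * ln (row_sum (t_of P) i j)) = 0"
    using eq t0 by (auto simp: g_def)
  show "t_of P = t" if "(\<Sum>(i, j)\<in>rows. P i j * ln (row_sum t i j)) = 0"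
    using eq uniq[of t] that by (simp add: g_def)
qed

definition base_entropy :: "(nat \<Rightarrow> nat \<Rightarrow> real) \<Rightarrow> real" where
  "base_entropy P = (\<Sum>(i, j)\<in>rows. P i j * ln (P i j / p i))"

definition base_lyapunov :: "(nat \<Rightarrow> nat \<Rightarrow> real) \<Rightarrow> real" where
  "base_lyapunov P = (\<Sum>(i, j)\<in>rows. P i j * ln (b i j))"

text \<open>Conditional entropy of the row given the letter, divided by the vertical Lyapunov
  exponent. Both carry the opposite of their usual sign, which cancels. It is the share of the
  vertical direction in the dimension of the measure.\<close>

definition base_dim :: "(nat \<Rightarrow> nat \<Rightarrow> real) \<Rightarrow> real" where
  "base_dim P = base_entropy P / base_lyapunov P"

lemma base_lyapunov_neg: "P \<in> row_weights \<Longrightarrow> base_lyapunov P < 0"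
  using sum_row_weights_strict_mono[of P "\<lambda>i j. ln (b i j)" "\<lambda>_ _. 0"] b_pos b_less_1
  by (simp add: base_lyapunov_def case_prod_unfold)

lemma base_entropy_nonpos: "P \<in> row_weights \<Longrightarrow> base_entropy P \<le> 0"
  unfolding base_entropy_def
proof (intro sum_nonpos, clarify)
  fix i j assume P: "P \<in> row_weights" and ij: "(i, j) \<in> rows"
  show "P i j * ln (P i j / p i) \<le> 0"
  proof (cases "P i j = 0")
    case False
    have "P i j / p i \<le> 1"
      using row_weights_le[OF P ij] p_pos rowsD[OF ij] by (simp add: divide_le_eq_1)
    then show ?thesis using row_weights_nonneg[OF P ij] p_pos[of i] False rowsD[OF ij]
      by (intro mult_nonneg_nonpos) (auto simp: ln_le_zero_iff)
  qed simp
qed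

lemma base_dim_nonneg: "P \<in> row_weights \<Longrightarrow> 0 \<le> base_dim P"
  unfolding base_dim_def using base_entropy_nonpos base_lyapunov_neg
  by (intro divide_nonpos_neg)

text \<open>The exponent is kept as an extra coordinate of the compact set, so continuity of \<open>t(P)\<close> is not needed.\<close>

lemma exists_maximal_vector:
  "\<exists>P\<in>row_weights. \<forall>Q\<in>row_weights. base_dim Q + t_of Q \<le> base_dim P + t_of P"
proof -
  \<comment> \<open>Coordinates outside \<open>rows\<close> are frozen at 0, so a product over all
    index pairs is compact and no restricted function type is needed.\<close>
  define cube where "cube = (\<Pi>\<^sub>E x\<in>UNIV. if x \<in> rows then {0..1::real} else {0})"
  define K where "K = (cube \<times> {0..1::real}) \<inter>
     ((\<Inter>i\<in>{1..m}. {z. (\<Sum>j=1..M i. fst z (i, j)) = p i}) \<inter>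
     {z. (\<Sum>(i, j)\<in>rows. fst z (i, j) * ln (row_sum (snd z) i j)) = 0})"
  define F where "F z = (\<Sum>(i, j)\<in>rows. fst z (i, j) * ln (fst z (i, j) / p i)) /
      (\<Sum>(i, j)\<in>rows. fst z (i, j) * ln (b i j)) + snd z" for z :: "(nat \<times> nat \<Rightarrow> real) \<times> real"
  define vec where "vec z = (\<lambda>i j. fst z (i, j))" for z :: "(nat \<times> nat \<Rightarrow> real) \<times> real"
  have coord: "continuous_on A (\<lambda>z. fst z x)"
    for A :: "((nat \<times> nat \<Rightarrow> real) \<times> real) set" and x :: "nat \<times> nat"
  by (rule continuous_on_product_then_coordinatewise[OF continuous_on_fst[OF continuous_on_id]])
  have vecK: "vec z \<in> row_weights" "snd z = t_of (vec z)" "F z = base_dim (vec z) + t_of (vec z)" if "z \<in> K" for z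
  proof -
    show 1: "vec z \<in> row_weights"
    proof -
      have "0 \<le> fst z (i, j)" if "(i, j) \<in> rows" for i j
        using \<open>z \<in> K\<close> that PiE_mem[of "fst z" UNIV "\<lambda>x. if x \<in> rows then {0..1} else {0}" "(i, j)"]
        by (simp add: K_def cube_def mem_Times_iff)
      then show ?thesis
        using that by (simp add: K_def row_weights_def vec_def rows_def)
    qed
    show 2: "snd z = t_of (vec z)"
      using that by (intro t_of(3)[OF 1, symmetric]) (auto simp: K_def vec_def)
    show "F z = base_dim (vec z) + t_of (vec z)"
      unfolding F_def base_dim_def base_entropy_def base_lyapunov_def 2[symmetric]
      by (simp add: vec_def)
  qed
  have Kvec: "\<exists>z\<in>K. F z = base_dim P + t_of P" if P: "P \<in> row_weights" for P
  proof -
    define z where "z = (\<lambda>x. if x \<in> rows then P (fst x) (snd x) else 0, t_of P)"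
    have z: "fst z (i, j) = P i j" if "(i, j) \<in> rows" for i j using that by (simp add: z_def)
    have le1: "P i j \<le> 1" if ij: "(i, j) \<in> rows" for i j
    proof -
      have "p i \<le> (\<Sum>i=1..m. p i)"
        using p_pos rowsD[OF ij] by (intro member_le_sum) (auto intro: less_imp_le)
      then show ?thesis using row_weights_le[OF P ij] p_sum by simp
    qed
    have 1: "fst z \<in> cube"
      using row_weights_nonneg[OF P] le1 by (auto simp: cube_def z_def PiE_def Pi_def)
    have 2: "(\<Sum>j=1..M i. fst z (i, j)) = p i" if "i \<in> {1..m}" for i
      using row_weights_row_sum[OF P that] that by (simp add: z rows_def)
    have 3: "(\<Sum>(i, j)\<in>rows. fst z (i, j) * f i j) = (\<Sum>(i, j)\<in>rows. P i j * f i j)" for f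
      by (intro sum.cong) (auto simp: z)
    have "(\<Sum>(i, j)\<in>rows. fst z (i, j) * ln (fst z (i, j) / p i)) = base_entropy P"
      unfolding base_entropy_def by (intro sum.cong) (auto simp: z)
    then have "F z = base_dim P + t_of P"
      unfolding F_def 3 by (simp add: base_dim_def base_lyapunov_def z_def)
    moreover have "z \<in> K"
    proof -
      have "snd z = t_of P" by (simp add: z_def)
      then show ?thesis unfolding K_def using 1 2 t_of(1,2)[OF P] by (simp add: 3 mem_Times_iff)
    qed
    ultimately show ?thesis by blast
  qed
  have "compact K"
    unfolding K_def
  proof (rule compact_Int_closed)
    have "compactin (product_topology (\<lambda>i. euclidean) UNIV) cube"
      unfolding cube_def by (subst compactin_PiE) auto
    then have "compact cube" by (simp add: euclidean_product_topology)
    then show "compact (cube \<times> {0..1::real})" by (intro compact_Times) auto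
    show "closed ((\<Inter>i\<in>{1..m}. {z::(nat \<times> nat \<Rightarrow> real) \<times> real. (\<Sum>j=1..M i. fst z (i, j)) = p i}) \<inter>
     {z. (\<Sum>(i, j)\<in>rows. fst z (i, j) * ln (row_sum (snd z) i j)) = 0})"
    proof (intro closed_Int closed_INT ballI closed_Collect_eq)
      show "continuous_on UNIV (\<lambda>z::(nat \<times> nat \<Rightarrow> real) \<times> real. \<Sum>j=1..M i. fst z (i, j))" for i
        by (intro continuous_on_sum coord)
      show "continuous_on UNIV (\<lambda>z::(nat \<times> nat \<Rightarrow> real) \<times> real.
          \<Sum>(i, j)\<in>rows. fst z (i, j) * ln (row_sum (snd z) i j))"
        unfolding case_prod_unfold
        by (intro continuous_on_sum continuous_on_mult coord continuous_on_ln_row_sum continuous_on_snd continuous_on_id) simp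
    qed (intro continuous_on_const)+
  qed
  moreover have "K \<noteq> {}"
  proof -
    \<comment> \<open>All of \<open>p i\<close> on the first row of each letter.\<close>
    have "(\<lambda>i j. if j = 1 then p i else 0) \<in> row_weights"
      using p_pos M by (auto simp: row_weights_def less_imp_le)
    then show ?thesis using Kvec by blast
  qed
  moreover have "continuous_on K F"
  proof -
    have term_cont: "continuous_on K (\<lambda>z. fst z (i, j) * ln (fst z (i, j) / p i))" if ij: "(i, j) \<in> rows" for i j
    proof (rule continuous_on_compose2[OF continuous_on_mult_ln coord])
      show "0 < p i" using p_pos rowsD[OF ij] by blast
      show "(\<lambda>z. fst z (i, j)) ` K \<subseteq> {0..}"
        using vecK(1) row_weights_nonneg[OF _ ij] by (auto simp: vec_def)
    qed
    have "(\<Sum>(i, j)\<in>rows. fst z (i, j) * ln (b i j)) \<noteq> 0" if "z \<in> K" for z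
      using base_lyapunov_neg[OF vecK(1)[OF that]] by (simp add: base_lyapunov_def vec_def)
    moreover have "continuous_on K (\<lambda>z. \<Sum>(i, j)\<in>rows. fst z (i, j) * ln (b i j))"
      unfolding case_prod_unfold by (intro continuous_on_sum continuous_on_mult coord continuous_on_const)
    moreover have "continuous_on K (\<lambda>z. \<Sum>(i, j)\<in>rows. fst z (i, j) * ln (fst z (i, j) / p i))"
      unfolding case_prod_unfold
    proof (intro continuous_on_sum)
      fix x assume "x \<in> rows"
      then show "continuous_on K (\<lambda>z. fst z (fst x, snd x) * ln (fst z (fst x, snd x) / p (fst x)))"
        using term_cont[of "fst x" "snd x"] by simp
    qed
    ultimately show ?thesis
      unfolding F_def by (intro continuous_on_add continuous_on_divide continuous_on_snd continuous_on_id) auto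
  qed
  ultimately obtain z where z: "z \<in> K" "\<And>z'. z' \<in> K \<Longrightarrow> F z' \<le> F z"
    using continuous_attains_sup[of K F] by blast
  show ?thesis
  proof (intro bexI[OF _ vecK(1)[OF z(1)]] ballI)
    fix Q assume "Q \<in> row_weights"
    then obtain z' where "z' \<in> K" "F z' = base_dim Q + t_of Q" using Kvec by blast
    then show "base_dim Q + t_of Q \<le> base_dim (vec z) + t_of (vec z)"
      using z(2)[of z'] vecK(3)[OF z(1)] by simp
  qed
qed

end

section \<open>Codes, rectangles and cylinders\<close>

text \<open>The stopping level at scale r. Minimality makes the preceding length exceed r, so with
  ratios at least \<alpha> and r at most 1 the length at this level lies between \<alpha> r and
  r.\<close>

definition scale_index :: "(nat \<Rightarrow> real) \<Rightarrow> real \<Rightarrow> nat" where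
  "scale_index u r = (LEAST n. interval_len u n \<le> r)"

lemma interval_len_bounds:
  assumes "0 \<le> \<alpha>" "\<And>l. \<alpha> \<le> u l" "\<And>l. u l \<le> \<beta>"
  shows "\<alpha> ^ n \<le> interval_len u n" "interval_len u n \<le> \<beta> ^ n"
proof -
  have "(\<Prod>l<n. \<alpha>) \<le> interval_len u n"
    unfolding interval_len_def using assms by (intro prod_mono) auto
  then show "\<alpha> ^ n \<le> interval_len u n" by simp
  have "interval_len u n \<le> (\<Prod>l<n. \<beta>)"
    unfolding interval_len_def using assms by (intro prod_mono) (auto intro: order_trans)
  then show "interval_len u n \<le> \<beta> ^ n" by simp
qed

context
  fixes u :: "nat \<Rightarrow> real" and \<alpha> \<beta> r :: real
  assumes u: "\<And>l. \<alpha> \<le> u l" "\<And>l. u l \<le> \<beta>" and \<alpha>: "0 < \<alpha>" and \<beta>: "\<beta> < 1" and r: "0 < r"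
begin

lemma scale_index_le: "\<beta> ^ n \<le> r \<Longrightarrow> scale_index u r \<le> n"
  unfolding scale_index_def
  using interval_len_bounds(2)[of \<alpha> u \<beta> n] u \<alpha> by (intro Least_le) auto

lemma interval_len_scale_index_le: "interval_len u (scale_index u r) \<le> r"
  unfolding scale_index_def
proof (rule LeastI_ex)
  obtain n where "\<beta> ^ n < r" using real_arch_pow_inv[OF r \<beta>] by blast
  then show "\<exists>n. interval_len u n \<le> r"
    using interval_len_bounds(2)[of \<alpha> u \<beta> n] u \<alpha> by (intro exI[of _ n]) auto
qed

lemma less_interval_len: "n < scale_index u r \<Longrightarrow> r < interval_len u n"
  unfolding scale_index_def by (auto dest: not_less_Least)

lemma interval_len_scale_index_ge:
  assumes "r \<le> 1" shows "\<alpha> * r \<le> interval_len u (scale_index u r)"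
proof (cases "scale_index u r")
  case 0
  have "\<alpha> \<le> 1" using u[of 0] \<beta> by linarith
  then have "\<alpha> * r \<le> 1 * 1" using assms \<alpha> r by (intro mult_mono) auto
  then show ?thesis by (simp add: 0 interval_len_0)
next
  case (Suc n)
  then have "r < interval_len u n" by (intro less_interval_len) auto
  then have "\<alpha> * r \<le> u n * interval_len u n"
    using u(1)[of n] \<alpha> r by (intro mult_mono) auto
  then show ?thesis by (simp add: Suc interval_len_Suc mult.commute)
qed

text \<open>The stopping property: whether to stop at a level is decided by the ratios before it.
  Through it, blocks with code-dependent levels turn out to be either equal or separated.\<close>

lemma scale_index_eqI:
  assumes "\<And>l. l < scale_index u r \<Longrightarrow> u' l = u l"
  shows "scale_index u' r = scale_index u r"
proof -
  have eq: "interval_len u' n = interval_len u n" if "n \<le> scale_index u r" for n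
    using assms that by (intro interval_len_cong) auto
  show ?thesis
    unfolding scale_index_def[of u']
  proof (rule Least_equality)
    show "interval_len u' (scale_index u r) \<le> r"
      using interval_len_scale_index_le eq by simp
    show "scale_index u r \<le> n" if "interval_len u' n \<le> r" for n
      using less_interval_len[of n] eq[of n] that by (cases "n < scale_index u r") auto
  qed
qed

text \<open>The level before the stopping level is still longer than r, and its length is at most a
  power of \<beta>; the 1 is the last step. Errors proportional to the number of letters become
  errors proportional to the logarithm of r.\<close>

lemma scale_index_le_log:
  "r \<le> 1 \<Longrightarrow> real (scale_index u r) \<le> 1 + ln r / ln \<beta>"
proof (cases "scale_index u r")
  case (Suc n)
  have \<beta>0: "0 < \<beta>" using u[of 0] \<alpha> by linarith
  have "r < interval_len u n" using Suc by (intro less_interval_len) auto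
  also have "\<dots> \<le> \<beta> ^ n" using interval_len_bounds(2)[of \<alpha> u \<beta> n] u \<alpha> by auto
  finally have "ln r < ln (\<beta> ^ n)" using r by (subst ln_less_cancel_iff) auto
  then have "ln r < n * ln \<beta>" using \<beta>0 by (simp add: ln_realpow)
  then have "real n \<le> ln r / ln \<beta>" using \<beta>0 \<beta> by (simp add: neg_le_divide_eq)
  then show ?thesis using Suc by simp
next
  assume "r \<le> 1"
  case 0
  have \<beta>0: "0 < \<beta>" using u[of 0] \<alpha> by linarith
  have "0 \<le> ln r / ln \<beta>" using r \<open>r \<le> 1\<close> \<beta>0 \<beta> by (intro divide_nonpos_neg) auto
  then show ?thesis using 0 by simp
qed

end

locale carpet_sequence = random_carpet +
  fixes seq :: "nat \<Rightarrow> nat"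
  assumes seq: "\<And>l. seq l \<in> {1..m}"
begin

definition codes :: "(nat \<Rightarrow> nat \<times> nat) set" where
  "codes = {\<omega>. \<forall>l. \<omega> l \<in> row_col M N (seq l)}"

definition ra :: "(nat \<Rightarrow> nat \<times> nat) \<Rightarrow> nat \<Rightarrow> real" where "ra \<omega> l = a (seq l) (fst (\<omega> l)) (snd (\<omega> l))"
definition rb :: "(nat \<Rightarrow> nat \<times> nat) \<Rightarrow> nat \<Rightarrow> real" where "rb \<omega> l = b (seq l) (fst (\<omega> l))"
definition rc :: "(nat \<Rightarrow> nat \<times> nat) \<Rightarrow> nat \<Rightarrow> real" where "rc \<omega> l = c (seq l) (fst (\<omega> l)) (snd (\<omega> l))"
definition rd :: "(nat \<Rightarrow> nat \<times> nat) \<Rightarrow> nat \<Rightarrow> real" where "rd \<omega> l = d (seq l) (fst (\<omega> l))"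

abbreviation "width \<omega> \<equiv> interval_len (ra \<omega>)"
abbreviation "row_height \<omega> \<equiv> interval_len (rb \<omega>)"
abbreviation "left \<omega> \<equiv> interval_pos (ra \<omega>) (rc \<omega>)"
abbreviation "bottom \<omega> \<equiv> interval_pos (rb \<omega>) (rd \<omega>)"

text \<open>For L = n this is the image of the unit square under the word. With n chosen so that the
  height is comparable to the width at level L it is an approximate square.\<close>

definition rectangle :: "nat \<Rightarrow> nat \<Rightarrow> (nat \<Rightarrow> nat \<times> nat) \<Rightarrow> (real \<times> real) set" where
  "rectangle L n \<omega> = {left \<omega> L..left \<omega> L + width \<omega> L} \<times> {bottom \<omega> n..bottom \<omega> n + row_height \<omega> n}"

abbreviation "coding \<equiv> coding_map a b c d seq"

lemma codesD:
  assumes "\<omega> \<in> codes"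
  shows "(fst (\<omega> l), snd (\<omega> l)) \<in> row_col M N (seq l)" "(seq l, fst (\<omega> l)) \<in> rows"
    "fst (\<omega> l) \<in> {1..M (seq l)}" "snd (\<omega> l) \<in> {1..N (seq l) (fst (\<omega> l))}"
proof -
  have 1: "\<omega> l \<in> row_col M N (seq l)" using assms by (simp add: codes_def)
  then show "(fst (\<omega> l), snd (\<omega> l)) \<in> row_col M N (seq l)" by simp
  from 1 show "(seq l, fst (\<omega> l)) \<in> rows" "fst (\<omega> l) \<in> {1..M (seq l)}" "snd (\<omega> l) \<in> {1..N (seq l) (fst (\<omega> l))}"
    using seq[of l] by (auto simp: rows_def row_col_def)
qed

lemma ratio_bounds:
  assumes "\<omega> \<in> codes"
  shows "amin \<le> ra \<omega> l" "ra \<omega> l \<le> rb \<omega> l" "rb \<omega> l \<le> bmax" "ra \<omega> l \<le> bmax" "amin \<le> rb \<omega> l"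
    "0 < ra \<omega> l" "0 < rb \<omega> l" "0 \<le> rc \<omega> l" "rc \<omega> l + ra \<omega> l \<le> 1" "0 \<le> rd \<omega> l" "rd \<omega> l + rb \<omega> l \<le> 1"
  using codesD[OF assms, of l] seq[of l] amin_le a_le_b b_le_bmax a_le_bmax amin_le_b a_pos b_pos
    d_bounds c_bounds unfolding ra_def rb_def rc_def rd_def by simp_all

lemma width_le_height: "\<omega> \<in> codes \<Longrightarrow> width \<omega> n \<le> row_height \<omega> n"
  unfolding interval_len_def using ratio_bounds by (intro prod_mono) (auto intro: less_imp_le)

lemma width_pos: "\<omega> \<in> codes \<Longrightarrow> 0 < width \<omega> n" and height_pos: "\<omega> \<in> codes \<Longrightarrow> 0 < row_height \<omega> n"
  unfolding interval_len_def using ratio_bounds by (auto intro!: prod_pos)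

lemma width_bounds: "\<omega> \<in> codes \<Longrightarrow> amin ^ n \<le> width \<omega> n" "\<omega> \<in> codes \<Longrightarrow> width \<omega> n \<le> bmax ^ n"
  using interval_len_bounds[of amin "ra \<omega>" bmax n] ratio_bounds amin_pos by auto

lemma height_bounds: "\<omega> \<in> codes \<Longrightarrow> amin ^ n \<le> row_height \<omega> n" "\<omega> \<in> codes \<Longrightarrow> row_height \<omega> n \<le> bmax ^ n"
  using interval_len_bounds[of amin "rb \<omega>" bmax n] ratio_bounds amin_pos by auto

lemma width_le_1: "\<omega> \<in> codes \<Longrightarrow> width \<omega> n \<le> 1"
  using width_bounds(2)[of \<omega> n] bmax_pos bmax_less_1 power_le_one[of bmax n] by linarith

lemma affine_word_eq:
  "affine_word a b c d seq \<omega> n (x, y) = (left \<omega> n + width \<omega> n * x, bottom \<omega> n + row_height \<omega> n * y)"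
proof (induction n arbitrary: x y)
  case (Suc n)
  then show ?case
    by (simp add: affine_piece_def case_prod_unfold interval_pos_Suc interval_len_Suc
        ra_def rb_def rc_def rd_def algebra_simps)
qed (simp add: interval_len_0 interval_pos_0)

lemma affine_word_image:
  assumes "\<omega> \<in> codes"
  shows "affine_word a b c d seq \<omega> n ` unit_square = rectangle n n \<omega>"
proof -
  have img: "(\<lambda>x. l + w * x) ` {0..1} = {l..l + w}" if "0 < w" for l w :: real
    using that image_affinity_atLeastAtMost[of w l 0 "1::real"] by (simp add: add.commute)
  have "affine_word a b c d seq \<omega> n ` unit_square =
      map_prod (\<lambda>x. left \<omega> n + width \<omega> n * x) (\<lambda>y. bottom \<omega> n + row_height \<omega> n * y) ` ({0..1} \<times> {0..1})"
    unfolding unit_square_def by (intro image_cong refl) (auto simp: affine_word_eq)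
  also have "\<dots> = rectangle n n \<omega>"
    unfolding map_prod_surj_on[OF refl refl] rectangle_def
    using img width_pos[OF assms] height_pos[OF assms] by simp
  finally show ?thesis .
qed

lemma horizontal_nested:
  assumes "\<omega> \<in> codes" "n \<le> n'"
  shows "left \<omega> n \<le> left \<omega> n'" "left \<omega> n' + width \<omega> n' \<le> left \<omega> n + width \<omega> n"
  using interval_nested[of "ra \<omega>" "rc \<omega>" n n'] less_imp_le[OF ratio_bounds(6)[OF assms(1)]]
    ratio_bounds(8,9)[OF assms(1)] assms(2)
  by blast+

lemma vertical_nested:
  assumes "\<omega> \<in> codes" "n \<le> n'"
  shows "bottom \<omega> n \<le> bottom \<omega> n'" "bottom \<omega> n' + row_height \<omega> n' \<le> bottom \<omega> n + row_height \<omega> n"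
  using interval_nested[of "rb \<omega>" "rd \<omega>" n n'] less_imp_le[OF ratio_bounds(7)[OF assms(1)]]
    ratio_bounds(10,11)[OF assms(1)] assms(2)
  by blast+

lemma nested_limit:
  fixes l w :: "nat \<Rightarrow> real"
  assumes inc: "\<And>n n'. n \<le> n' \<Longrightarrow> l n \<le> l n'" and dec: "\<And>n n'. n \<le> n' \<Longrightarrow> l n' + w n' \<le> l n + w n"
    and w: "\<And>n. 0 \<le> w n"
  obtains x where "l \<longlonglongrightarrow> x" "\<And>n. x \<in> {l n..l n + w n}"
proof -
  have le: "l n' \<le> l n + w n" for n n'
    using inc[of n' "max n n'"] dec[of n "max n n'"] w[of "max n n'"] by simp
  obtain x where x: "l \<longlonglongrightarrow> x" "\<And>n. l n \<le> x"
    using incseq_convergent[of l "l 0 + w 0"] inc le by (auto simp: incseq_def)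
  moreover have "x \<le> l n + w n" for n
    using LIMSEQ_le_const2[OF x(1)] le by blast
  ultimately show ?thesis using that by auto
qed

text \<open>\<open>coding_map\<close> is a definite description: the monotone corners converge to a
  point of all rectangles, and it is the only one since the sides are at most
  \<open>bmax ^ n\<close>. The convergence of the corners also yields measurability of the
  coding.\<close>

lemma
  assumes \<omega>: "\<omega> \<in> codes"
  shows coding_in_rectangle_diag: "\<And>n. coding \<omega> \<in> rectangle n n \<omega>"
    and left_tendsto: "left \<omega> \<longlonglongrightarrow> fst (coding \<omega>)"
    and bottom_tendsto: "bottom \<omega> \<longlonglongrightarrow> snd (coding \<omega>)"
proof -
  obtain x where x: "left \<omega> \<longlonglongrightarrow> x" "\<And>n. x \<in> {left \<omega> n..left \<omega> n + width \<omega> n}"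
    using nested_limit[of "left \<omega>" "width \<omega>"] horizontal_nested[OF \<omega>] width_pos[OF \<omega>] by (metis less_imp_le)
  obtain y where y: "bottom \<omega> \<longlonglongrightarrow> y" "\<And>n. y \<in> {bottom \<omega> n..bottom \<omega> n + row_height \<omega> n}"
    using nested_limit[of "bottom \<omega>" "row_height \<omega>"] vertical_nested[OF \<omega>] height_pos[OF \<omega>] by (metis less_imp_le)
  have to0: "w \<longlonglongrightarrow> 0" if "\<And>n. w n \<le> bmax ^ n" "\<And>n. 0 < w n" for w :: "nat \<Rightarrow> real"
    by (rule tendsto_sandwich[of "\<lambda>_. 0" _ _ "\<lambda>n. bmax ^ n"])
      (use that bmax_pos bmax_less_1 in \<open>auto intro!: less_imp_le[OF that(2)] always_eventually LIMSEQ_realpow_zero\<close>)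
  have uniq: "x' = x" if "\<And>n. n \<ge> 1 \<Longrightarrow> x' \<in> {l n..l n + w n}" "l \<longlonglongrightarrow> x" "w \<longlonglongrightarrow> 0" for x' x :: real and l w
  proof -
    have "(\<lambda>n. l n + w n) \<longlonglongrightarrow> x + 0" using that(2,3) by (rule tendsto_add)
    then have "(\<lambda>n. x') \<longlonglongrightarrow> x"
      by (intro tendsto_sandwich[OF _ _ that(2), of "\<lambda>_. x'" "\<lambda>n. l n + w n"])
        (use that(1) in \<open>auto intro!: eventually_sequentiallyI[of 1]\<close>)
    then show ?thesis by (simp add: LIMSEQ_const_iff)
  qed
  have "coding \<omega> = (x, y)"
    unfolding coding_map_def
  proof (rule the_equality)
    show "(x, y) \<in> (\<Inter>n\<in>{1..}. affine_word a b c d seq \<omega> n ` unit_square)"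
      using x(2) y(2) by (simp add: affine_word_image[OF \<omega>] rectangle_def)
    fix z assume z: "z \<in> (\<Inter>n\<in>{1..}. affine_word a b c d seq \<omega> n ` unit_square)"
    then have z': "z \<in> rectangle n n \<omega>" if "n \<ge> 1" for n using that by (auto simp: affine_word_image[OF \<omega>])
    have "fst z = x"
      by (rule uniq[OF _ x(1) to0[OF width_bounds(2)[OF \<omega>] width_pos[OF \<omega>]]])
        (use z' in \<open>simp add: rectangle_def mem_Times_iff\<close>)
    moreover have "snd z = y"
      by (rule uniq[OF _ y(1) to0[OF height_bounds(2)[OF \<omega>] height_pos[OF \<omega>]]])
        (use z' in \<open>simp add: rectangle_def mem_Times_iff\<close>)
    ultimately show "z = (x, y)" by (simp add: prod_eq_iff)
  qed
  with x y show "\<And>n. coding \<omega> \<in> rectangle n n \<omega>" "left \<omega> \<longlonglongrightarrow> fst (coding \<omega>)" "bottom \<omega> \<longlonglongrightarrow> snd (coding \<omega>)"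
    by (auto simp: rectangle_def)
qed

lemma coding_in_rectangle:
  assumes "\<omega> \<in> codes" shows "coding \<omega> \<in> rectangle L n \<omega>"
  using coding_in_rectangle_diag[OF assms, of L] coding_in_rectangle_diag[OF assms, of n]
  by (simp add: rectangle_def mem_Times_iff)

lemma rectangle_mono:
  assumes "\<omega> \<in> codes" "L \<le> n" "n' \<le> n" shows "rectangle n n \<omega> \<subseteq> rectangle L n' \<omega>"
  using horizontal_nested[OF assms(1,2)] vertical_nested[OF assms(1,3)]
  by (auto simp: rectangle_def)

text \<open>For \<open>L \<le> n\<close>: the code of an approximate square, with \<open>L\<close> columns and \<open>n\<close> rows prescribed.\<close>

definition cylinder :: "nat \<Rightarrow> nat \<Rightarrow> (nat \<Rightarrow> nat \<times> nat) \<Rightarrow> (nat \<Rightarrow> nat \<times> nat) set" where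
  "cylinder L n \<omega> = {\<omega>'\<in>codes. (\<forall>l<L. \<omega>' l = \<omega> l) \<and> (\<forall>l<n. fst (\<omega>' l) = fst (\<omega> l))}"

lemma cylinder_self: "\<omega> \<in> codes \<Longrightarrow> \<omega> \<in> cylinder L n \<omega>"
  by (simp add: cylinder_def)

lemma cylinder_agree:
  assumes "\<omega>' \<in> cylinder L n \<omega>"
  shows "l < L \<Longrightarrow> ra \<omega>' l = ra \<omega> l" "l < L \<Longrightarrow> rc \<omega>' l = rc \<omega> l"
    "l < n \<Longrightarrow> rb \<omega>' l = rb \<omega> l" "l < n \<Longrightarrow> rd \<omega>' l = rd \<omega> l"
  using assms by (auto simp: cylinder_def ra_def rb_def rc_def rd_def)

lemma cylinder_rectangle:
  assumes "\<omega>' \<in> cylinder L n \<omega>"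
  shows "rectangle L n \<omega>' = rectangle L n \<omega>" "width \<omega>' L = width \<omega> L" "row_height \<omega>' n = row_height \<omega> n"
proof -
  show 1: "width \<omega>' L = width \<omega> L" "row_height \<omega>' n = row_height \<omega> n"
    using cylinder_agree[OF assms] by (auto intro!: interval_len_cong)
  have "left \<omega>' L = left \<omega> L" "bottom \<omega>' n = bottom \<omega> n"
    using cylinder_agree[OF assms] by (auto intro!: interval_pos_cong)
  with 1 show "rectangle L n \<omega>' = rectangle L n \<omega>" by (simp add: rectangle_def)
qed

lemma cylinder_eq: "\<omega>' \<in> cylinder L n \<omega> \<Longrightarrow> cylinder L n \<omega>' = cylinder L n \<omega>"
  by (auto simp: cylinder_def)

section \<open>Masses of cylinders\<close>

abbreviation "code_measure P \<equiv> symbolic_measure m p M N a P seq"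

abbreviation "letter_measure P l \<equiv> point_measure (row_col M N (seq l)) (\<lambda>w. ennreal (letter_weight m p M N a P (seq l) w))"

lemma space_code_measure: "space (code_measure P) = codes"
  by (auto simp: symbolic_measure_def space_PiM space_point_measure codes_def PiE_def Pi_def)

lemma letter_weight_eq:
  "letter_weight m p M N a P i (j, k) = P i j / p i * (a i j k powr t_of P / row_sum (t_of P) i j)"
  by (simp add: letter_weight_def Let_def row_sum_def)

lemma letter_weight_nonneg:
  assumes "P \<in> row_weights" "i \<in> {1..m}" "w \<in> row_col M N i"
  shows "0 \<le> letter_weight m p M N a P i w"
proof (cases w)
  case (Pair j k)
  then have ij: "(i, j) \<in> rows" using assms by (auto simp: rows_def row_col_def)
  show ?thesis
    unfolding Pair letter_weight_eq
    using row_weights_nonneg[OF assms(1) ij] p_pos[OF assms(2)] row_sum_pos[OF ij]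
    by (intro mult_nonneg_nonneg divide_nonneg_nonneg) (auto intro: less_imp_le)
qed

lemma sum_letter_weight_row:
  assumes "(i, j) \<in> rows"
  shows "(\<Sum>k=1..N i j. letter_weight m p M N a P i (j, k) * f) = P i j / p i * f"
proof -
  have "(\<Sum>k=1..N i j. letter_weight m p M N a P i (j, k) * f)
      = P i j / p i * f / row_sum (t_of P) i j * row_sum (t_of P) i j"
    unfolding letter_weight_eq row_sum_def[of "t_of P" i j]
    by (subst sum_distrib_left) (auto intro!: sum.cong)
  then show ?thesis using row_sum_pos[OF assms, of "t_of P"] by simp
qed

lemma sum_letter_weight:
  assumes "i \<in> {1..m}"
  shows "(\<Sum>w\<in>row_col M N i. letter_weight m p M N a P i w * f (fst w)) = (\<Sum>j=1..M i. P i j * f j) / p i"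
proof -
  have "(\<Sum>w\<in>row_col M N i. letter_weight m p M N a P i w * f (fst w))
      = (\<Sum>j=1..M i. \<Sum>k=1..N i j. letter_weight m p M N a P i (j, k) * f j)"
    unfolding row_col_def by (subst sum.Sigma) (auto intro!: sum.cong)
  also have "\<dots> = (\<Sum>j=1..M i. P i j / p i * f j)"
    using assms by (intro sum.cong refl sum_letter_weight_row) (auto simp: rows_def)
  finally show ?thesis by (simp add: sum_divide_distrib)
qed

lemma sum_letter_weight_1:
  assumes "P \<in> row_weights" "i \<in> {1..m}"
  shows "(\<Sum>w\<in>row_col M N i. letter_weight m p M N a P i w) = 1"
  using sum_letter_weight[OF assms(2), of P "\<lambda>_. 1"] row_weights_row_sum[OF assms] p_pos[OF assms(2)]
  by simp

lemma prob_space_letter_measure: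
  assumes P: "P \<in> row_weights" shows "prob_space (letter_measure P l)"
  using finite_row_col sum_letter_weight_1[OF P seq] letter_weight_nonneg[OF P seq]
  by (intro prob_space_point_measure) (auto simp: sum_ennreal)

lemma prob_space_code_measure: "P \<in> row_weights \<Longrightarrow> prob_space (code_measure P)"
  unfolding symbolic_measure_def by (intro prob_space_PiM prob_space_letter_measure)

text \<open>Before L a whole letter is prescribed, from L to n only its row. The weights inside a
  row add up to \<open>P i j / p i\<close>, so the factors with \<open>row_sum\<close> survive only
  for l < L.\<close>

lemma
  assumes P: "P \<in> row_weights" and \<omega>: "\<omega> \<in> codes" and Ln: "L \<le> n"
  shows cylinder_sets: "cylinder L n \<omega> \<in> sets (code_measure P)"
    and emeasure_cylinder: "emeasure (code_measure P) (cylinder L n \<omega>) =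
      ennreal ((\<Prod>l<n. P (seq l) (fst (\<omega> l)) / p (seq l)) *
               (\<Prod>l<L. ra \<omega> l powr t_of P / row_sum (t_of P) (seq l) (fst (\<omega> l))))"
proof -
  define E where "E l = (if l < L then {\<omega> l} else {w\<in>row_col M N (seq l). fst w = fst (\<omega> l)})" for l
  have E: "E l \<subseteq> row_col M N (seq l)" for l
    using \<omega> by (auto simp: E_def codes_def)
  then have E': "E l \<in> sets (letter_measure P l)" for l
    by (simp add: sets_point_measure)
  have cyl: "cylinder L n \<omega> = prod_emb UNIV (letter_measure P) {..<n} (PiE {..<n} E)"
    using Ln by (auto simp: prod_emb_def cylinder_def E_def space_point_measure codes_def PiE_iff Pi_def
        extensional_def split: if_splits)
  then show "cylinder L n \<omega> \<in> sets (code_measure P)"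
    unfolding symbolic_measure_def using E' by (auto intro!: sets_PiM_I)
  define f where "f l = P (seq l) (fst (\<omega> l)) / p (seq l)" for l
  define g where "g l = (if l < L then ra \<omega> l powr t_of P / row_sum (t_of P) (seq l) (fst (\<omega> l)) else 1)" for l
  have f: "0 \<le> f l" for l
    unfolding f_def using row_weights_nonneg[OF P codesD(2)[OF \<omega>, of l]] p_pos[OF seq[of l]]
    by (intro divide_nonneg_nonneg) auto
  have g: "0 \<le> g l" for l
    unfolding g_def using row_sum_pos[OF codesD(2)[OF \<omega>]]
    by (auto intro!: divide_nonneg_nonneg powr_ge_zero intro: less_imp_le)
  have "emeasure (code_measure P) (cylinder L n \<omega>) = (\<Prod>l<n. emeasure (letter_measure P l) (E l))"
    unfolding cyl symbolic_measure_def using E' prob_space_letter_measure[OF P]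
    by (intro emeasure_PiM_emb) auto
  also have "\<dots> = (\<Prod>l<n. ennreal (f l * g l))"
  proof (intro prod.cong refl)
    fix l
    have "emeasure (letter_measure P l) (E l) = ennreal (\<Sum>w\<in>E l. letter_weight m p M N a P (seq l) w)"
      by (subst emeasure_point_measure_finite[OF finite_row_col E])
        (intro sum_ennreal letter_weight_nonneg[OF P seq] subsetD[OF E])
    also have "(\<Sum>w\<in>E l. letter_weight m p M N a P (seq l) w) = f l * g l"
    proof (cases "l < L")
      case True
      then have "(\<Sum>w\<in>E l. letter_weight m p M N a P (seq l) w) = letter_weight m p M N a P (seq l) (fst (\<omega> l), snd (\<omega> l))"
        by (simp add: E_def)
      then show ?thesis
        using True unfolding letter_weight_eq by (simp add: f_def g_def ra_def)
    next
      case False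
      then have "E l = Pair (fst (\<omega> l)) ` {1..N (seq l) (fst (\<omega> l))}"
        using codesD(3)[OF \<omega>, of l] by (auto simp: E_def row_col_def)
      then have "(\<Sum>w\<in>E l. letter_weight m p M N a P (seq l) w) =
          (\<Sum>k=1..N (seq l) (fst (\<omega> l)). letter_weight m p M N a P (seq l) (fst (\<omega> l), k))"
        by (simp add: sum.reindex inj_on_def)
      also have "\<dots> = f l"
        using sum_letter_weight_row[OF codesD(2)[OF \<omega>, of l], of P 1] by (simp add: f_def)
      finally show ?thesis using False by (simp add: g_def)
    qed
    finally show "emeasure (letter_measure P l) (E l) = ennreal (f l * g l)" .
  qed
  also have "\<dots> = ennreal (\<Prod>l<n. f l * g l)"
    using f g by (intro prod_ennreal) auto
  also have "(\<Prod>l<n. f l * g l) = (\<Prod>l<n. f l) * (\<Prod>l<n. g l)" by (rule prod.distrib)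
  also have "(\<Prod>l<n. g l) = (\<Prod>l<L. g l)"
    using Ln by (intro prod.mono_neutral_right) (auto simp: g_def)
  also have "(\<Prod>l<L. g l) = (\<Prod>l<L. ra \<omega> l powr t_of P / row_sum (t_of P) (seq l) (fst (\<omega> l)))"
    by (intro prod.cong) (auto simp: g_def)
  finally show "emeasure (code_measure P) (cylinder L n \<omega>) =
      ennreal ((\<Prod>l<n. P (seq l) (fst (\<omega> l)) / p (seq l)) *
               (\<Prod>l<L. ra \<omega> l powr t_of P / row_sum (t_of P) (seq l) (fst (\<omega> l))))"
    by (simp add: f_def)
qed

text \<open>Positivity of the row weights matters: as \<open>ln 0 = 0\<close>, the exponential would
  stay positive for a row of weight zero, while the mass vanishes.\<close>

lemma emeasure_cylinder_exp:
  assumes P: "P \<in> row_weights" and \<omega>: "\<omega> \<in> codes" and Ln: "L \<le> n"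
    and pos: "\<And>l. l < n \<Longrightarrow> 0 < P (seq l) (fst (\<omega> l))"
  shows "emeasure (code_measure P) (cylinder L n \<omega>) =
      ennreal (exp ((\<Sum>l<n. ln (P (seq l) (fst (\<omega> l)) / p (seq l))) + t_of P * ln (width \<omega> L)
        - (\<Sum>l<L. ln (row_sum (t_of P) (seq l) (fst (\<omega> l))))))"
proof -
  have 1: "(\<Prod>l<n. P (seq l) (fst (\<omega> l)) / p (seq l)) = exp (\<Sum>l<n. ln (P (seq l) (fst (\<omega> l)) / p (seq l)))"
    using pos p_pos[OF seq] by (simp add: exp_sum)
  have 2: "ra \<omega> l powr t_of P / row_sum (t_of P) (seq l) (fst (\<omega> l)) =
      exp (t_of P * ln (ra \<omega> l) - ln (row_sum (t_of P) (seq l) (fst (\<omega> l))))" for l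
    using ratio_bounds(6)[OF \<omega>, of l] row_sum_pos[OF codesD(2)[OF \<omega>, of l]]
    by (simp add: powr_def exp_diff)
  have "(\<Prod>l<L. ra \<omega> l powr t_of P / row_sum (t_of P) (seq l) (fst (\<omega> l))) =
      exp (\<Sum>l<L. t_of P * ln (ra \<omega> l) - ln (row_sum (t_of P) (seq l) (fst (\<omega> l))))"
    unfolding 2 by (simp add: exp_sum)
  also have "(\<Sum>l<L. t_of P * ln (ra \<omega> l) - ln (row_sum (t_of P) (seq l) (fst (\<omega> l)))) =
      t_of P * ln (width \<omega> L) - (\<Sum>l<L. ln (row_sum (t_of P) (seq l) (fst (\<omega> l))))"
    unfolding interval_len_def
    by (subst ln_prod) (auto simp: sum_subtractf sum_distrib_left less_imp_neq[OF ratio_bounds(6)[OF \<omega>], symmetric])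
  finally show ?thesis
    unfolding emeasure_cylinder[OF P \<omega> Ln] 1 by (simp add: mult_exp_exp algebra_simps)
qed

end

section \<open>Lower bound\<close>

context carpet_sequence
begin

lemma measurable_code_letter:
  fixes f :: "nat \<times> nat \<Rightarrow> real"
  shows "(\<lambda>\<omega>. f (\<omega> l)) \<in> borel_measurable (code_measure P)"
  unfolding symbolic_measure_def
  by (rule measurable_compose[where N = "letter_measure P l" and g = f])
    (auto intro: measurable_component_singleton)

lemma measurable_coding: "coding \<in> borel_measurable (code_measure P)"
proof -
  have [measurable]: "(\<lambda>\<omega>. ra \<omega> l) \<in> borel_measurable (code_measure P)"
    "(\<lambda>\<omega>. rb \<omega> l) \<in> borel_measurable (code_measure P)"
    "(\<lambda>\<omega>. rc \<omega> l) \<in> borel_measurable (code_measure P)"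
    "(\<lambda>\<omega>. rd \<omega> l) \<in> borel_measurable (code_measure P)" for l
    unfolding ra_def rb_def rc_def rd_def by (rule measurable_code_letter)+
  have [measurable]: "(\<lambda>\<omega>. left \<omega> n) \<in> borel_measurable (code_measure P)"
    "(\<lambda>\<omega>. bottom \<omega> n) \<in> borel_measurable (code_measure P)" for n
    unfolding interval_pos_def interval_len_def by measurable
  have "(\<lambda>\<omega>. fst (coding \<omega>)) \<in> borel_measurable (code_measure P)"
    by (rule borel_measurable_LIMSEQ_real[where u = "\<lambda>n \<omega>. left \<omega> n"])
      (auto simp: space_code_measure left_tendsto)
  moreover have "(\<lambda>\<omega>. snd (coding \<omega>)) \<in> borel_measurable (code_measure P)"
    by (rule borel_measurable_LIMSEQ_real[where u = "\<lambda>n \<omega>. bottom \<omega> n"])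
      (auto simp: space_code_measure bottom_tendsto)
  ultimately have "(\<lambda>\<omega>. (fst (coding \<omega>), snd (coding \<omega>))) \<in> borel_measurable (code_measure P)"
    by (rule borel_measurable_Pair)
  then show ?thesis by simp
qed

abbreviation "limset \<equiv> limit_set M N a b c d seq"

lemma affine_word_cong:
  assumes "\<And>l. l < n \<Longrightarrow> \<omega> l = \<omega>' l"
  shows "affine_word a b c d seq \<omega> n = affine_word a b c d seq \<omega>' n"
  using assms by (induction n) auto

lemma closed_limit_set: "closed limset"
proof -
  have cont: "continuous_on A (affine_word a b c d seq \<omega> n)" for \<omega> n A
  proof -
    have "affine_word a b c d seq \<omega> n =
      (\<lambda>z. (left \<omega> n + width \<omega> n * fst z, bottom \<omega> n + row_height \<omega> n * snd z))"
      using affine_word_eq by auto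
    then show ?thesis by (auto intro!: continuous_intros)
  qed
  have "compact unit_square" unfolding unit_square_def by (intro compact_Times) auto
  then show ?thesis
    unfolding limit_set_def
    by (intro closed_INT ballI closed_UN finite_PiE finite_row_col compact_imp_closed
        compact_continuous_image cont) auto
qed

lemma coding_in_limit_set:
  assumes "\<omega> \<in> codes" shows "coding \<omega> \<in> limset"
  unfolding limit_set_def
proof
  fix n
  have "restrict \<omega> {..<n} \<in> (\<Pi>\<^sub>E l\<in>{..<n}. row_col M N (seq l))"
    using assms by (auto simp: codes_def)
  moreover have "affine_word a b c d seq (restrict \<omega> {..<n}) n = affine_word a b c d seq \<omega> n"
    by (rule affine_word_cong) auto
  ultimately show "coding \<omega> \<in> (\<Union>\<omega>\<in>(\<Pi>\<^sub>E l\<in>{..<n}. row_col M N (seq l)). affine_word a b c d seq \<omega> n ` unit_square)"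
    using coding_in_rectangle[OF assms, of n n] affine_word_image[OF assms, of n]
    by (intro UN_I[of "restrict \<omega> {..<n}"]) simp_all
qed

abbreviation "carpet P \<equiv> carpet_measure m p M N a b c d P seq"

lemma sets_carpet: "sets (carpet P) = sets borel"
  by (simp add: carpet_measure_def)

lemma emeasure_carpet:
  "F \<in> sets borel \<Longrightarrow> emeasure (carpet P) F = emeasure (code_measure P) {\<omega>\<in>codes. coding \<omega> \<in> F}"
  unfolding carpet_measure_def using measurable_coding
  by (subst emeasure_distr) (auto simp: space_code_measure intro!: arg_cong2[where f = emeasure])

text \<open>The limit set competes in the infimum: it is closed, hence Borel, and it contains the
  image of every code.\<close>

lemma hausdorff_dim_carpet_le:
  assumes "P \<in> row_weights"
  shows "hausdorff_dim_measure (carpet P) \<le> hausdorff_dim limset"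
proof -
  interpret prob_space "code_measure P" by (rule prob_space_code_measure[OF assms])
  have "limset \<in> sets borel" using closed_limit_set by auto
  moreover have "{\<omega>\<in>codes. coding \<omega> \<in> limset} = space (code_measure P)"
    using coding_in_limit_set by (auto simp: space_code_measure)
  ultimately show ?thesis
    unfolding hausdorff_dim_measure_def
    by (intro Inf_lower) (auto simp: sets_carpet emeasure_carpet emeasure_space_1)
qed

definition letter_count :: "nat \<Rightarrow> nat \<Rightarrow> nat" where
  "letter_count i n = card {l. l < n \<and> seq l = i}"

lemma sum_seq_eq: "(\<Sum>l<n. f (seq l)) = (\<Sum>i=1..m. real (letter_count i n) * f i)"
proof -
  have "(\<Sum>l<n. f (seq l)) = (\<Sum>i\<in>{1..m}. \<Sum>l\<in>{l\<in>{..<n}. seq l = i}. f (seq l))"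
    using seq by (intro sum.group[symmetric]) auto
  also have "\<dots> = (\<Sum>i=1..m. real (letter_count i n) * f i)"
  proof (intro sum.cong refl)
    fix i
    have "(\<Sum>l\<in>{l\<in>{..<n}. seq l = i}. f (seq l)) = (\<Sum>l\<in>{l\<in>{..<n}. seq l = i}. f i)"
      by (intro sum.cong) auto
    then show "(\<Sum>l\<in>{l\<in>{..<n}. seq l = i}. f (seq l)) = real (letter_count i n) * f i"
      by (simp add: letter_count_def)
  qed
  finally show ?thesis .
qed

text \<open>The only property of the random sequence that the two bounds use. Both hold for every
  individual sequence with these letter frequencies.\<close>

definition typical :: bool where
  "typical \<longleftrightarrow> (\<forall>i\<in>{1..m}. (\<lambda>n. real (letter_count i n) / n) \<longlonglongrightarrow> p i)"

text \<open>For a fixed sequence the letters of a code are independent, with means that depend on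
  \<open>seq l\<close>. The law of large numbers replaces the sum by these means, and the letter
  frequencies average the means to the P-mean of f.\<close>

lemma AE_average_tendsto_0:
  assumes P: "P \<in> row_weights" and "typical" and zero: "(\<Sum>(i, j)\<in>rows. P i j * f i j) = 0"
  shows "AE \<omega> in code_measure P. (\<lambda>n. (\<Sum>l<n. f (seq l) (fst (\<omega> l))) / n) \<longlonglongrightarrow> 0"
proof -
  define e where "e i = (\<Sum>j=1..M i. P i j * f i j) / p i" for i
  define C where "C = (\<Sum>(i, j)\<in>rows. \<bar>f i j\<bar>)"
  have bd: "\<bar>f (seq l) (fst w)\<bar> \<le> C" if "w \<in> row_col M N (seq l)" for l w
  proof -
    have "(seq l, fst w) \<in> rows" using that seq[of l] by (auto simp: rows_def row_col_def)
    from member_le_sum[OF this, of "\<lambda>(i, j). \<bar>f i j\<bar>"] finite_rows show ?thesis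
      by (auto simp: C_def)
  qed
  have "(\<lambda>n. \<Sum>i=1..m. real (letter_count i n) / n * e i) \<longlonglongrightarrow> (\<Sum>i=1..m. p i * e i)"
    using \<open>typical\<close> unfolding typical_def by (intro tendsto_sum tendsto_mult tendsto_const) auto
  also have "(\<lambda>n. \<Sum>i=1..m. real (letter_count i n) / n * e i) = (\<lambda>n. (\<Sum>l<n. e (seq l)) / n)"
    unfolding sum_seq_eq by (simp add: sum_divide_distrib)
  also have "(\<Sum>i=1..m. p i * e i) = (\<Sum>(i, j)\<in>rows. P i j * f i j)"
    unfolding sum_rows e_def using p_pos by (intro sum.cong) (auto simp: less_imp_neq[symmetric])
  finally have mean: "(\<lambda>n. (\<Sum>l<n. e (seq l)) / n) \<longlonglongrightarrow> 0" using zero by simp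
  have "AE \<omega> in code_measure P. (\<lambda>n. (\<Sum>l<n. f (seq l) (fst (\<omega> l)) -
      (\<Sum>w\<in>row_col M N (seq l). letter_weight m p M N a P (seq l) w * f (seq l) (fst w))) / n) \<longlonglongrightarrow> 0"
    unfolding symbolic_measure_def
    by (rule slln_product_point_measure[where X = "\<lambda>l w. f (seq l) (fst w)" and C = C])
      (use finite_row_col letter_weight_nonneg[OF P seq] sum_letter_weight_1[OF P seq] bd in auto)
  then show ?thesis
  proof eventually_elim
    case (elim \<omega>)
    have "(\<lambda>n. (\<Sum>l<n. f (seq l) (fst (\<omega> l)) - e (seq l)) / n) \<longlonglongrightarrow> 0"
      using elim by (simp add: sum_letter_weight[OF seq] e_def)
    from tendsto_add[OF this mean] show ?case
      by (simp add: sum_subtractf flip: add_divide_distrib)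
  qed
qed

section \<open>Approximate squares at a given scale\<close>

lemma row_index_facts:
  assumes "\<omega> \<in> codes" "0 < r"
  shows "row_height \<omega> (scale_index (rb \<omega>) r) \<le> r"
    "n < scale_index (rb \<omega>) r \<Longrightarrow> r < row_height \<omega> n"
    "r \<le> 1 \<Longrightarrow> amin * r \<le> row_height \<omega> (scale_index (rb \<omega>) r)"
    "r \<le> 1 \<Longrightarrow> real (scale_index (rb \<omega>) r) \<le> 1 + ln r / ln bmax"
    "bmax ^ n \<le> r \<Longrightarrow> scale_index (rb \<omega>) r \<le> n"
    "(\<And>l. l < scale_index (rb \<omega>) r \<Longrightarrow> rb \<omega>' l = rb \<omega> l) \<Longrightarrow> scale_index (rb \<omega>') r = scale_index (rb \<omega>) r"
  using interval_len_scale_index_le[of amin "rb \<omega>" bmax r] less_interval_len[of amin "rb \<omega>" bmax r n]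
    interval_len_scale_index_ge[of amin "rb \<omega>" bmax r] scale_index_le_log[of amin "rb \<omega>" bmax r]
    scale_index_le[of amin "rb \<omega>" bmax r n] scale_index_eqI[of amin "rb \<omega>" bmax r "rb \<omega>'"]
    ratio_bounds[OF assms(1)] amin_pos bmax_less_1 assms(2) by auto

lemma column_index_facts:
  assumes "\<omega> \<in> codes" "0 < r"
  shows "width \<omega> (scale_index (ra \<omega>) r) \<le> r"
    "n < scale_index (ra \<omega>) r \<Longrightarrow> r < width \<omega> n"
    "r \<le> 1 \<Longrightarrow> amin * r \<le> width \<omega> (scale_index (ra \<omega>) r)"
    "(\<And>l. l < scale_index (ra \<omega>) r \<Longrightarrow> ra \<omega>' l = ra \<omega> l) \<Longrightarrow> scale_index (ra \<omega>') r = scale_index (ra \<omega>) r"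
  using interval_len_scale_index_le[of amin "ra \<omega>" bmax r] less_interval_len[of amin "ra \<omega>" bmax r n]
    interval_len_scale_index_ge[of amin "ra \<omega>" bmax r]
    scale_index_eqI[of amin "ra \<omega>" bmax r "ra \<omega>'"]
    ratio_bounds[OF assms(1)] amin_pos bmax_less_1 assms(2) by auto

lemma columns_le_rows_stopping:
  assumes "\<omega> \<in> codes" "0 < r"
  shows "scale_index (ra \<omega>) r \<le> scale_index (rb \<omega>) r"
proof (rule ccontr)
  assume "\<not> ?thesis"
  then have "r < width \<omega> (scale_index (rb \<omega>) r)" using column_index_facts(2)[OF assms] by auto
  also have "\<dots> \<le> row_height \<omega> (scale_index (rb \<omega>) r)" by (rule width_le_height[OF assms(1)])
  also have "\<dots> \<le> r" by (rule row_index_facts(1)[OF assms])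
  finally show False by simp
qed

definition block :: "real \<Rightarrow> (nat \<Rightarrow> nat \<times> nat) \<Rightarrow> (nat \<Rightarrow> nat \<times> nat) set" where
  "block r \<omega> = cylinder (scale_index (ra \<omega>) r) (scale_index (rb \<omega>) r) \<omega>"

text \<open>If the rows differ before both row levels, the first difference separates vertically.
  Otherwise the stopping property makes the row levels equal. Then a first differing letter before
  both column levels lies in a common row and separates horizontally; if there is none, the column
  levels agree too and the blocks coincide.\<close>

lemma block_rectangles_separated:
  assumes \<omega>: "\<omega> \<in> codes" and \<omega>': "\<omega>' \<in> codes" and r: "0 < r" and neq: "block r \<omega> \<noteq> block r \<omega>'"
  defines "L \<equiv> scale_index (ra \<omega>) r" and "n \<equiv> scale_index (rb \<omega>) r"
    and "L' \<equiv> scale_index (ra \<omega>') r" and "n' \<equiv> scale_index (rb \<omega>') r"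
  shows "left \<omega> L + width \<omega> L \<le> left \<omega>' L' \<or> left \<omega>' L' + width \<omega>' L' \<le> left \<omega> L \<or>
    bottom \<omega> n + row_height \<omega> n \<le> bottom \<omega>' n' \<or> bottom \<omega>' n' + row_height \<omega>' n' \<le> bottom \<omega> n"
proof (cases "\<exists>l. l < n \<and> l < n' \<and> fst (\<omega> l) \<noteq> fst (\<omega>' l)")
  case True
  define l where "l = (LEAST l. l < n \<and> l < n' \<and> fst (\<omega> l) \<noteq> fst (\<omega>' l))"
  have l: "l < n" "l < n'" "fst (\<omega> l) \<noteq> fst (\<omega>' l)"
    using LeastI_ex[OF True] unfolding l_def by auto
  have eq: "fst (\<omega> k) = fst (\<omega>' k)" if "k < l" for k
    using not_less_Least[of k "\<lambda>l. l < n \<and> l < n' \<and> fst (\<omega> l) \<noteq> fst (\<omega>' l)"] that l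
    unfolding l_def by auto
  have sep: "bottom \<omega>\<^sub>1 n\<^sub>1 + row_height \<omega>\<^sub>1 n\<^sub>1 \<le> bottom \<omega>\<^sub>2 n\<^sub>2"
    if "\<omega>\<^sub>1 \<in> codes" "\<omega>\<^sub>2 \<in> codes" "l < n\<^sub>1" "l < n\<^sub>2" "fst (\<omega>\<^sub>1 l) < fst (\<omega>\<^sub>2 l)"
      "\<And>k. k < l \<Longrightarrow> fst (\<omega>\<^sub>1 k) = fst (\<omega>\<^sub>2 k)" for \<omega>\<^sub>1 \<omega>\<^sub>2 n\<^sub>1 n\<^sub>2
  proof (rule interval_separated[where k = l])
    show "rd \<omega>\<^sub>1 l + rb \<omega>\<^sub>1 l \<le> rd \<omega>\<^sub>2 l"
      using d_ordered[OF seq[of l], of "fst (\<omega>\<^sub>1 l)" "fst (\<omega>\<^sub>2 l)"] that codesD(3)[OF that(1), of l] codesD(3)[OF that(2), of l]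
      by (simp add: rd_def rb_def)
  qed (use that ratio_bounds[OF that(1)] ratio_bounds[OF that(2)] in \<open>auto simp: rb_def rd_def intro: less_imp_le\<close>)
  show ?thesis
    using sep[OF \<omega> \<omega>' l(1,2)] sep[OF \<omega>' \<omega> l(2,1)] l(3) eq by (metis linorder_less_linear)
next
  case False
  have nn: "n = n'"
  proof (cases "n \<le> n'")
    case True
    have "n' = n" unfolding n'_def n_def
      by (rule row_index_facts(6)[OF \<omega> r]) (use False True in \<open>auto simp: rb_def n_def n'_def\<close>)
    then show ?thesis by simp
  next
    case le: False
    show "n = n'" unfolding n'_def n_def
      by (rule row_index_facts(6)[OF \<omega>' r]) (use False le in \<open>auto simp: rb_def n_def n'_def\<close>)
  qed
  with False have rows_eq: "fst (\<omega> l) = fst (\<omega>' l)" if "l < n" for l using that by auto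
  have Ln: "L \<le> n" "L' \<le> n"
    using columns_le_rows_stopping[OF \<omega> r] columns_le_rows_stopping[OF \<omega>' r] nn
    by (auto simp: L_def L'_def n_def n'_def)
  show ?thesis
  proof (cases "\<exists>l. l < L \<and> l < L' \<and> \<omega> l \<noteq> \<omega>' l")
    case True
    define l where "l = (LEAST l. l < L \<and> l < L' \<and> \<omega> l \<noteq> \<omega>' l)"
    have l: "l < L" "l < L'" "\<omega> l \<noteq> \<omega>' l"
      using LeastI_ex[OF True] unfolding l_def by auto
    have eq: "\<omega> k = \<omega>' k" if "k < l" for k
      using not_less_Least[of k "\<lambda>l. l < L \<and> l < L' \<and> \<omega> l \<noteq> \<omega>' l"] that l
      unfolding l_def by auto
    have fst_eq: "fst (\<omega> l) = fst (\<omega>' l)" using rows_eq l(1) Ln by simp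
    have sep: "left \<omega>\<^sub>1 n\<^sub>1 + width \<omega>\<^sub>1 n\<^sub>1 \<le> left \<omega>\<^sub>2 n\<^sub>2"
      if "\<omega>\<^sub>1 \<in> codes" "\<omega>\<^sub>2 \<in> codes" "l < n\<^sub>1" "l < n\<^sub>2" "snd (\<omega>\<^sub>1 l) < snd (\<omega>\<^sub>2 l)" "fst (\<omega>\<^sub>1 l) = fst (\<omega>\<^sub>2 l)"
        "\<And>k. k < l \<Longrightarrow> \<omega>\<^sub>1 k = \<omega>\<^sub>2 k" for \<omega>\<^sub>1 \<omega>\<^sub>2 n\<^sub>1 n\<^sub>2
    proof (rule interval_separated[where k = l])
      show "rc \<omega>\<^sub>1 l + ra \<omega>\<^sub>1 l \<le> rc \<omega>\<^sub>2 l"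
        using c_ordered[OF seq[of l] codesD(3)[OF that(2), of l], of "snd (\<omega>\<^sub>1 l)" "snd (\<omega>\<^sub>2 l)"]
          that codesD(4)[OF that(1), of l] codesD(4)[OF that(2), of l]
        by (simp add: rc_def ra_def)
    qed (use that ratio_bounds[OF that(1)] ratio_bounds[OF that(2)] in \<open>auto simp: ra_def rc_def intro: less_imp_le\<close>)
    have "snd (\<omega> l) \<noteq> snd (\<omega>' l)" using l(3) fst_eq by (simp add: prod_eq_iff)
    then show ?thesis
      using sep[OF \<omega> \<omega>' l(1,2) _ fst_eq] sep[OF \<omega>' \<omega> l(2,1) _ fst_eq[symmetric]] eq by (metis linorder_less_linear)
  next
    case False
    have LL: "L = L'"
    proof (cases "L \<le> L'")
      case True
      have "L' = L" unfolding L'_def L_def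
        by (rule column_index_facts(4)[OF \<omega> r]) (use False True in \<open>auto simp: ra_def L_def L'_def\<close>)
      then show ?thesis by simp
    next
      case le: False
      show "L = L'" unfolding L'_def L_def
        by (rule column_index_facts(4)[OF \<omega>' r]) (use False le in \<open>auto simp: ra_def L_def L'_def\<close>)
    qed
    with False have "\<omega> l = \<omega>' l" if "l < L" for l using that by auto
    then have "\<omega> \<in> cylinder L' n' \<omega>'" using rows_eq \<omega> by (simp add: cylinder_def flip: LL nn)
    from cylinder_eq[OF this] have "block r \<omega> = block r \<omega>'"
      using LL nn unfolding block_def L_def n_def L'_def n'_def by simp
    with neq show ?thesis by simp
  qed
qed

lemma card_blocks_le:
  assumes T: "T \<subseteq> codes" and r: "0 < r" "r \<le> 1" and U: "bounded U" "diameter U \<le> r"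
    and TU: "\<And>\<omega>. \<omega> \<in> T \<Longrightarrow> coding \<omega> \<in> U"
  shows "finite (block r ` T) \<and> card (block r ` T) \<le> nat \<lfloor>16 / amin\<^sup>2\<rfloor>"
\<comment> \<open>Finiteness of the family is not known beforehand, so the area count is applied to
  its finite subsets.\<close>
proof (rule finite_if_finite_subsets_card_bdd)
  fix B assume B: "B \<subseteq> block r ` T" "finite B"
  then have "\<forall>\<beta>\<in>B. \<exists>\<omega>\<in>T. block r \<omega> = \<beta>" by auto
  then obtain \<rho> where \<rho>: "\<And>\<beta>. \<beta> \<in> B \<Longrightarrow> \<rho> \<beta> \<in> T" "\<And>\<beta>. \<beta> \<in> B \<Longrightarrow> block r (\<rho> \<beta>) = \<beta>" by metis
  have \<rho>': "\<rho> \<beta> \<in> codes" if "\<beta> \<in> B" for \<beta> using \<rho>(1)[OF that] T by auto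
  define L where "L \<omega> = scale_index (ra \<omega>) r" for \<omega>
  define n where "n \<omega> = scale_index (rb \<omega>) r" for \<omega>
  have "real (card B) \<le> 16 / amin\<^sup>2"
  proof (rule card_separated_rectangles_le[where x = "\<lambda>\<beta>. left (\<rho> \<beta>) (L (\<rho> \<beta>))" and w = "\<lambda>\<beta>. width (\<rho> \<beta>) (L (\<rho> \<beta>))"
        and y = "\<lambda>\<beta>. bottom (\<rho> \<beta>) (n (\<rho> \<beta>))" and h = "\<lambda>\<beta>. row_height (\<rho> \<beta>) (n (\<rho> \<beta>))", OF B(2) r(1) amin_pos U])
    fix \<beta> assume \<beta>: "\<beta> \<in> B"
    show "amin * r \<le> width (\<rho> \<beta>) (L (\<rho> \<beta>)) \<and> width (\<rho> \<beta>) (L (\<rho> \<beta>)) \<le> r"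
      using column_index_facts(1,3)[OF \<rho>'[OF \<beta>] r(1)] r(2) by (simp add: L_def)
    show "amin * r \<le> row_height (\<rho> \<beta>) (n (\<rho> \<beta>)) \<and> row_height (\<rho> \<beta>) (n (\<rho> \<beta>)) \<le> r"
      using row_index_facts(1,3)[OF \<rho>'[OF \<beta>] r(1)] r(2) by (simp add: n_def)
    show "\<exists>q\<in>U. q \<in> {left (\<rho> \<beta>) (L (\<rho> \<beta>))..left (\<rho> \<beta>) (L (\<rho> \<beta>)) + width (\<rho> \<beta>) (L (\<rho> \<beta>))} \<times>
        {bottom (\<rho> \<beta>) (n (\<rho> \<beta>))..bottom (\<rho> \<beta>) (n (\<rho> \<beta>)) + row_height (\<rho> \<beta>) (n (\<rho> \<beta>))}"
      using TU[OF \<rho>(1)[OF \<beta>]] coding_in_rectangle[OF \<rho>'[OF \<beta>]] unfolding rectangle_def by blast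
  next
    fix \<beta> \<beta>' assume "\<beta> \<in> B" "\<beta>' \<in> B" "\<beta> \<noteq> \<beta>'"
    then show "left (\<rho> \<beta>) (L (\<rho> \<beta>)) + width (\<rho> \<beta>) (L (\<rho> \<beta>)) \<le> left (\<rho> \<beta>') (L (\<rho> \<beta>')) \<or>
        left (\<rho> \<beta>') (L (\<rho> \<beta>')) + width (\<rho> \<beta>') (L (\<rho> \<beta>')) \<le> left (\<rho> \<beta>) (L (\<rho> \<beta>)) \<or>
        bottom (\<rho> \<beta>) (n (\<rho> \<beta>)) + row_height (\<rho> \<beta>) (n (\<rho> \<beta>)) \<le> bottom (\<rho> \<beta>') (n (\<rho> \<beta>')) \<or>
        bottom (\<rho> \<beta>') (n (\<rho> \<beta>')) + row_height (\<rho> \<beta>') (n (\<rho> \<beta>')) \<le> bottom (\<rho> \<beta>) (n (\<rho> \<beta>))"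
      unfolding L_def n_def using \<rho>' \<rho>(2) r by (intro block_rectangles_separated) auto
  qed
  then show "card B \<le> nat \<lfloor>16 / amin\<^sup>2\<rfloor>" by (simp add: le_nat_floor)
qed

text \<open>The law of large numbers gives bounds from an index that depends on the code.
  Restricting to a part of positive mass on which this index is at most k makes them uniform, and
  the mass distribution principle applies to this part, whose image lies in F.\<close>

lemma carpet_dim_ge:
  assumes P: "P \<in> row_weights" and ty: "typical"
  shows "ennreal (base_dim P + t_of P) \<le> hausdorff_dim_measure (carpet P)"
  unfolding hausdorff_dim_measure_def
proof (rule Inf_greatest, clarify, rule hausdorff_dim_geI)
  fix F s assume F: "F \<in> sets (carpet P)" "emeasure (carpet P) F = 1"
    and s: "0 < s" "s < base_dim P + t_of P"
  interpret prob_space "code_measure P" by (rule prob_space_code_measure[OF P])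
  define lam t where "lam = base_dim P" and "t = t_of P"
  define g where "g i j = ln (P i j / p i) - lam * ln (b i j)" for i j
  define h where "h i j = - ln (row_sum t i j)" for i j
  \<comment> \<open>Both functions have \<open>P\<close>-mean zero, and the logarithm of the mass of an approximate square of side
    \<open>\<delta>\<close> is about \<open>(lam + t) ln \<delta>\<close> plus their sums along the code.\<close>
  define \<epsilon> where "\<epsilon> = (lam + t - s) * (- ln bmax) / 4"
  have lb: "ln bmax < 0" using bmax_pos bmax_less_1 by simp
  have \<epsilon>: "0 < \<epsilon>" unfolding \<epsilon>_def using s lb by (auto simp: lam_def t_def intro!: mult_pos_neg)
  have lam: "0 \<le> lam" and t: "0 \<le> t" using base_dim_nonneg[OF P] t_of(1)[OF P] by (auto simp: lam_def t_def)
  have "(\<Sum>(i, j)\<in>rows. P i j * g i j) = base_entropy P - lam * base_lyapunov P"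
    by (simp add: g_def base_entropy_def base_lyapunov_def case_prod_unfold sum_distrib_left
        right_diff_distrib sum_subtractf mult.left_commute)
  also have "\<dots> = 0" using base_lyapunov_neg[OF P] by (simp add: lam_def base_dim_def)
  finally have AEg: "AE \<omega> in code_measure P. (\<lambda>n. (\<Sum>l<n. g (seq l) (fst (\<omega> l))) / n) \<longlonglongrightarrow> 0"
    by (intro AE_average_tendsto_0 P ty)
  have "(\<Sum>(i, j)\<in>rows. P i j * h i j) = 0"
    using t_of(2)[OF P] by (simp add: h_def t_def case_prod_unfold sum_negf)
  then have AEh: "AE \<omega> in code_measure P. (\<lambda>n. (\<Sum>l<n. h (seq l) (fst (\<omega> l))) / n) \<longlonglongrightarrow> 0"
    by (intro AE_average_tendsto_0 P ty)
  \<comment> \<open>One-sided bounds suffice, as only upper bounds for masses are wanted.\<close>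
  define E where "E k = {\<omega>\<in>codes. \<forall>n\<ge>k. (\<Sum>l<n. g (seq l) (fst (\<omega> l))) \<le> \<epsilon> * n \<and> (\<Sum>l<n. h (seq l) (fst (\<omega> l))) \<le> \<epsilon> * n}" for k
  define G where "G k = E k \<inter> {\<omega>\<in>codes. coding \<omega> \<in> F}" for k
  have cF: "{\<omega>\<in>codes. coding \<omega> \<in> F} \<in> sets (code_measure P)"
    using measurable_sets[OF measurable_coding, of F P] F(1)
    by (auto simp: sets_carpet space_code_measure vimage_def Int_def conj_commute)
  have [measurable]: "(\<lambda>\<omega>. g (seq l) (fst (\<omega> l))) \<in> borel_measurable (code_measure P)"
      "(\<lambda>\<omega>. h (seq l) (fst (\<omega> l))) \<in> borel_measurable (code_measure P)" for l
    by (rule measurable_code_letter)+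
  have Esets: "E k \<in> sets (code_measure P)" for k
    unfolding E_def space_code_measure[of P, symmetric] by measurable
  have Gsets: "G k \<in> sets (code_measure P)" for k
    unfolding G_def using cF Esets by auto
  have "\<exists>k. 0 < emeasure (code_measure P) (G k)"
  proof (rule ccontr)
    assume "\<not> ?thesis"
    then have "\<forall>k. emeasure (code_measure P) (G k) = 0" by (simp add: not_gr_zero)
    then have "\<forall>k. AE \<omega> in code_measure P. \<omega> \<notin> G k"
      using Gsets by (auto intro!: AE_not_in)
    then have "AE \<omega> in code_measure P. \<forall>k. \<omega> \<notin> G k" by (simp add: AE_all_countable)
    moreover have "AE \<omega> in code_measure P. \<omega> \<in> {\<omega>\<in>codes. coding \<omega> \<in> F}"
      using F cF by (intro AE_prob_1) (simp add: emeasure_carpet sets_carpet measure_def)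
    ultimately have "AE \<omega> in code_measure P. False"
      using AEg AEh AE_space
    proof eventually_elim
      case (elim \<omega>)
      have ev: "eventually (\<lambda>n. f n \<le> \<epsilon> * n) sequentially" if "(\<lambda>n. f n / real n) \<longlonglongrightarrow> 0" for f
        using order_tendstoD(2)[OF that \<epsilon>] eventually_gt_at_top[of 0]
        by eventually_elim (simp add: field_simps)
      have "eventually (\<lambda>n. (\<Sum>l<n. g (seq l) (fst (\<omega> l))) \<le> \<epsilon> * n \<and> (\<Sum>l<n. h (seq l) (fst (\<omega> l))) \<le> \<epsilon> * n) sequentially"
        using ev[OF elim(3)] ev[OF elim(4)] by (rule eventually_conj)
      then obtain k where "\<omega> \<in> E k"
        unfolding eventually_sequentially E_def using elim(2) by auto
      then have "\<omega> \<in> G k" using elim(2) by (auto simp: G_def)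
      then show False using elim(1) by blast
    qed
    then show False using AE_False by simp
  qed
  then obtain k where k: "0 < emeasure (code_measure P) (G k)" by blast
  \<comment> \<open>Below \<open>amin ^ k\<close> the column level is at least k, so both bounds in
    \<open>E k\<close> apply; the factor 1/2 makes this strict. Below \<open>bmax\<close> the
    quotient \<open>ln \<delta> / ln bmax\<close> is at least 1 and absorbs the 1 in the bound of
    the row level.\<close>
  define \<delta>0 where "\<delta>0 = min bmax (amin ^ k / 2)"
  define K where "K = real (nat \<lfloor>16 / amin\<^sup>2\<rfloor>) + 1"
  have small: "emeasure (code_measure P) (block \<delta> \<omega>) \<le> ennreal (\<delta> powr s)"
    if \<delta>: "0 < \<delta>" "\<delta> \<le> \<delta>0" and \<omega>: "\<omega> \<in> G k" for \<delta> \<omega>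
  proof -
    have \<omega>c: "\<omega> \<in> codes" using \<omega> by (auto simp: G_def)
    define L n where "L = scale_index (ra \<omega>) \<delta>" and "n = scale_index (rb \<omega>) \<delta>"
    have \<delta>1: "\<delta> \<le> bmax" "\<delta> < 1" "\<delta> < amin ^ k"
      using \<delta> bmax_less_1 zero_less_power[OF amin_pos, of k] by (auto simp: \<delta>0_def min_def split: if_splits)
    have Ln: "L \<le> n" unfolding L_def n_def by (rule columns_le_rows_stopping[OF \<omega>c \<delta>(1)])
    have kL: "k \<le> L"
    proof (rule ccontr)
      assume "\<not> k \<le> L"
      then have "amin ^ k \<le> amin ^ L" using amin_pos amin_less_1 by (intro power_decreasing) auto
      also have "\<dots> \<le> width \<omega> L" by (rule width_bounds(1)[OF \<omega>c])
      also have "\<dots> \<le> \<delta>" unfolding L_def by (rule column_index_facts(1)[OF \<omega>c \<delta>(1)])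
      finally show False using \<delta>1 by simp
    qed
    show ?thesis
    proof (cases "\<exists>l<n. P (seq l) (fst (\<omega> l)) = 0")
      case True
      then have "(\<Prod>l<n. P (seq l) (fst (\<omega> l)) / p (seq l)) = 0" by (auto intro!: prod_zero)
      then show ?thesis
        unfolding block_def L_def[symmetric] n_def[symmetric] emeasure_cylinder[OF P \<omega>c Ln]
        by (simp only: mult_zero_left ennreal_0 zero_le)
    next
      case False
      have pos: "0 < P (seq l) (fst (\<omega> l))" if "l < n" for l
        using False that row_weights_nonneg[OF P codesD(2)[OF \<omega>c, of l]] by force
      have lnh: "(\<Sum>l<n. ln (b (seq l) (fst (\<omega> l)))) = ln (row_height \<omega> n)"
        unfolding interval_len_def
        using ratio_bounds(7)[OF \<omega>c] by (subst ln_prod) (auto simp: rb_def[symmetric] less_imp_neq[OF ratio_bounds(7)[OF \<omega>c], symmetric])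
      have E: "(\<Sum>l<n. g (seq l) (fst (\<omega> l))) \<le> \<epsilon> * n" "(\<Sum>l<L. h (seq l) (fst (\<omega> l))) \<le> \<epsilon> * L"
        using \<omega> Ln kL by (auto simp: G_def E_def)
      have ld: "ln \<delta> \<le> ln bmax" using \<delta>1 \<delta>(1) by simp
      then have "1 \<le> ln \<delta> / ln bmax" using lb by (simp add: neg_le_divide_eq)
      then have n: "real n \<le> 2 * (ln \<delta> / ln bmax)"
        using row_index_facts(4)[OF \<omega>c \<delta>(1)] \<delta>1 unfolding n_def by simp
      have "(\<Sum>l<n. ln (P (seq l) (fst (\<omega> l)) / p (seq l))) + t_of P * ln (width \<omega> L)
        - (\<Sum>l<L. ln (row_sum (t_of P) (seq l) (fst (\<omega> l)))) =
         (\<Sum>l<n. g (seq l) (fst (\<omega> l))) + lam * ln (row_height \<omega> n) + t * ln (width \<omega> L) + (\<Sum>l<L. h (seq l) (fst (\<omega> l)))"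
        by (simp add: g_def h_def sum_subtractf sum_negf t_def flip: lnh sum_distrib_left)
      also have "\<dots> \<le> \<epsilon> * n + lam * ln \<delta> + t * ln \<delta> + \<epsilon> * n"
      proof (intro add_mono E(1) mult_left_mono lam t)
        show "ln (row_height \<omega> n) \<le> ln \<delta>"
          using row_index_facts(1)[OF \<omega>c \<delta>(1)] height_pos[OF \<omega>c] \<delta>(1) by (simp add: n_def)
        show "ln (width \<omega> L) \<le> ln \<delta>"
          using column_index_facts(1)[OF \<omega>c \<delta>(1)] width_pos[OF \<omega>c] \<delta>(1) by (simp add: L_def)
        show "(\<Sum>l<L. h (seq l) (fst (\<omega> l))) \<le> \<epsilon> * n"
          using E(2) Ln \<epsilon> by (smt (verit) mult_left_mono of_nat_le_iff)
      qed
      also have "\<dots> = (lam + t) * ln \<delta> + 2 * \<epsilon> * n" by (simp add: algebra_simps)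
      \<comment> \<open>Two errors of size \<epsilon> n and n at most twice the quotient of
        logarithms: hence the 4 in the definition of \<epsilon>, which makes the total error use up
        exactly the gap \<open>lam + t - s\<close>.\<close>
      also have "\<dots> \<le> (lam + t) * ln \<delta> + 2 * \<epsilon> * (2 * (ln \<delta> / ln bmax))"
        using n \<epsilon> by (intro add_left_mono mult_left_mono) auto
      also have "2 * \<epsilon> * (2 * (ln \<delta> / ln bmax)) = - (lam + t - s) * ln \<delta>"
        using lb by (simp add: \<epsilon>_def) (simp add: algebra_simps)
      also have "(lam + t) * ln \<delta> + - (lam + t - s) * ln \<delta> = s * ln \<delta>" by (simp add: algebra_simps)
      finally have "ennreal (exp ((\<Sum>l<n. ln (P (seq l) (fst (\<omega> l)) / p (seq l))) + t_of P * ln (width \<omega> L)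
        - (\<Sum>l<L. ln (row_sum (t_of P) (seq l) (fst (\<omega> l)))))) \<le> ennreal (exp (s * ln \<delta>))"
        by (intro ennreal_leI) simp
      then show ?thesis
        using emeasure_cylinder_exp[OF P \<omega>c Ln pos] \<delta>(1) unfolding block_def L_def[symmetric] n_def[symmetric]
        by (simp add: powr_def)
    qed
  qed
  show "hausdorff_measure s F \<noteq> 0"
  proof (rule mass_distribution_principle[where G = "G k" and \<mu> = "code_measure P" and \<phi> = coding and \<rho> = \<delta>0 and K = K])
    show "emeasure (code_measure P) (G k) < \<infinity>" by (simp add: emeasure_eq_measure)
    show "coding ` G k \<subseteq> F" by (auto simp: G_def)
    show "0 < \<delta>0" using bmax_pos amin_pos by (simp add: \<delta>0_def)
    show "0 < K" unfolding K_def by (rule add_nonneg_pos[OF of_nat_0_le_iff zero_less_one])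
    fix \<delta> :: real and U :: "(real \<times> real) set" assume \<delta>: "0 < \<delta>" "\<delta> \<le> \<delta>0" and U: "bounded U" "diameter U \<le> \<delta>"
    define T where "T = {\<omega>\<in>G k. coding \<omega> \<in> U}"
    have Tc: "T \<subseteq> codes" by (auto simp: T_def G_def)
    have "\<delta> \<le> 1" using \<delta> bmax_less_1 by (simp add: \<delta>0_def)
    then have card: "finite (block \<delta> ` T)" "card (block \<delta> ` T) \<le> nat \<lfloor>16 / amin\<^sup>2\<rfloor>"
      using card_blocks_le[OF Tc \<delta>(1) _ U] by (auto simp: T_def)
    have bsets: "block \<delta> \<omega> \<in> sets (code_measure P)" if "\<omega> \<in> codes" for \<omega>
      unfolding block_def by (rule cylinder_sets[OF P that columns_le_rows_stopping[OF that \<delta>(1)]])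
    have "emeasure (code_measure P) (\<Union>\<beta>\<in>block \<delta> ` T. \<beta>) \<le> (\<Sum>\<beta>\<in>block \<delta> ` T. emeasure (code_measure P) \<beta>)"
      using card(1) bsets Tc by (intro emeasure_subadditive_finite) auto
    also have "\<dots> \<le> (\<Sum>\<beta>\<in>block \<delta> ` T. ennreal (\<delta> powr s))"
      using small[OF \<delta>] by (intro sum_mono) (auto simp: T_def)
    also have "\<dots> = ennreal (real (card (block \<delta> ` T)) * \<delta> powr s)"
      by (simp add: ennreal_mult ennreal_of_nat_eq_real_of_nat)
    also have "\<dots> \<le> ennreal (K * \<delta> powr s)"
    proof (intro ennreal_leI mult_right_mono)
      show "real (card (block \<delta> ` T)) \<le> K"
        using of_nat_mono[OF card(2), where 'a = real] unfolding K_def by linarith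
    qed simp
    finally have "emeasure (code_measure P) (\<Union>\<beta>\<in>block \<delta> ` T. \<beta>) \<le> ennreal (K * \<delta> powr s)" .
    moreover have "{\<omega>\<in>G k. coding \<omega> \<in> U} \<subseteq> (\<Union>\<beta>\<in>block \<delta> ` T. \<beta>)"
      using Tc cylinder_self by (fastforce simp: T_def block_def G_def)
    moreover have "(\<Union>\<beta>\<in>block \<delta> ` T. \<beta>) \<in> sets (code_measure P)"
      using card(1) bsets Tc by (intro sets.finite_UN) auto
    ultimately show "\<exists>V\<in>sets (code_measure P). {\<omega>\<in>G k. coding \<omega> \<in> U} \<subseteq> V \<and> emeasure (code_measure P) V \<le> ennreal (K * \<delta> powr s)"
      by blast
  qed (use k s Gsets in auto)
qed

end

section \<open>Upper bound\<close>

context carpet_sequence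
begin

text \<open>Extensional on \<open>rows\<close>, so that the tables with entries at most n' form a
  finite function set of size \<open>(n' + 1) ^ card rows\<close>.\<close>

definition row_count :: "nat \<Rightarrow> (nat \<Rightarrow> nat \<times> nat) \<Rightarrow> nat \<times> nat \<Rightarrow> nat" where
  "row_count n \<omega> = (\<lambda>x\<in>rows. card {l. l < n \<and> seq l = fst x \<and> fst (\<omega> l) = snd x})"

text \<open>Each letter is normalised separately, so its rows add up to exactly \<open>p i\<close>
  although the letter frequency is only close to it. A letter that does not occur gives 0 by
  division by zero; \<open>regular\<close> with \<eta> < 1 excludes this. Words with the same table
  share one measure.\<close>

definition type_vector :: "(nat \<times> nat \<Rightarrow> nat) \<Rightarrow> nat \<Rightarrow> nat \<Rightarrow> real" where
  "type_vector \<kappa> i j = p i * real (\<kappa> (i, j)) / real (\<Sum>j'=1..M i. \<kappa> (i, j'))"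

abbreviation empirical :: "nat \<Rightarrow> (nat \<Rightarrow> nat \<times> nat) \<Rightarrow> nat \<Rightarrow> nat \<Rightarrow> real" where
  "empirical n \<omega> \<equiv> type_vector (row_count n \<omega>)"

lemma row_count_le: "x \<in> rows \<Longrightarrow> row_count n \<omega> x \<le> n"
proof -
  assume "x \<in> rows"
  moreover have "card {l. l < n \<and> seq l = fst x \<and> fst (\<omega> l) = snd x} \<le> card {..<n}"
    by (intro card_mono) auto
  ultimately show ?thesis by (simp add: row_count_def)
qed

lemma row_count_types: "n \<le> n' \<Longrightarrow> row_count n \<omega> \<in> (\<Pi>\<^sub>E x\<in>rows. {..n'})"
  using row_count_le[of _ n \<omega>] by (fastforce simp: row_count_def)

lemma sum_codes_eq:
  assumes "\<omega> \<in> codes"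
  shows "(\<Sum>l<n. f (seq l) (fst (\<omega> l))) = (\<Sum>(i, j)\<in>rows. real (row_count n \<omega> (i, j)) * f i j)"
proof -
  have "(\<Sum>l<n. f (seq l) (fst (\<omega> l))) =
      (\<Sum>x\<in>rows. \<Sum>l\<in>{l\<in>{..<n}. (seq l, fst (\<omega> l)) = x}. f (seq l) (fst (\<omega> l)))"
    using codesD(2)[OF assms] finite_rows by (intro sum.group[symmetric]) auto
  also have "\<dots> = (\<Sum>(i, j)\<in>rows. real (row_count n \<omega> (i, j)) * f i j)"
  proof (intro sum.cong refl, clarify)
    fix i j assume ij: "(i, j) \<in> rows"
    have "(\<Sum>l\<in>{l\<in>{..<n}. (seq l, fst (\<omega> l)) = (i, j)}. f (seq l) (fst (\<omega> l))) =
        (\<Sum>l\<in>{l\<in>{..<n}. (seq l, fst (\<omega> l)) = (i, j)}. f i j)"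
      by (intro sum.cong) auto
    also have "{l\<in>{..<n}. (seq l, fst (\<omega> l)) = (i, j)} = {l. l < n \<and> seq l = i \<and> fst (\<omega> l) = j}" by auto
    finally show "(\<Sum>l\<in>{l\<in>{..<n}. (seq l, fst (\<omega> l)) = (i, j)}. f (seq l) (fst (\<omega> l))) =
        real (row_count n \<omega> (i, j)) * f i j"
      using ij by (simp add: row_count_def)
  qed
  finally show ?thesis .
qed

lemma sum_row_count:
  assumes "\<omega> \<in> codes" "i \<in> {1..m}"
  shows "(\<Sum>j=1..M i. row_count n \<omega> (i, j)) = letter_count i n"
proof -
  have "letter_count i n = card (\<Union>j\<in>{1..M i}. {l. l < n \<and> seq l = i \<and> fst (\<omega> l) = j})"
    unfolding letter_count_def using codesD(3)[OF assms(1)] by (intro arg_cong[where f = card]) fastforce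
  also have "\<dots> = (\<Sum>j=1..M i. card {l. l < n \<and> seq l = i \<and> fst (\<omega> l) = j})"
    by (intro card_UN_disjoint) auto
  also have "\<dots> = (\<Sum>j=1..M i. row_count n \<omega> (i, j))"
    using assms(2) by (intro sum.cong) (auto simp: row_count_def rows_def)
  finally show ?thesis by simp
qed

text \<open>A relative error, so that row counts and n times the empirical weights differ by factors
  1 - \<eta> and 1 + \<eta> even for rare rows.\<close>

definition regular :: "real \<Rightarrow> nat \<Rightarrow> bool" where
  "regular \<eta> n \<longleftrightarrow> 0 < n \<and> (\<forall>i\<in>{1..m}. (1 - \<eta>) * (p i * n) \<le> real (letter_count i n) \<and>
      real (letter_count i n) \<le> (1 + \<eta>) * (p i * n))"

lemma eventually_regular:
  assumes "typical" "0 < \<eta>"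
  shows "eventually (regular \<eta>) sequentially"
proof -
  have "eventually (\<lambda>n. (1 - \<eta>) * (p i * n) \<le> real (letter_count i n) \<and>
      real (letter_count i n) \<le> (1 + \<eta>) * (p i * n)) sequentially" if i: "i \<in> {1..m}" for i
  proof -
    have lim: "(\<lambda>n. real (letter_count i n) / n) \<longlonglongrightarrow> p i"
      using assms(1) i by (simp add: typical_def)
    have "(1 - \<eta>) * p i < p i" "p i < (1 + \<eta>) * p i"
      using p_pos[OF i] assms(2) by (simp_all add: algebra_simps)
    from order_tendstoD(1)[OF lim this(1)] order_tendstoD(2)[OF lim this(2)] eventually_gt_at_top[of 0]
    show ?thesis
      by eventually_elim (simp add: field_simps)
  qed
  then have "eventually (\<lambda>n. \<forall>i\<in>{1..m}. (1 - \<eta>) * (p i * n) \<le> real (letter_count i n) \<and>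
      real (letter_count i n) \<le> (1 + \<eta>) * (p i * n)) sequentially"
    by (subst eventually_ball_finite_distrib) auto
  with eventually_gt_at_top[of 0] show ?thesis
    unfolding regular_def by (rule eventually_conj)
qed

context
  fixes \<eta> :: real and n :: nat and \<omega> :: "nat \<Rightarrow> nat \<times> nat"
  assumes \<eta>: "0 < \<eta>" "\<eta> < 1" and reg: "regular \<eta> n" and \<omega>: "\<omega> \<in> codes"
begin

lemma letter_count_pos: "i \<in> {1..m} \<Longrightarrow> 0 < letter_count i n"
  using reg p_pos[of i] \<eta> unfolding regular_def
  by (metis diff_gt_0_iff_gt less_le_trans mult_pos_pos of_nat_0_less_iff)

lemma empirical_eq:
  "i \<in> {1..m} \<Longrightarrow> empirical n \<omega> i j = p i * real (row_count n \<omega> (i, j)) / real (letter_count i n)"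
  by (simp only: type_vector_def sum_row_count[OF \<omega>])

lemma empirical_row_weights: "empirical n \<omega> \<in> row_weights"
  unfolding row_weights_def
proof (intro CollectI ballI conjI)
  fix i assume i: "i \<in> {1..m}"
  show "0 \<le> empirical n \<omega> i j" for j
    unfolding empirical_eq[OF i] using p_pos[OF i] by simp
  have "(\<Sum>j=1..M i. empirical n \<omega> i j) = p i / real (letter_count i n) * real (\<Sum>j=1..M i. row_count n \<omega> (i, j))"
    by (simp add: empirical_eq[OF i] sum_distrib_left)
  also have "\<dots> = p i"
    unfolding sum_row_count[OF \<omega> i] using letter_count_pos[OF i] by simp
  finally show "(\<Sum>j=1..M i. empirical n \<omega> i j) = p i" .
qed

lemma row_count_bounds:
  assumes "(i, j) \<in> rows"
  shows "(1 - \<eta>) * (n * empirical n \<omega> i j) \<le> real (row_count n \<omega> (i, j))"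
    "real (row_count n \<omega> (i, j)) \<le> (1 + \<eta>) * (n * empirical n \<omega> i j)"
proof -
  have i: "i \<in> {1..m}" using rowsD[OF assms] by simp
  define f k where "f = real (letter_count i n)" and "k = real (row_count n \<omega> (i, j))"
  have f: "0 < f" and k: "0 \<le> k" using letter_count_pos[OF i] by (auto simp: f_def k_def)
  have b: "(1 - \<eta>) * (p i * n) \<le> f" "f \<le> (1 + \<eta>) * (p i * n)"
    using reg i by (auto simp: regular_def f_def)
  have e: "empirical n \<omega> i j = p i * k / f" by (simp add: empirical_eq[OF i] f_def k_def)
  have "(1 - \<eta>) * (p i * n) * k \<le> f * k" "f * k \<le> (1 + \<eta>) * (p i * n) * k"
    using b k by (auto intro: mult_right_mono)
  then show "(1 - \<eta>) * (n * empirical n \<omega> i j) \<le> real (row_count n \<omega> (i, j))"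
    "real (row_count n \<omega> (i, j)) \<le> (1 + \<eta>) * (n * empirical n \<omega> i j)"
    unfolding e k_def[symmetric] using f by (simp_all add: field_simps)
qed

lemma empirical_pos:
  assumes "l < n" shows "0 < empirical n \<omega> (seq l) (fst (\<omega> l))"
proof -
  have "l \<in> {l'. l' < n \<and> seq l' = seq l \<and> fst (\<omega> l') = fst (\<omega> l)}" using assms by simp
  then have "0 < row_count n \<omega> (seq l, fst (\<omega> l))"
    using codesD(2)[OF \<omega>, of l] by (subst row_count_def) (auto simp: card_gt_0_iff)
  then show ?thesis
    unfolding empirical_eq[OF seq] using letter_count_pos[OF seq] p_pos[OF seq] by simp
qed

text \<open>With exact frequencies both sides would be n times \<open>base_entropy\<close>, which is
  \<open>base_dim\<close> times \<open>base_lyapunov\<close>. All logarithms involved are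
  nonpositive, so passing from counts to weights costs the factor 1 + \<eta> in the entropy and 1 /
  (1 - \<eta>) in the height.\<close>

lemma entropy_sum_ge:
  "(1 + \<eta>) / (1 - \<eta>) * base_dim (empirical n \<omega>) * ln (row_height \<omega> n)
    \<le> (\<Sum>l<n. ln (empirical n \<omega> (seq l) (fst (\<omega> l)) / p (seq l)))"
proof -
  define P where "P = empirical n \<omega>"
  have P: "P \<in> row_weights" unfolding P_def by (rule empirical_row_weights)
  have lnh: "ln (row_height \<omega> n) = (\<Sum>l<n. ln (b (seq l) (fst (\<omega> l))))"
    unfolding interval_len_def
    by (subst ln_prod) (auto simp: rb_def[symmetric] less_imp_neq[OF ratio_bounds(7)[OF \<omega>], symmetric])
  have "ln (row_height \<omega> n) / (1 - \<eta>) = (\<Sum>(i, j)\<in>rows. real (row_count n \<omega> (i, j)) * ln (b i j) / (1 - \<eta>))"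
    unfolding lnh sum_codes_eq[OF \<omega>, where f = "\<lambda>i j. ln (b i j)"]
    by (simp add: sum_divide_distrib case_prod_unfold)
  also have "\<dots> \<le> (\<Sum>(i, j)\<in>rows. n * (P i j * ln (b i j)))"
  proof (intro sum_mono, clarify)
    fix i j assume ij: "(i, j) \<in> rows"
    have "n * P i j \<le> real (row_count n \<omega> (i, j)) / (1 - \<eta>)"
      using row_count_bounds(1)[OF ij] \<eta> by (simp add: P_def field_simps)
    then have "real (row_count n \<omega> (i, j)) / (1 - \<eta>) * ln (b i j) \<le> (n * P i j) * ln (b i j)"
      using b_less_1[OF ij] b_pos[OF ij] by (intro mult_right_mono_neg) auto
    then show "real (row_count n \<omega> (i, j)) * ln (b i j) / (1 - \<eta>) \<le> n * (P i j * ln (b i j))" by (simp add: mult.assoc)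
  qed
  also have "\<dots> = n * base_lyapunov P"
    by (simp add: base_lyapunov_def sum_distrib_left case_prod_unfold)
  finally have 1: "ln (row_height \<omega> n) / (1 - \<eta>) \<le> n * base_lyapunov P" .
  have "(1 + \<eta>) / (1 - \<eta>) * base_dim P * ln (row_height \<omega> n) = ((1 + \<eta>) * base_dim P) * (ln (row_height \<omega> n) / (1 - \<eta>))"
    by simp
  also have "\<dots> \<le> ((1 + \<eta>) * base_dim P) * (n * base_lyapunov P)"
    using 1 base_dim_nonneg[OF P] \<eta> by (intro mult_left_mono) auto
  also have "\<dots> = (1 + \<eta>) * n * base_entropy P"
    using base_lyapunov_neg[OF P] by (simp add: base_dim_def)
  also have "\<dots> = (\<Sum>(i, j)\<in>rows. (1 + \<eta>) * (n * P i j) * ln (P i j / p i))"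
    by (simp add: base_entropy_def sum_distrib_left case_prod_unfold mult.assoc)
  also have "\<dots> \<le> (\<Sum>(i, j)\<in>rows. real (row_count n \<omega> (i, j)) * ln (P i j / p i))"
  proof (intro sum_mono, clarify)
    fix i j assume ij: "(i, j) \<in> rows"
    have i: "0 < p i" using p_pos rowsD[OF ij] by blast
    show "(1 + \<eta>) * (n * P i j) * ln (P i j / p i) \<le> real (row_count n \<omega> (i, j)) * ln (P i j / p i)"
    proof (cases "P i j = 0")
      case False
      then have "ln (P i j / p i) \<le> 0"
        using row_weights_le[OF P ij] row_weights_nonneg[OF P ij] i by (simp add: ln_le_zero_iff)
      then show ?thesis
        using row_count_bounds(2)[OF ij] by (intro mult_right_mono_neg) (auto simp: P_def)
    qed simp
  qed
  also have "\<dots> = (\<Sum>l<n. ln (P (seq l) (fst (\<omega> l)) / p (seq l)))"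
    by (rule sum_codes_eq[OF \<omega>, symmetric])
  finally show ?thesis by (simp add: P_def)
qed

text \<open>At the exponent of the word's own frequencies the weighted sum is zero by definition.
  The two error terms pay for an exponent lower by at most \<delta> and for replacing counts by
  weights. It is applied to the short word of L letters with the exponent of the long one.\<close>

lemma ln_row_sum_average_le:
  assumes C: "\<And>i j t. (i, j) \<in> rows \<Longrightarrow> t \<in> {0..1} \<Longrightarrow> \<bar>ln (row_sum t i j)\<bar> \<le> C"
    and t: "t \<in> {0..1}" "0 \<le> \<delta>" "t_of (empirical n \<omega>) - \<delta> \<le> t"
  shows "(\<Sum>l<n. ln (row_sum t (seq l) (fst (\<omega> l)))) \<le> n * (\<delta> * (- ln amin) + \<eta> * C)"
proof -
  define P where "P = empirical n \<omega>"
  have P: "P \<in> row_weights" unfolding P_def by (rule empirical_row_weights)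
  have "(\<Sum>l<n. ln (row_sum t (seq l) (fst (\<omega> l)))) = (\<Sum>(i, j)\<in>rows. real (row_count n \<omega> (i, j)) * ln (row_sum t i j))"
    by (rule sum_codes_eq[OF \<omega>])
  also have "\<dots> \<le> (\<Sum>(i, j)\<in>rows. n * (P i j * ln (row_sum (t_of P) i j) + P i j * (\<delta> * (- ln amin) + \<eta> * C)))"
  proof (intro sum_mono, clarify)
    fix i j assume ij: "(i, j) \<in> rows"
    define x where "x = ln (row_sum t i j)"
    define k where "k = real (row_count n \<omega> (i, j))"
    have P0: "0 \<le> n * P i j" using row_weights_nonneg[OF P ij] by simp
    have "\<bar>k - n * P i j\<bar> \<le> \<eta> * (n * P i j)"
      using row_count_bounds[OF ij] by (simp add: P_def k_def abs_le_iff algebra_simps)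
    moreover have "\<bar>x\<bar> \<le> C" unfolding x_def by (rule C[OF ij t(1)])
    ultimately have "\<bar>k - n * P i j\<bar> * \<bar>x\<bar> \<le> (\<eta> * (n * P i j)) * C"
      by (intro mult_mono) auto
    then have "(k - n * P i j) * x \<le> (\<eta> * (n * P i j)) * C"
      by (metis abs_le_D1 abs_mult)
    then have "k * x \<le> n * P i j * x + n * P i j * (\<eta> * C)" by (simp add: algebra_simps)
    moreover have "n * P i j * x \<le> n * P i j * (ln (row_sum (t_of P) i j) + \<delta> * (- ln amin))"
      unfolding x_def using t P0 by (intro mult_left_mono ln_row_sum_le ij) (auto simp: P_def)
    ultimately show "real (row_count n \<omega> (i, j)) * ln (row_sum t i j) \<le>
        n * (P i j * ln (row_sum (t_of P) i j) + P i j * (\<delta> * (- ln amin) + \<eta> * C))"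
      unfolding x_def[symmetric] k_def[symmetric] by (simp add: algebra_simps)
  qed
  also have "\<dots> = n * ((\<Sum>(i, j)\<in>rows. P i j * ln (row_sum (t_of P) i j)) + (\<Sum>(i, j)\<in>rows. P i j) * (\<delta> * (- ln amin) + \<eta> * C))"
    by (simp add: case_prod_unfold sum_distrib_left sum_distrib_right sum.distrib distrib_left)
  also have "\<dots> = n * (\<delta> * (- ln amin) + \<eta> * C)"
    using t_of(2)[OF P] row_weights_sum[OF P] by simp
  finally show ?thesis .
qed

end

section \<open>Lengths at which the exponent does not drop, and the mass of their squares\<close>

definition next_index :: "(nat \<Rightarrow> nat \<times> nat) \<Rightarrow> nat \<Rightarrow> nat" where
  "next_index \<omega> L = scale_index (rb \<omega>) (width \<omega> L)"

lemma next_index_ge: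
  assumes "\<omega> \<in> codes" shows "L \<le> next_index \<omega> L"
proof (rule ccontr)
  assume "\<not> ?thesis"
  have "strict_mono (\<lambda>n. - width \<omega> n)"
  proof (rule strict_monoI_Suc)
    fix n
    have "width \<omega> n * ra \<omega> n < width \<omega> n * 1"
      using width_pos[OF assms] ratio_bounds(4)[OF assms, of n] bmax_less_1 by (intro mult_strict_left_mono) auto
    then show "- width \<omega> n < - width \<omega> (Suc n)" by (simp add: interval_len_Suc)
  qed
  with \<open>\<not> ?thesis\<close> have "width \<omega> L < width \<omega> (next_index \<omega> L)"
    by (auto simp: strict_mono_def)
  also have "\<dots> \<le> row_height \<omega> (next_index \<omega> L)" by (rule width_le_height[OF assms])
  also have "\<dots> \<le> width \<omega> L"
    unfolding next_index_def by (rule row_index_facts(1)[OF assms width_pos[OF assms]])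
  finally show False by simp
qed

text \<open>C row steps shrink the height at least as much as one column step can shrink the
  width.\<close>

lemma next_index_le:
  assumes "\<omega> \<in> codes" "bmax ^ C \<le> amin" shows "next_index \<omega> L \<le> C * L"
  unfolding next_index_def
proof (rule row_index_facts(5)[OF assms(1) width_pos[OF assms(1)]])
  have "bmax ^ (C * L) = (bmax ^ C) ^ L" by (rule power_mult)
  also have "\<dots> \<le> amin ^ L" using assms(2) bmax_pos by (intro power_mono) auto
  also have "\<dots> \<le> width \<omega> L" by (rule width_bounds(1)[OF assms(1)])
  finally show "bmax ^ (C * L) \<le> width \<omega> L" .
qed

lemma next_index_cong:
  assumes "\<omega>' \<in> cylinder L (next_index \<omega> L) \<omega>" "\<omega> \<in> codes"
  shows "next_index \<omega>' L = next_index \<omega> L"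
proof -
  have "scale_index (rb \<omega>') (width \<omega> L) = next_index \<omega> L"
    unfolding next_index_def
    by (rule row_index_facts(6)[OF assms(2) width_pos[OF assms(2)]])
      (use cylinder_agree(3)[OF assms(1)] in \<open>simp add: next_index_def\<close>)
  then show ?thesis by (simp add: next_index_def cylinder_rectangle(2)[OF assms(1)])
qed

definition good :: "real \<Rightarrow> nat \<Rightarrow> (nat \<Rightarrow> nat \<times> nat) \<Rightarrow> bool" where
  "good \<delta> L \<omega> \<longleftrightarrow> \<omega> \<in> codes \<and> t_of (empirical L \<omega>) - \<delta> \<le> t_of (empirical (next_index \<omega> L) \<omega>)"

text \<open>Each iteration of \<open>next_index\<close> multiplies the length by at most C, and at
  most J iterations are tried. The window for L depends on L0 but not on the code.\<close>

lemma exists_good_index: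
  assumes \<eta>: "0 < \<eta>" "\<eta> < 1" and reg: "\<And>n. n0 \<le> n \<Longrightarrow> regular \<eta> n" and \<omega>: "\<omega> \<in> codes"
    and C: "bmax ^ C \<le> amin" and \<delta>: "0 < \<delta>" and J: "1 < real J * \<delta>" and "n0 \<le> L0"
  shows "\<exists>L. L0 \<le> L \<and> L \<le> C ^ J * L0 \<and> good \<delta> L \<omega>"
proof (rule ccontr)
  assume none: "\<not> ?thesis"
  have C1: "1 \<le> C"
  proof (rule ccontr)
    assume "\<not> 1 \<le> C"
    then have "C = 0" by simp
    with C amin_less_1 show False by simp
  qed
  define \<Lambda> where "\<Lambda> k = (next_index \<omega> ^^ k) L0" for k
  have \<Lambda>_Suc: "\<Lambda> (Suc k) = next_index \<omega> (\<Lambda> k)" for k by (simp add: \<Lambda>_def)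
  have ge: "L0 \<le> \<Lambda> k" for k
  proof (induction k)
    case (Suc k)
    then show ?case using next_index_ge[OF \<omega>, of "\<Lambda> k"] unfolding \<Lambda>_Suc by simp
  qed (simp add: \<Lambda>_def)
  have le: "\<Lambda> k \<le> C ^ k * L0" for k
  proof (induction k)
    case (Suc k)
    have "\<Lambda> (Suc k) \<le> C * \<Lambda> k" unfolding \<Lambda>_Suc by (rule next_index_le[OF \<omega> C])
    also have "\<dots> \<le> C * (C ^ k * L0)" by (intro mult_left_mono Suc) auto
    finally show ?case by simp
  qed (simp add: \<Lambda>_def)
  have T: "t_of (empirical (\<Lambda> k) \<omega>) \<in> {0..1}" for k
    using ge[of k] \<open>n0 \<le> L0\<close> by (intro t_of(1) empirical_row_weights[OF \<eta> reg \<omega>]) simp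
  have "k \<le> J \<Longrightarrow> t_of (empirical (\<Lambda> k) \<omega>) \<le> 1 - real k * \<delta>" for k
  proof (induction k)
    case 0
    then show ?case using T[of 0] by simp
  next
    case (Suc k)
    have "\<Lambda> k \<le> C ^ J * L0"
      using le[of k] power_increasing[of k J C] C1 Suc.prems by (meson Suc_leD le_trans mult_le_mono1)
    with none ge[of k] \<omega> have "t_of (empirical (\<Lambda> (Suc k)) \<omega>) < t_of (empirical (\<Lambda> k) \<omega>) - \<delta>"
      unfolding good_def \<Lambda>_Suc by force
    with Suc show ?case by (simp add: algebra_simps)
  qed
  from this[of J] T[of J] J show False by simp
qed

text \<open>The first factor on the right is \<open>amin\<close> to the power -3D. It pays for the
  height, which may be as small as \<open>amin\<close> times the width and enters with an exponent
  of at most 3D.\<close>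

lemma cylinder_mass_ge:
  assumes \<eta>: "0 < \<eta>" "\<eta> \<le> 1 / 2" and reg: "\<And>n. n0 \<le> n \<Longrightarrow> regular \<eta> n" and L: "n0 \<le> L" and good: "good \<delta> L \<omega>"
    and \<delta>: "0 \<le> \<delta>"
    and C: "\<And>i j t. (i, j) \<in> rows \<Longrightarrow> t \<in> {0..1} \<Longrightarrow> \<bar>ln (row_sum t i j)\<bar> \<le> C"
    and D: "\<And>Q. Q \<in> row_weights \<Longrightarrow> base_dim Q + t_of Q \<le> D"
    and e: "4 * \<eta> * D + (\<delta> * (- ln amin) + \<eta> * C) / (- ln bmax) \<le> e"
  defines "n \<equiv> next_index \<omega> L"
  shows "ennreal (width \<omega> L powr (D + e)) \<le>
    ennreal (exp (- 3 * D * ln amin)) * emeasure (code_measure (empirical n \<omega>)) (cylinder L n \<omega>)"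
proof -
  have \<omega>: "\<omega> \<in> codes" using good by (simp add: good_def)
  have Ln: "L \<le> n" unfolding n_def by (rule next_index_ge[OF \<omega>])
  have \<eta>1: "\<eta> < 1" using \<eta> by simp
  have regL: "regular \<eta> L" and regn: "regular \<eta> n" using reg L Ln by auto
  define P where "P = empirical n \<omega>"
  have P: "P \<in> row_weights" unfolding P_def by (rule empirical_row_weights[OF \<eta>(1) \<eta>1 regn \<omega>])
  define r where "r = width \<omega> L"
  define lam t where "lam = base_dim P" and "t = t_of P"
  have r: "0 < r" "r \<le> 1" using width_pos[OF \<omega>] width_le_1[OF \<omega>] by (auto simp: r_def)
  have lam: "0 \<le> lam" "lam + t \<le> D" and t: "t \<in> {0..1}"
    using base_dim_nonneg[OF P] D[OF P] t_of(1)[OF P] by (auto simp: lam_def t_def)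
  then have lamD: "lam \<le> D" and D0: "0 \<le> D" by auto
  have lnr: "ln r \<le> 0" using r by simp
  have lb: "ln bmax < 0" using bmax_pos bmax_less_1 by simp
  have la: "ln amin < 0" using amin_pos amin_less_1 by simp
  have C0: "0 \<le> C"
  proof -
    obtain i j where "(i, j) \<in> rows" using rows_nonempty by auto
    from C[OF this, of 0] show ?thesis by simp
  qed
  \<comment> \<open>The factor lost in \<open>entropy_sum_ge\<close>. For \<eta> at most 1/2 it is
    at most 3, and its excess over 1 is at most 4\<eta>; hence the constants in the hypothesis on e
    and in the conclusion.\<close>
  define \<theta> where "\<theta> = (1 + \<eta>) / (1 - \<eta>)"
  have \<theta>: "1 \<le> \<theta>" "\<theta> \<le> 1 + 4 * \<eta>" "\<theta> \<le> 3"
  proof -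
    show "1 \<le> \<theta>" "\<theta> \<le> 3" unfolding \<theta>_def using \<eta> by (auto simp: field_simps)
    have "0 \<le> 2 * \<eta> * (1 - 2 * \<eta>)" using \<eta> by (intro mult_nonneg_nonneg) auto
    then have "1 + \<eta> \<le> (1 + 4 * \<eta>) * (1 - \<eta>)" by (simp add: algebra_simps)
    then show "\<theta> \<le> 1 + 4 * \<eta>" unfolding \<theta>_def using \<eta>1 by (simp add: divide_le_eq)
  qed
  have h: "ln amin + ln r \<le> ln (row_height \<omega> n)"
  proof -
    have "amin * r \<le> row_height \<omega> n"
      unfolding n_def next_index_def r_def
      by (rule row_index_facts(3)[OF \<omega> width_pos[OF \<omega>] width_le_1[OF \<omega>]])
    then have "ln (amin * r) \<le> ln (row_height \<omega> n)" using amin_pos r by (intro ln_mono) auto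
    then show ?thesis using amin_pos r by (simp add: ln_mult)
  qed
  \<comment> \<open>Turns the error per letter in the row sums into an error in the exponent of
    r.\<close>
  have Lr: "real L \<le> ln r / ln bmax"
  proof -
    have "ln r \<le> ln (bmax ^ L)" using width_bounds(2)[OF \<omega>, of L] r bmax_pos by (intro ln_mono) (auto simp: r_def)
    then show ?thesis using bmax_pos lb by (simp add: ln_realpow neg_le_divide_eq)
  qed
  define z where "z = \<delta> * (- ln amin) + \<eta> * C"
  have z: "0 \<le> z" unfolding z_def using \<delta> la \<eta> C0 by (intro add_nonneg_nonneg mult_nonneg_nonneg) auto
  have S: "(\<Sum>l<L. ln (row_sum t (seq l) (fst (\<omega> l)))) \<le> L * z"
    unfolding z_def
  proof (rule ln_row_sum_average_le[OF \<eta>(1) \<eta>1 regL \<omega> C t \<delta>])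
    show "t_of (empirical L \<omega>) - \<delta> \<le> t" using good by (simp add: good_def t_def P_def n_def)
  qed
  also have "\<dots> \<le> ln r / ln bmax * z" using Lr z by (intro mult_right_mono) auto
  also have "\<dots> = - (z / (- ln bmax) * ln r)" using lb by simp
  finally have S': "(\<Sum>l<L. ln (row_sum t (seq l) (fst (\<omega> l)))) \<le> - (z / (- ln bmax) * ln r)" .
  have E: "\<theta> * lam * ln (row_height \<omega> n) \<le> (\<Sum>l<n. ln (P (seq l) (fst (\<omega> l)) / p (seq l)))"
    unfolding \<theta>_def lam_def P_def by (rule entropy_sum_ge[OF \<eta>(1) \<eta>1 regn \<omega>])
  have "(D + e) * ln r + 3 * D * ln amin \<le> (D + 4 * \<eta> * D + z / (- ln bmax)) * ln r + 3 * D * ln amin"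
    using e lnr unfolding z_def by (intro add_right_mono mult_right_mono_neg) auto
  also have "\<dots> = D * ln r + 4 * \<eta> * D * ln r + z / (- ln bmax) * ln r + 3 * D * ln amin"
    by (simp only: distrib_right)
  also have "\<dots> \<le> (lam + t) * ln r + (\<theta> - 1) * lam * ln r + z / (- ln bmax) * ln r + \<theta> * lam * ln amin"
  proof (intro add_mono order_refl mult_right_mono_neg lnr lam(2) less_imp_le[OF la])
    show "(\<theta> - 1) * lam \<le> 4 * \<eta> * D" using \<theta> lam lamD \<eta> by (intro mult_mono) auto
    show "\<theta> * lam \<le> 3 * D" using \<theta> lam lamD by (intro mult_mono) auto
  qed
  also have "\<dots> = \<theta> * lam * (ln amin + ln r) + t * ln r + z / (- ln bmax) * ln r"
    by (simp add: algebra_simps)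
  also have "\<dots> \<le> \<theta> * lam * ln (row_height \<omega> n) + t * ln r + z / (- ln bmax) * ln r"
    using h \<theta> lam by (intro add_right_mono mult_left_mono) auto
  also have "\<dots> \<le> (\<Sum>l<n. ln (P (seq l) (fst (\<omega> l)) / p (seq l))) + t * ln r - (\<Sum>l<L. ln (row_sum t (seq l) (fst (\<omega> l))))"
    using E S' by linarith
  finally have "(D + e) * ln r \<le> - 3 * D * ln amin + ((\<Sum>l<n. ln (P (seq l) (fst (\<omega> l)) / p (seq l))) + t * ln r - (\<Sum>l<L. ln (row_sum t (seq l) (fst (\<omega> l)))))"
    by simp
  then have "exp ((D + e) * ln r) \<le> exp (- 3 * D * ln amin) *
      exp ((\<Sum>l<n. ln (P (seq l) (fst (\<omega> l)) / p (seq l))) + t * ln r - (\<Sum>l<L. ln (row_sum t (seq l) (fst (\<omega> l)))))"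
    unfolding exp_add[symmetric] by simp
  then show ?thesis
    using emeasure_cylinder_exp[OF P \<omega> Ln] empirical_pos[OF \<eta>(1) \<eta>1 regn \<omega>] r
    unfolding P_def[symmetric] r_def[symmetric] t_def[symmetric]
    by (simp add: powr_def ennreal_mult[symmetric] ennreal_leI)
qed

end

text \<open>The polynomial factor will count the tables of row counts, the geometric one comes from
  the widths. Successive ratios tend to q < 1.\<close>

lemma summable_power_mult_geometric:
  fixes C R :: nat and q :: real
  assumes "0 < q" "q < 1"
  shows "summable (\<lambda>n. real (C * n + 1) ^ R * q ^ n)"
proof -
  obtain c where c: "q < c" "c < 1" using dense[OF assms(2)] by blast
  have "(\<lambda>n. (real (C * Suc n + 1) / real (C * n + 1)) ^ R * q) \<longlonglongrightarrow> 1 ^ R * q"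
  proof (intro tendsto_mult tendsto_power tendsto_const)
    have "(\<lambda>n. 1 + real C / (real C * real n + 1)) \<longlonglongrightarrow> 1"
    proof (cases "C = 0")
      case False
      then have "0 < real C" by simp
      then show ?thesis by real_asymp
    qed simp
    moreover have "real (C * Suc n + 1) / real (C * n + 1) = 1 + real C / (real C * real n + 1)" for n
    proof -
      have "0 < real C * real n + 1" by (intro add_nonneg_pos) auto
      then show ?thesis by (simp add: field_simps)
    qed
    ultimately show "(\<lambda>n. real (C * Suc n + 1) / real (C * n + 1)) \<longlonglongrightarrow> 1" by simp
  qed
  from order_tendstoD(2)[OF this, of c] c obtain n0
    where n0: "\<And>n. n0 \<le> n \<Longrightarrow> (real (C * Suc n + 1) / real (C * n + 1)) ^ R * q < c"
    by (auto simp: eventually_sequentially)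
  show ?thesis
  proof (rule summable_ratio_test[OF c(2)])
    fix n assume "n0 \<le> n"
    have pos: "0 < real (C * n + 1) ^ R * q ^ n" using assms by (intro mult_pos_pos zero_less_power) (simp_all add: add_pos_nonneg)
    have "real (C * Suc n + 1) ^ R * q ^ Suc n =
        ((real (C * Suc n + 1) / real (C * n + 1)) ^ R * q) * (real (C * n + 1) ^ R * q ^ n)"
    proof -
      have "real (C * n + 1) ^ R \<noteq> 0" using pos by (metis mult_zero_left less_irrefl)
      moreover have "y * (q * w) = (y / x * q) * (x * w)" if "x \<noteq> 0" for x y w :: real using that by simp
      ultimately show ?thesis unfolding power_divide power_Suc by blast
    qed
    also have "\<dots> \<le> c * (real (C * n + 1) ^ R * q ^ n)"
      using n0[OF \<open>n0 \<le> n\<close>] pos by (intro mult_right_mono) auto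
    finally show "norm (real (C * Suc n + 1) ^ R * q ^ Suc n) \<le> c * norm (real (C * n + 1) ^ R * q ^ n)"
      using assms by simp
  qed
qed

section \<open>The cover of the limit set and its total cost\<close>

context carpet_sequence
begin

lemma diameter_rectangle:
  assumes "\<omega> \<in> codes" "row_height \<omega> n \<le> width \<omega> L"
  shows "bounded (rectangle L n \<omega>)" "diameter (rectangle L n \<omega>) \<le> 2 * width \<omega> L"
proof -
  show "bounded (rectangle L n \<omega>)" unfolding rectangle_def by (intro bounded_Times) auto
  show "diameter (rectangle L n \<omega>) \<le> 2 * width \<omega> L"
  proof (rule diameter_le)
    show "rectangle L n \<omega> \<noteq> {} \<or> 0 \<le> 2 * width \<omega> L" using width_pos[OF assms(1), of L] by simp
    fix x y assume xy: "x \<in> rectangle L n \<omega>" "y \<in> rectangle L n \<omega>"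
    have "norm (x - y) \<le> norm (fst x - fst y) + norm (snd x - snd y)"
      using norm_Pair_le[of "fst x - fst y" "snd x - snd y"] by (simp add: minus_prod_def)
    also have "\<dots> \<le> 2 * width \<omega> L"
    proof -
      have "\<bar>fst x - fst y\<bar> \<le> width \<omega> L" "\<bar>snd x - snd y\<bar> \<le> row_height \<omega> n"
        using xy by (simp_all add: rectangle_def mem_Times_iff abs_le_iff)
      then show ?thesis using assms(2) by simp
    qed
    finally show "norm (x - y) \<le> 2 * width \<omega> L" .
  qed
qed

text \<open>The limit set is built from finite words, the cylinders from infinite codes; the letter
  (1, 1) is always available for the continuation.\<close>

lemma extend_code:
  assumes "w \<in> (\<Pi>\<^sub>E l\<in>{..<n}. row_col M N (seq l))"
  obtains \<omega> where "\<omega> \<in> codes" "affine_word a b c d seq w n = affine_word a b c d seq \<omega> n"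
proof
  define \<omega> where "\<omega> l = (if l < n then w l else (1, 1))" for l
  have "(1, 1) \<in> row_col M N (seq l)" for l
    using row_cell[OF seq[of l], of 1] M[OF seq[of l]] by simp
  then show "\<omega> \<in> codes" using assms by (auto simp: codes_def \<omega>_def)
  show "affine_word a b c d seq w n = affine_word a b c d seq \<omega> n"
    by (rule affine_word_cong) (simp add: \<omega>_def)
qed

lemma limit_set_covered:
  assumes \<eta>: "0 < \<eta>" "\<eta> < 1" and reg: "\<And>n. n0 \<le> n \<Longrightarrow> regular \<eta> n"
    and C: "bmax ^ C \<le> amin" and \<delta>: "0 < \<delta>" and J: "1 < real J * \<delta>" and L0: "n0 \<le> L0" and x: "x \<in> limset"
  shows "\<exists>\<omega> L. L0 \<le> L \<and> L \<le> C ^ J * L0 \<and> good \<delta> L \<omega> \<and> x \<in> rectangle L (next_index \<omega> L) \<omega>"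
proof -
  \<comment> \<open>The good length is found only after a code through x has been chosen. This n is
    fixed beforehand and exceeds every possible L and \<open>next_index\<close>, so a single finite
    word around x suffices.\<close>
  define n where "n = C * (C ^ J * L0) + C ^ J * L0 + 1"
  obtain w where w: "w \<in> (\<Pi>\<^sub>E l\<in>{..<n}. row_col M N (seq l))" "x \<in> affine_word a b c d seq w n ` unit_square"
  proof -
    have "n \<in> {1..}" by (simp add: n_def)
    with x have "x \<in> (\<Union>w\<in>(\<Pi>\<^sub>E l\<in>{..<n}. row_col M N (seq l)). affine_word a b c d seq w n ` unit_square)"
      unfolding limit_set_def by (rule INT_D)
    then show ?thesis using that by blast
  qed
  obtain \<omega> where \<omega>: "\<omega> \<in> codes" "affine_word a b c d seq w n = affine_word a b c d seq \<omega> n"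
    using extend_code[OF w(1)] by blast
  obtain L where L: "L0 \<le> L" "L \<le> C ^ J * L0" "good \<delta> L \<omega>"
    using exists_good_index[OF \<eta> reg \<omega>(1) C \<delta> J L0] by blast
  have "next_index \<omega> L \<le> C * L" by (rule next_index_le[OF \<omega>(1) C])
  also have "\<dots> \<le> C * (C ^ J * L0)" using L(2) by (rule mult_left_mono) simp
  finally have "next_index \<omega> L \<le> n" "L \<le> n" using L(2) by (simp_all add: n_def)
  with w(2) have "x \<in> rectangle L (next_index \<omega> L) \<omega>"
    unfolding \<omega>(2) affine_word_image[OF \<omega>(1)] using rectangle_mono[OF \<omega>(1), of L n "next_index \<omega> L"] by blast
  with L show ?thesis by blast
qed

definition good_blocks :: "real \<Rightarrow> nat \<Rightarrow> (nat \<Rightarrow> nat \<times> nat) set set" where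
  "good_blocks \<delta> L = (\<lambda>\<omega>. cylinder L (next_index \<omega> L) \<omega>) ` {\<omega>. good \<delta> L \<omega>}"

lemma finite_good_blocks:
  assumes C: "bmax ^ C \<le> amin"
  shows "finite (good_blocks \<delta> L)"
proof (rule finite_subset)
  show "good_blocks \<delta> L \<subseteq> (\<Union>n\<in>{..C * L}. cylinder L n ` (\<Pi>\<^sub>E l\<in>{..<n}. row_col M N (seq l)))"
  proof
    fix \<beta> assume "\<beta> \<in> good_blocks \<delta> L"
    then obtain \<omega> where \<omega>: "\<omega> \<in> codes" "\<beta> = cylinder L (next_index \<omega> L) \<omega>"
      by (auto simp: good_blocks_def good_def)
    define n where "n = next_index \<omega> L"
    have "L \<le> n" "n \<le> C * L" unfolding n_def using next_index_ge[OF \<omega>(1)] next_index_le[OF \<omega>(1) C] by auto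
    then have "cylinder L n \<omega> = cylinder L n (restrict \<omega> {..<n})" by (simp add: cylinder_def)
    moreover have "restrict \<omega> {..<n} \<in> (\<Pi>\<^sub>E l\<in>{..<n}. row_col M N (seq l))" using \<omega>(1) by (auto simp: codes_def)
    ultimately show "\<beta> \<in> (\<Union>n\<in>{..C * L}. cylinder L n ` (\<Pi>\<^sub>E l\<in>{..<n}. row_col M N (seq l)))"
      using \<omega>(2) \<open>n \<le> C * L\<close> unfolding n_def[symmetric] by blast
  qed
  show "finite (\<Union>n\<in>{..C * L}. cylinder L n ` (\<Pi>\<^sub>E l\<in>{..<n}. row_col M N (seq l)))"
    by (intro finite_UN_I finite_imageI finite_PiE finite_row_col) auto
qed

text \<open>\<open>next_index\<close> is constant on a block, so any code in the block determines
  the whole block once L is given.\<close>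

lemma disjoint_good_blocks:
  assumes "\<beta> \<in> good_blocks \<delta> L" "\<beta>' \<in> good_blocks \<delta> L" "\<omega> \<in> \<beta>" "\<omega> \<in> \<beta>'"
  shows "\<beta> = \<beta>'"
proof -
  have "\<beta> = cylinder L (next_index \<omega> L) \<omega>" if \<beta>: "\<beta> \<in> good_blocks \<delta> L" "\<omega> \<in> \<beta>" for \<beta>
  proof -
    obtain \<omega>' where \<omega>': "\<omega>' \<in> codes" "\<beta> = cylinder L (next_index \<omega>' L) \<omega>'"
      using \<beta>(1) unfolding good_blocks_def good_def by blast
    have mem: "\<omega> \<in> cylinder L (next_index \<omega>' L) \<omega>'" using \<beta>(2) \<omega>'(2) by simp
    show ?thesis unfolding \<omega>'(2) next_index_cong[OF mem \<omega>'(1)] cylinder_eq[OF mem] ..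
  qed
  with assms show ?thesis by blast
qed

text \<open>Blocks whose representatives have the same count table are measured by one probability
  measure and are disjoint, so each group contributes at most 1. The number of groups is at most the
  number of tables with entries up to \<open>C * L\<close>.\<close>

lemma sum_block_mass_le:
  assumes \<eta>: "0 < \<eta>" "\<eta> < 1" and reg: "\<And>n. n0 \<le> n \<Longrightarrow> regular \<eta> n" and L: "n0 \<le> L"
    and C: "bmax ^ C \<le> amin"
    and \<rho>: "\<And>\<beta>. \<beta> \<in> good_blocks \<delta> L \<Longrightarrow> good \<delta> L (\<rho> \<beta>)"
      "\<And>\<beta>. \<beta> \<in> good_blocks \<delta> L \<Longrightarrow> cylinder L (next_index (\<rho> \<beta>) L) (\<rho> \<beta>) = \<beta>"
  shows "(\<Sum>\<beta>\<in>good_blocks \<delta> L. emeasure (code_measure (empirical (next_index (\<rho> \<beta>) L) (\<rho> \<beta>))) \<beta>)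
      \<le> ennreal (real (C * L + 1) ^ card rows)"
proof -
  define type where "type \<beta> = row_count (next_index (\<rho> \<beta>) L) (\<rho> \<beta>)" for \<beta>
  define types where "types = (\<Pi>\<^sub>E x\<in>rows. {..C * L})"
  have \<rho>c: "\<rho> \<beta> \<in> codes" if "\<beta> \<in> good_blocks \<delta> L" for \<beta> using \<rho>(1)[OF that] by (simp add: good_def)
  have fin: "finite (good_blocks \<delta> L)" by (rule finite_good_blocks[OF C])
  have "(\<Sum>\<beta>\<in>good_blocks \<delta> L. emeasure (code_measure (type_vector (type \<beta>))) \<beta>) =
      (\<Sum>\<kappa>\<in>types. \<Sum>\<beta>\<in>{\<beta>\<in>good_blocks \<delta> L. type \<beta> = \<kappa>}. emeasure (code_measure (type_vector (type \<beta>))) \<beta>)"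
  proof (intro sum.group[symmetric] fin)
    show "finite types" unfolding types_def using finite_rows by (intro finite_PiE) auto
    show "type ` good_blocks \<delta> L \<subseteq> types"
      unfolding type_def types_def using row_count_types[OF next_index_le[OF \<rho>c C]] by blast
  qed
  also have "\<dots> \<le> (\<Sum>\<kappa>\<in>types. 1)"
  proof (intro sum_mono)
    fix \<kappa>
    define B where "B = {\<beta>\<in>good_blocks \<delta> L. type \<beta> = \<kappa>}"
    show "(\<Sum>\<beta>\<in>{\<beta>\<in>good_blocks \<delta> L. type \<beta> = \<kappa>}. emeasure (code_measure (type_vector (type \<beta>))) \<beta>) \<le> 1"
      unfolding B_def[symmetric]
    proof (cases "B = {}")
      case False
      then obtain \<beta> where \<beta>: "\<beta> \<in> good_blocks \<delta> L" "type \<beta> = \<kappa>" by (auto simp: B_def)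
      have "n0 \<le> next_index (\<rho> \<beta>) L" using next_index_ge[OF \<rho>c[OF \<beta>(1)], of L] L by simp
      then have P: "type_vector \<kappa> \<in> row_weights"
        using empirical_row_weights[OF \<eta> reg \<rho>c[OF \<beta>(1)]] \<beta>(2) unfolding type_def by auto
      interpret prob_space "code_measure (type_vector \<kappa>)" by (rule prob_space_code_measure[OF P])
      have sets: "\<beta> \<in> sets (code_measure (type_vector \<kappa>))" if "\<beta> \<in> B" for \<beta>
      proof -
        have \<beta>: "\<beta> \<in> good_blocks \<delta> L" using that by (simp add: B_def)
        have "cylinder L (next_index (\<rho> \<beta>) L) (\<rho> \<beta>) \<in> sets (code_measure (type_vector \<kappa>))"
          by (rule cylinder_sets[OF P \<rho>c[OF \<beta>] next_index_ge[OF \<rho>c[OF \<beta>]]])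
        then show ?thesis by (simp add: \<rho>(2)[OF \<beta>])
      qed
      have disj: "disjoint_family_on (\<lambda>\<beta>. \<beta>) B"
        unfolding disjoint_family_on_def B_def using disjoint_good_blocks by blast
      have "(\<Sum>\<beta>\<in>B. emeasure (code_measure (type_vector (type \<beta>))) \<beta>) = (\<Sum>\<beta>\<in>B. emeasure (code_measure (type_vector \<kappa>)) \<beta>)"
        by (intro sum.cong) (auto simp: B_def)
      also have "\<dots> = emeasure (code_measure (type_vector \<kappa>)) (\<Union>\<beta>\<in>B. \<beta>)"
        using fin sets disj by (intro sum_emeasure) (auto simp: B_def)
      also have "\<dots> \<le> 1" by (rule emeasure_le_1)
      finally show "(\<Sum>\<beta>\<in>B. emeasure (code_measure (type_vector (type \<beta>))) \<beta>) \<le> 1" .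
    qed simp
  qed
  also have "\<dots> = ennreal (real (C * L + 1) ^ card rows)"
    unfolding types_def using finite_rows
    by (simp add: card_PiE ennreal_of_nat_eq_real_of_nat ennreal_power)
  finally show ?thesis by (simp add: type_def)
qed

text \<open>The surplus s - D is split into two equal parts e. One absorbs the error in the mass of
  a square; the other leaves a factor \<open>bmax powr e\<close> to the power L, which beats the
  polynomial number of tables.\<close>

lemma limit_set_dim_le:
  assumes ty: "typical" and D: "\<And>Q. Q \<in> row_weights \<Longrightarrow> base_dim Q + t_of Q \<le> D" and D0: "0 \<le> D"
  shows "hausdorff_dim limset \<le> ennreal D"
proof (rule hausdorff_dim_leI[OF D0], rule hausdorff_measure_eq_0I)
  fix s \<delta>' e' :: real assume s: "D < s" and \<delta>': "0 < \<delta>'" and e': "0 < e'"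
  define e where "e = (s - D) / 2"
  have e: "0 < e" and s_eq: "s = (D + e) + e" using s by (auto simp: e_def)
  obtain C0 where C0: "0 < C0" "\<And>i j t. (i, j) \<in> rows \<Longrightarrow> t \<in> {0..1} \<Longrightarrow> \<bar>ln (row_sum t i j)\<bar> \<le> C0"
    using abs_ln_row_sum_bounded by blast
  have lb: "0 < - ln bmax" using bmax_pos bmax_less_1 by simp
  have la: "0 < - ln amin" using amin_pos amin_less_1 by simp
  \<comment> \<open>\<delta> makes the error from a drop of the exponent equal to e / 2, and \<eta>
    makes the errors from the letter frequencies at most e / 2.\<close>
  define \<delta> where "\<delta> = e * (- ln bmax) / (2 * (- ln amin))"
  define \<eta> where "\<eta> = min (1 / 2) (e / (2 * (4 * D + C0 / (- ln bmax))))"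
  have w: "0 < 4 * D + C0 / (- ln bmax)" using D0 C0 lb by (intro add_nonneg_pos divide_pos_pos) auto
  have \<delta>: "0 < \<delta>" unfolding \<delta>_def using e lb la by (intro divide_pos_pos mult_pos_pos) auto
  have \<eta>: "0 < \<eta>" "\<eta> \<le> 1 / 2"
    unfolding \<eta>_def using divide_pos_pos[OF e, of "2 * (4 * D + C0 / (- ln bmax))"] w
    by (simp_all only: min_less_iff_conj min.cobounded1) simp
  then have \<eta>1: "\<eta> < 1" by simp
  have small: "4 * \<eta> * D + (\<delta> * (- ln amin) + \<eta> * C0) / (- ln bmax) \<le> e"
  proof -
    have "\<delta> * (- ln amin) / (- ln bmax) = e / 2" unfolding \<delta>_def using la lb by (simp add: field_simps)
    moreover have "\<eta> * (4 * D + C0 / (- ln bmax)) \<le> e / 2"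
    proof -
      have "\<eta> \<le> e / (2 * (4 * D + C0 / (- ln bmax)))" by (simp add: \<eta>_def)
      then show ?thesis using w by (simp add: pos_le_divide_eq mult.commute mult.left_commute)
    qed
    moreover have "4 * \<eta> * D + (\<delta> * (- ln amin) + \<eta> * C0) / (- ln bmax) =
        \<delta> * (- ln amin) / (- ln bmax) + \<eta> * (4 * D + C0 / (- ln bmax))"
    proof -
      have "4 * \<eta> * D + (x + \<eta> * C0) / y = x / y + \<eta> * (4 * D + C0 / y)" for x y :: real
        by (simp add: add_divide_distrib distrib_left)
      then show ?thesis .
    qed
    ultimately show ?thesis by linarith
  qed
  obtain C where C: "bmax ^ C < amin" using real_arch_pow_inv[OF amin_pos bmax_less_1] by blast
  obtain J where J: "1 < real J * \<delta>" using reals_Archimedean3[OF \<delta>] by blast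
  obtain n0 where reg: "\<And>n. n0 \<le> n \<Longrightarrow> regular \<eta> n"
    using eventually_regular[OF ty \<eta>(1)] by (auto simp: eventually_sequentially)
  define q where "q = bmax powr e"
  have q: "0 < q" "q < 1"
    unfolding q_def using bmax_pos bmax_less_1 powr_less_mono2[of e bmax 1] e by auto
  \<comment> \<open>\<open>2 powr s\<close> stems from the diameter, at most twice the width; the
    other factor from \<open>cylinder_mass_ge\<close>.\<close>
  define K where "K = 2 powr s * exp (- 3 * D * ln amin)"
  have K: "0 < K" by (simp add: K_def)
  define f where "f L = real (C * L + 1) ^ card rows * q ^ L" for L
  have f0: "0 \<le> f L" for L unfolding f_def using q by simp
  have "summable f" unfolding f_def by (rule summable_power_mult_geometric[OF q])
  then obtain N1 where N1: "\<And>L0 L1. N1 \<le> L0 \<Longrightarrow> norm (sum f {L0..<L1}) < e' / K"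
    using e' K unfolding summable_Cauchy by (meson divide_pos_pos)
  have "(\<lambda>n. 2 * bmax ^ n) \<longlonglongrightarrow> 2 * 0" using bmax_pos bmax_less_1
    by (intro tendsto_mult tendsto_const LIMSEQ_realpow_zero) auto
  from order_tendstoD(2)[OF this, of \<delta>'] \<delta>' obtain N2 where N2: "\<And>n. N2 \<le> n \<Longrightarrow> 2 * bmax ^ n < \<delta>'"
    by (auto simp: eventually_sequentially)
  \<comment> \<open>From \<open>n0\<close> on lengths are regular, from \<open>N1\<close> on tails
    of the series are below \<open>e' / K\<close>, from \<open>N2\<close> on squares are smaller
    than \<delta>'.\<close>
  define L0 where "L0 = max n0 (max N1 N2)"
  define L1 where "L1 = C ^ J * L0"
  \<comment> \<open>A block may come from many codes; one representative is fixed, and its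
    frequencies define the measure used for the block.\<close>
  have "\<forall>L. \<forall>\<beta>\<in>good_blocks \<delta> L. \<exists>\<omega>. good \<delta> L \<omega> \<and> cylinder L (next_index \<omega> L) \<omega> = \<beta>"
    by (auto simp: good_blocks_def)
  then obtain \<rho> where \<rho>: "\<And>L \<beta>. \<beta> \<in> good_blocks \<delta> L \<Longrightarrow> good \<delta> L (\<rho> L \<beta>)"
      "\<And>L \<beta>. \<beta> \<in> good_blocks \<delta> L \<Longrightarrow> cylinder L (next_index (\<rho> L \<beta>) L) (\<rho> L \<beta>) = \<beta>"
    by metis
  have \<rho>c: "\<rho> L \<beta> \<in> codes" if "\<beta> \<in> good_blocks \<delta> L" for L \<beta> using \<rho>(1)[OF that] by (simp add: good_def)
  define V where "V = (\<lambda>(L, \<beta>). rectangle L (next_index (\<rho> L \<beta>) L) (\<rho> L \<beta>))"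
  define I where "I = (SIGMA L:{L0..<Suc L1}. good_blocks \<delta> L)"
  have finb: "finite (good_blocks \<delta> L)" for L using finite_good_blocks[OF less_imp_le[OF C]] .
  have diam: "bounded (V (L, \<beta>))" "diameter (V (L, \<beta>)) \<le> 2 * width (\<rho> L \<beta>) L"
    if "\<beta> \<in> good_blocks \<delta> L" for L \<beta>
    using diameter_rectangle[OF \<rho>c[OF that], of "next_index (\<rho> L \<beta>) L" L]
      row_index_facts(1)[OF \<rho>c[OF that] width_pos[OF \<rho>c[OF that]]]
    by (auto simp: V_def next_index_def)
  have "hausdorff_premeasure \<delta>' s limset \<le> (\<Sum>x\<in>I. ennreal (diameter (V x) powr s))"
  proof (rule hausdorff_premeasure_le_finite_sum)
    show "finite I" unfolding I_def using finb by (intro finite_SigmaI) auto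
    show "0 \<le> \<delta>'" using \<delta>' by simp
    show "limset \<subseteq> (\<Union>x\<in>I. V x)"
    proof
      fix x assume x: "x \<in> limset"
      have n0L0: "n0 \<le> L0" by (simp add: L0_def)
      obtain \<omega> L where \<omega>: "L0 \<le> L" "L \<le> L1" "good \<delta> L \<omega>" "x \<in> rectangle L (next_index \<omega> L) \<omega>"
        using limit_set_covered[OF \<eta>(1) \<eta>1 reg less_imp_le[OF C] \<delta> J n0L0 x] unfolding L1_def by auto
      define \<beta> where "\<beta> = cylinder L (next_index \<omega> L) \<omega>"
      have \<beta>: "\<beta> \<in> good_blocks \<delta> L" using \<omega>(3) by (auto simp: good_blocks_def \<beta>_def)
      have "\<omega> \<in> cylinder L (next_index (\<rho> L \<beta>) L) (\<rho> L \<beta>)"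
        unfolding \<rho>(2)[OF \<beta>] using \<omega>(3) by (auto simp: \<beta>_def good_def intro: cylinder_self)
      from cylinder_rectangle(1)[OF this] next_index_cong[OF this \<rho>c[OF \<beta>]]
      have "x \<in> V (L, \<beta>)" using \<omega>(4) by (simp add: V_def)
      then show "x \<in> (\<Union>x\<in>I. V x)" using \<omega> \<beta> by (intro UN_I[of "(L, \<beta>)"]) (auto simp: I_def)
    qed
    fix x assume "x \<in> I"
    then obtain L \<beta> where x: "x = (L, \<beta>)" "L0 \<le> L" "\<beta> \<in> good_blocks \<delta> L" by (auto simp: I_def)
    have "2 * width (\<rho> L \<beta>) L \<le> 2 * bmax ^ L" using width_bounds(2)[OF \<rho>c[OF x(3)]] by simp
    also have "\<dots> \<le> \<delta>'" using N2[of L] x(2) by (auto simp: L0_def)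
    finally show "bounded (V x) \<and> diameter (V x) \<le> \<delta>'" using diam[OF x(3)] by (simp add: x(1))
  qed
  also have "\<dots> = (\<Sum>L\<in>{L0..<Suc L1}. \<Sum>\<beta>\<in>good_blocks \<delta> L. ennreal (diameter (V (L, \<beta>)) powr s))"
    unfolding I_def using finb by (subst sum.Sigma) (auto simp: case_prod_unfold)
  also have "\<dots> \<le> (\<Sum>L\<in>{L0..<Suc L1}. ennreal (K * f L))"
  proof (intro sum_mono)
    fix L assume L: "L \<in> {L0..<Suc L1}"
    then have n0L: "n0 \<le> L" by (simp add: L0_def)
    define \<mu> where "\<mu> \<beta> = emeasure (code_measure (empirical (next_index (\<rho> L \<beta>) L) (\<rho> L \<beta>))) \<beta>" for \<beta>
    have "(\<Sum>\<beta>\<in>good_blocks \<delta> L. ennreal (diameter (V (L, \<beta>)) powr s)) \<le> (\<Sum>\<beta>\<in>good_blocks \<delta> L. ennreal (K * q ^ L) * \<mu> \<beta>)"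
    proof (intro sum_mono)
      fix \<beta> assume \<beta>: "\<beta> \<in> good_blocks \<delta> L"
      define r where "r = width (\<rho> L \<beta>) L"
      have r: "0 < r" "r \<le> bmax ^ L" unfolding r_def using width_pos[OF \<rho>c[OF \<beta>]] width_bounds(2)[OF \<rho>c[OF \<beta>]] by auto
      have "diameter (V (L, \<beta>)) powr s \<le> (2 * r) powr s"
        using diam[OF \<beta>] D0 s diameter_ge_0 by (intro powr_mono2) (auto simp: r_def)
      also have "\<dots> = 2 powr s * (r powr (D + e) * r powr e)"
        using r by (simp add: powr_mult s_eq flip: powr_add)
      also have "\<dots> \<le> 2 powr s * (r powr (D + e) * q ^ L)"
      proof (intro mult_left_mono)
        have "r powr e \<le> (bmax ^ L) powr e" using r e by (intro powr_mono2) auto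
        also have "\<dots> = q ^ L" unfolding q_def using bmax_pos
          by (simp add: powr_powr powr_realpow[symmetric] mult.commute)
        finally show "r powr e \<le> q ^ L" .
      qed auto
      finally have "ennreal (diameter (V (L, \<beta>)) powr s) \<le> ennreal (2 powr s * q ^ L) * ennreal (r powr (D + e))"
        using q by (simp add: ennreal_mult[symmetric] ennreal_leI mult_ac)
      also have "\<dots> \<le> ennreal (2 powr s * q ^ L) * (ennreal (exp (- 3 * D * ln amin)) * \<mu> \<beta>)"
        using cylinder_mass_ge[OF \<eta> reg n0L \<rho>(1)[OF \<beta>] less_imp_le[OF \<delta>] C0(2) D small]
        unfolding \<rho>(2)[OF \<beta>] \<mu>_def r_def by (intro mult_left_mono) auto
      also have "\<dots> = ennreal (K * q ^ L) * \<mu> \<beta>"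
        unfolding mult.assoc[symmetric] K_def using q by (subst ennreal_mult[symmetric]) (auto simp: mult_ac)
      finally show "ennreal (diameter (V (L, \<beta>)) powr s) \<le> ennreal (K * q ^ L) * \<mu> \<beta>" .
    qed
    also have "\<dots> = ennreal (K * q ^ L) * (\<Sum>\<beta>\<in>good_blocks \<delta> L. \<mu> \<beta>)" by (rule sum_distrib_left[symmetric])
    also have "\<dots> \<le> ennreal (K * q ^ L) * ennreal (real (C * L + 1) ^ card rows)"
      unfolding \<mu>_def by (intro mult_left_mono sum_block_mass_le[OF \<eta>(1) \<eta>1 reg n0L less_imp_le[OF C] \<rho>]) auto
    also have "\<dots> = ennreal (K * f L)"
      using K q by (subst ennreal_mult[symmetric]) (auto simp: f_def mult_ac)
    finally show "(\<Sum>\<beta>\<in>good_blocks \<delta> L. ennreal (diameter (V (L, \<beta>)) powr s)) \<le> ennreal (K * f L)" .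
  qed
  also have "\<dots> = ennreal (K * sum f {L0..<Suc L1})"
    using K f0 by (subst sum_ennreal) (simp_all add: sum_distrib_left del: sum.op_ivl_Suc)
  also have "\<dots> \<le> ennreal e'"
  proof (rule ennreal_leI)
    have "sum f {L0..<Suc L1} < e' / K" using N1[of L0 "Suc L1"] f0 by (simp add: L0_def sum_nonneg abs_of_nonneg)
    then show "K * sum f {L0..<Suc L1} \<le> e'" using K by (simp add: field_simps)
  qed
  finally show "hausdorff_premeasure \<delta>' s limset \<le> ennreal e'" .
qed

end

section \<open>Typical sequences and the vector of full dimension\<close>

context random_carpet
begin

lemma AE_typical:
  "AE seq in bernoulli_measure m p. carpet_sequence m p M N a b c d seq \<and> carpet_sequence.typical m p seq"
proof -
  have seq_space: "carpet_sequence m p M N a b c d seq" if "seq \<in> space (bernoulli_measure m p)" for seq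
  proof unfold_locales
    show "seq l \<in> {1..m}" for l
      using that by (auto simp: bernoulli_measure_def space_PiM space_point_measure PiE_def Pi_def)
  qed
  have "AE seq in bernoulli_measure m p. \<forall>i\<in>{1..m}.
      (\<lambda>n::nat. (\<Sum>l<n. of_bool (seq l = i) - (\<Sum>x\<in>{1..m}. p x * of_bool (x = i))) / real n) \<longlonglongrightarrow> (0::real)"
    unfolding bernoulli_measure_def
  proof (rule AE_finite_allI)
    fix i
    show "AE seq in (\<Pi>\<^sub>M n\<in>UNIV. point_measure {1..m} (\<lambda>i. ennreal (p i))).
      (\<lambda>n::nat. (\<Sum>l<n. of_bool (seq l = i) - (\<Sum>x\<in>{1..m}. p x * of_bool (x = i))) / real n) \<longlonglongrightarrow> (0::real)"
      by (rule slln_product_point_measure[where C = 1 and X = "\<lambda>_ x. of_bool (x = i)" and w = "\<lambda>_. p" and A = "\<lambda>_. {1..m}"])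
        (use p_pos p_sum in \<open>auto intro: less_imp_le\<close>)
  qed simp
  then show ?thesis
    using AE_space
  proof eventually_elim
    case (elim seq)
    then interpret carpet_sequence m p M N a b c d seq by (intro seq_space)
    have "(\<lambda>n. real (letter_count i n) / n) \<longlonglongrightarrow> p i" if i: "i \<in> {1..m}" for i
    proof -
      have "(\<Sum>x\<in>{1..m}. p x * of_bool (x = i)) = p i"
        using i by (simp add: of_bool_def sum.delta' if_distrib cong: if_cong)
      then have "(\<lambda>n::nat. (\<Sum>l<n. of_bool (seq l = i) - p i) / real n) \<longlonglongrightarrow> 0"
        using elim(1) i by auto
      moreover have "(\<Sum>l<n. of_bool (seq l = i)) = real (letter_count i n)" for n :: nat
      proof -
        have "(\<Sum>l<n. of_bool (seq l = i)) = (\<Sum>l\<in>{l\<in>{..<n}. seq l = i}. (1::real))"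
          unfolding of_bool_def by (rule sum.inter_filter[symmetric]) simp
        then show ?thesis by (simp add: letter_count_def)
      qed
      ultimately have "(\<lambda>n. (real (letter_count i n) - real n * p i) / n) \<longlonglongrightarrow> 0"
        by (simp add: sum_subtractf)
      then have "(\<lambda>n. (real (letter_count i n) - real n * p i) / n + p i) \<longlonglongrightarrow> 0 + p i"
        by (intro tendsto_add tendsto_const)
      \<comment> \<open>At n = 0 the two sides are p i and 0, so the equality holds only
        eventually.\<close>
      moreover have "eventually (\<lambda>n. (real (letter_count i n) - real n * p i) / n + p i = real (letter_count i n) / n) sequentially"
        using eventually_gt_at_top[of 0] by eventually_elim (simp add: field_simps)
      ultimately show ?thesis by (simp add: tendsto_cong)
    qed
    then show ?case using carpet_sequence_axioms by (simp add: typical_def)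
  qed
qed

text \<open>The dimension of the measure is at most that of the limit set, and both lie between the
  same bounds D. The maximising vector depends on the parameters only, so it is chosen before the
  sequence.\<close>

lemma exists_full_dimension_vector:
  "\<exists>P\<in>row_weights. AE seq in bernoulli_measure m p.
     hausdorff_dim (limit_set M N a b c d seq) = hausdorff_dim_measure (carpet_measure m p M N a b c d P seq)"
proof -
  obtain P where P: "P \<in> row_weights" and max: "\<And>Q. Q \<in> row_weights \<Longrightarrow> base_dim Q + t_of Q \<le> base_dim P + t_of P"
    using exists_maximal_vector by blast
  have D0: "0 \<le> base_dim P + t_of P" using base_dim_nonneg[OF P] t_of(1)[OF P] by simp
  show ?thesis
  proof (rule bexI[OF _ P])
    show "AE seq in bernoulli_measure m p.
     hausdorff_dim (limit_set M N a b c d seq) = hausdorff_dim_measure (carpet_measure m p M N a b c d P seq)"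
      using AE_typical
    proof eventually_elim
      case (elim seq)
      then interpret carpet_sequence m p M N a b c d seq by simp
      have ty: "typical" using elim by simp
      show ?case
        using limit_set_dim_le[OF ty max D0] carpet_dim_ge[OF P ty] hausdorff_dim_carpet_le[OF P]
        by (intro antisym) auto
    qed
  qed
qed

end

theorem corollaryA:
  fixes m :: nat and p :: "nat \<Rightarrow> real"
    and M :: "nat \<Rightarrow> nat" and N :: "nat \<Rightarrow> nat \<Rightarrow> nat"
  assumes "1 \<le> m"
    and "\<forall>i\<in>{1..m}. 0 < p i" and "(\<Sum>i=1..m. p i) = 1"
    and "\<forall>i\<in>{1..m}. 1 \<le> M i"
    and "\<forall>i\<in>{1..m}. \<forall>j\<in>{1..M i}. 1 \<le> N i j"
  shows "\<exists>\<epsilon>>0. \<forall>(a :: nat \<Rightarrow> nat \<Rightarrow> nat \<Rightarrow> real) (b :: nat \<Rightarrow> nat \<Rightarrow> real)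
            (c :: nat \<Rightarrow> nat \<Rightarrow> nat \<Rightarrow> real) (d :: nat \<Rightarrow> nat \<Rightarrow> real).
      admissible m M N a b c d \<longrightarrow>
      (\<forall>t\<in>{0..1}. \<exists>i\<in>{1..m}. \<exists>j\<in>{1..M i}. \<exists>j'\<in>{1..M i}. j < j' \<and>
         (\<Sum>k=1..N i j. a i j k powr t) \<noteq> (\<Sum>k=1..N i j'. a i j' k powr t)) \<longrightarrow>
      ((\<forall>i\<in>{1..m}. \<exists>\<alpha> \<beta> :: real. 0 < \<alpha> \<and> \<alpha> \<le> \<beta> \<and> \<beta> < 1 \<and>
          (\<forall>(j, k)\<in>row_col M N i.
             inverse (1 + \<epsilon>) < b i j / \<beta> \<and> b i j / \<beta> < 1 + \<epsilon> \<and>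
             inverse (1 + \<epsilon>) < a i j k / \<alpha> \<and> a i j k / \<alpha> < 1 + \<epsilon>)) \<or>
       (\<forall>i\<in>{1..m}. \<forall>(j, k)\<in>row_col M N i. b i j / a i j k < 1 + \<epsilon>)) \<longrightarrow>
      (\<exists>P :: nat \<Rightarrow> nat \<Rightarrow> real.
         (\<forall>i\<in>{1..m}. (\<forall>j\<in>{1..M i}. 0 \<le> P i j) \<and> (\<Sum>j=1..M i. P i j) = p i) \<and>
         (AE seq in bernoulli_measure m p.
            hausdorff_dim (limit_set M N a b c d seq) =
            hausdorff_dim_measure (carpet_measure m p M N a b c d P seq)))"
proof (intro exI[of _ "1::real"] conjI allI impI)
  fix a b c d assume "admissible m M N a b c d"
  then interpret random_carpet m p M N a b c d using assms by unfold_locales auto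
  show "\<exists>P :: nat \<Rightarrow> nat \<Rightarrow> real.
         (\<forall>i\<in>{1..m}. (\<forall>j\<in>{1..M i}. 0 \<le> P i j) \<and> (\<Sum>j=1..M i. P i j) = p i) \<and>
         (AE seq in bernoulli_measure m p.
            hausdorff_dim (limit_set M N a b c d seq) =
            hausdorff_dim_measure (carpet_measure m p M N a b c d P seq))"
    using exists_full_dimension_vector unfolding row_weights_def by blast
qed simp

end
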